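(* Let $\mathbf{C}$ be an rm-adhesive category, let $\mathcal{M}$ be its class of regular monomorphisms, let $X_0$ be an object of $\mathbf{C}$, and let $r_1=(O_1\xleftarrow{o_1}K_1\xrightarrow{i_1}I_1)$ and $r_2=(O_2\xleftarrow{o_2}K_2\xrightarrow{i_2}I_2)$ be arbitrary spans in $\mathbf{C}$. 1. (Synthesis) For every DPO-admissible match $m_1$ of $r_1$ into $X_0$ and every DPO-admissible match $m_2$ of $r_2$ into $X_1:=r_{1_{m_1}}(X_0)$, there exist a DPO-admissible match $\mu$ of $r_2$ into $r_1$ and a DPO-admissible match $m_{21}$ of the composite rule $r_{21}:=r_2\,{}^{\mu}\!\circledcirc\,r_1$ into $X_0$ such that $r_{21_{m_{21}}}(X_0)\cong r_{2_{m_2}}(r_{1_{m_1}}(X_0))$. 2. (Analysis) For every DPO-admissible match $\mu$ of $r_2$ into $r_1$ and every DPO-admissible match $m_{21}$ of $r_{21}:=r_2\,{}^{\mu}\!\circledcirc\,r_1$ into $X_0$, there exist a DPO-admissible match $m_1$ of $r_1$ into $X_0$ and a DPO-admissible match $m_2$ of $r_2$ into $r_{1_{m_1}}(X_0)$ such that $r_{2_{m_2}}(r_{1_{m_1}}(X_0))\cong r_{21_{m_{21}}}(X_0)$. 3. (Compatibility) If in addition $\mathbf{C}$ is finitary (every object has only finitely many regular subobjects up to isomorphism), the set of pairs $(m_1,m_2)$ and the set of pairs $(\mu,m_{21})$ are in bijection once the former is quotiented by the universal isomorphisms of $X_1=r_{1_{m_1}}(X_0)$ and $X_2=r_{2_{m_2}}(X_1)$,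 and the latter by the universal isomorphisms of multi-sums and multi-pushout complements.
   Context: A quasi-topos is a category with finite limits and colimits, locally Cartesian closed, with a regular-subobject classifier; it has an (epi, regular mono)-factorization. An rm-adhesive category is (as in the paper) a quasi-topos in which pushouts along regular monomorphisms are van Kampen squares. $\mathcal{M}$ = regular monos. Multi-sum $\mathrm{Msum}(A,B)$: a family of cospans $A\xrightarrow{f}Y\xleftarrow{g}B$ with $f,g\in\mathcal{M}$ such that for every cospan $A\xrightarrow{a}Z\xleftarrow{b}B$ with $a,b\in\mathcal{M}$ there exist an element $(f,g)$ and $y:Y\to Z$ in $\mathcal{M}$ with $a=y\circ f$, $b=y\circ g$, unique up to universal isomorphism. Multi-pushout complement: for $A\xrightarrow{f}B\xrightarrow{b}D$ with $b\in\mathcal{M}$, $\mathrm{mPOC}(f,b)$ is the set of pairs $(A\xrightarrow{a}P,P\xrightarrow{d}D)$ with $a\in\mathcal{M}$ such that $(b,d)$ is a pushout of $(f,a)$, i.e. $B\xrightarrow{b}D\xleftarrow{d}P$ is a pushout of $B\xleftarrow{f}A\xrightarrow{a}P$. DPO direct derivation: a DPO-admissible match of $r=(O\xleftarrow{o}K\xrightarrow{i}I)$ into $X$ is a triple $(m,\bar m,\bar i)$ with $m:I\to X$ in $\mathcal{M}$ and $(\bar m:K\to\bar X,\ \bar i:\bar X\to X)\in\mathrm{mPOC}(i,m)$; the result $r_m(X)$ is the pushout of $O\xleftarrow{o}K\xrightarrow{\bar m}\bar X$. DPO-admissible matches of $r_2$ into $r_1$: tuples $(j_2,j_1,\bar j_2,\bar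 i_2,\bar j_1,\bar o_1)$ with $(j_2:I_2\to J_{21},j_1:O_1\to J_{21})\in\mathrm{Msum}(I_2,O_1)$, $(\bar j_2:K_2\to\bar K_2,\ \bar i_2:\bar K_2\to J_{21})\in\mathrm{mPOC}(i_2,j_2)$ and $(\bar j_1:K_1\to\bar K_1,\ \bar o_1:\bar K_1\to J_{21})\in\mathrm{mPOC}(o_1,j_1)$, modulo compatible universal isomorphisms of multi-sums and multi-POCs. DPO rule composition: let $O_{21}$ be the pushout of $O_2\xleftarrow{o_2}K_2\xrightarrow{\bar j_2}\bar K_2$ and $I_{21}$ the pushout of $I_1\xleftarrow{i_1}K_1\xrightarrow{\bar j_1}\bar K_1$; the composite rule $r_2\,{}^{\mu}\!\circledcirc\,r_1$ is the span composite (via pullback over $J_{21}$) of $(O_{21}\leftarrow\bar K_2\xrightarrow{\bar i_2}J_{21})$ and $(J_{21}\xleftarrow{\bar o_1}\bar K_1\to I_{21})$. *)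

theory Defs
  imports Main
begin

section \<open>Categories\<close>

record ('o, 'a) cat =
  Obj :: "'o set"
  Arr :: "'a set"
  Src :: "'a \<Rightarrow> 'o"
  Tgt :: "'a \<Rightarrow> 'o"
  Ident :: "'o \<Rightarrow> 'a"
  Cmp :: "'a \<Rightarrow> 'a \<Rightarrow> 'a"  (infixl "\<odot>\<index>" 70)

text \<open>Composition is in applicative order: \<open>g \<odot>\<^bsub>C\<^esub> f\<close> is \<open>g\<close> after \<open>f\<close>.\<close>

definition hom :: "('o, 'a, 'x) cat_scheme \<Rightarrow> 'o \<Rightarrow> 'o \<Rightarrow> 'a set" where
  "hom C A B = {f \<in> Arr C. Src C f = A \<and> Tgt C f = B}"

definition category :: "('o, 'a, 'x) cat_scheme \<Rightarrow> bool" where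
  "category C \<longleftrightarrow>
     (\<forall>f\<in>Arr C. Src C f \<in> Obj C \<and> Tgt C f \<in> Obj C) \<and>
     (\<forall>A\<in>Obj C. Ident C A \<in> hom C A A) \<and>
     (\<forall>A B D. \<forall>f\<in>hom C A B. \<forall>g\<in>hom C B D. g \<odot>\<^bsub>C\<^esub> f \<in> hom C A D) \<and>
     (\<forall>A B. \<forall>f\<in>hom C A B. f \<odot>\<^bsub>C\<^esub> Ident C A = f \<and> Ident C B \<odot>\<^bsub>C\<^esub> f = f) \<and>
     (\<forall>A B D E. \<forall>f\<in>hom C A B. \<forall>g\<in>hom C B D. \<forall>h\<in>hom C D E.
        h \<odot>\<^bsub>C\<^esub> (g \<odot>\<^bsub>C\<^esub> f) = (h \<odot>\<^bsub>C\<^esub> g) \<odot>\<^bsub>C\<^esub> f)"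

definition isos :: "('o, 'a, 'x) cat_scheme \<Rightarrow> 'o \<Rightarrow> 'o \<Rightarrow> 'a set" where
  "isos C A B = {f \<in> hom C A B. \<exists>g\<in>hom C B A. g \<odot>\<^bsub>C\<^esub> f = Ident C A \<and> f \<odot>\<^bsub>C\<^esub> g = Ident C B}"

definition isomorphic :: "('o, 'a, 'x) cat_scheme \<Rightarrow> 'o \<Rightarrow> 'o \<Rightarrow> bool" where
  "isomorphic C A B \<longleftrightarrow> isos C A B \<noteq> {}"


section \<open>Finite limits and colimits\<close>

text \<open>
  A finite diagram is given by a finite graph: a finite set \<open>V\<close> of vertices labelled with objects
  by \<open>D\<close>, and a finite set \<open>E\<close> of edges \<open>(v, f, w)\<close> labelled with arrows. (Parallel edges with
  the same label impose the same condition on cones, so they need not be distinguished.)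
\<close>

definition finite_diagram ::
    "('o, 'a, 'x) cat_scheme \<Rightarrow> nat set \<Rightarrow> (nat \<Rightarrow> 'o) \<Rightarrow> (nat \<times> 'a \<times> nat) set \<Rightarrow> bool" where
  "finite_diagram C V D E \<longleftrightarrow>
     finite V \<and> finite E \<and> (\<forall>v\<in>V. D v \<in> Obj C) \<and>
     (\<forall>(v, f, w)\<in>E. v \<in> V \<and> w \<in> V \<and> f \<in> hom C (D v) (D w))"

definition is_cone ::
    "('o, 'a, 'x) cat_scheme \<Rightarrow> nat set \<Rightarrow> (nat \<Rightarrow> 'o) \<Rightarrow> (nat \<times> 'a \<times> nat) set \<Rightarrow>
     'o \<Rightarrow> (nat \<Rightarrow> 'a) \<Rightarrow> bool" where
  "is_cone C V D E L p \<longleftrightarrow>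
     L \<in> Obj C \<and> (\<forall>v\<in>V. p v \<in> hom C L (D v)) \<and> (\<forall>(v, f, w)\<in>E. f \<odot>\<^bsub>C\<^esub> p v = p w)"

definition is_limit ::
    "('o, 'a, 'x) cat_scheme \<Rightarrow> nat set \<Rightarrow> (nat \<Rightarrow> 'o) \<Rightarrow> (nat \<times> 'a \<times> nat) set \<Rightarrow>
     'o \<Rightarrow> (nat \<Rightarrow> 'a) \<Rightarrow> bool" where
  "is_limit C V D E L p \<longleftrightarrow>
     is_cone C V D E L p \<and>
     (\<forall>M q. is_cone C V D E M q \<longrightarrow> (\<exists>!u. u \<in> hom C M L \<and> (\<forall>v\<in>V. p v \<odot>\<^bsub>C\<^esub> u = q v)))"

definition is_cocone ::
    "('o, 'a, 'x) cat_scheme \<Rightarrow> nat set \<Rightarrow> (nat \<Rightarrow> 'o) \<Rightarrow> (nat \<times> 'a \<times> nat) set \<Rightarrow>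
     'o \<Rightarrow> (nat \<Rightarrow> 'a) \<Rightarrow> bool" where
  "is_cocone C V D E L p \<longleftrightarrow>
     L \<in> Obj C \<and> (\<forall>v\<in>V. p v \<in> hom C (D v) L) \<and> (\<forall>(v, f, w)\<in>E. p w \<odot>\<^bsub>C\<^esub> f = p v)"

definition is_colimit ::
    "('o, 'a, 'x) cat_scheme \<Rightarrow> nat set \<Rightarrow> (nat \<Rightarrow> 'o) \<Rightarrow> (nat \<times> 'a \<times> nat) set \<Rightarrow>
     'o \<Rightarrow> (nat \<Rightarrow> 'a) \<Rightarrow> bool" where
  "is_colimit C V D E L p \<longleftrightarrow>
     is_cocone C V D E L p \<and>
     (\<forall>M q. is_cocone C V D E M q \<longrightarrow> (\<exists>!u. u \<in> hom C L M \<and> (\<forall>v\<in>V. u \<odot>\<^bsub>C\<^esub> p v = q v)))"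

definition has_finite_limits :: "('o, 'a, 'x) cat_scheme \<Rightarrow> bool" where
  "has_finite_limits C \<longleftrightarrow> (\<forall>V D E. finite_diagram C V D E \<longrightarrow> (\<exists>L p. is_limit C V D E L p))"

definition has_finite_colimits :: "('o, 'a, 'x) cat_scheme \<Rightarrow> bool" where
  "has_finite_colimits C \<longleftrightarrow> (\<forall>V D E. finite_diagram C V D E \<longrightarrow> (\<exists>L p. is_colimit C V D E L p))"


section \<open>Pushouts, pullbacks, regular monomorphisms\<close>

definition commuting_square :: "('o, 'a, 'x) cat_scheme \<Rightarrow> 'a \<Rightarrow> 'a \<Rightarrow> 'a \<Rightarrow> 'a \<Rightarrow> bool" where
  "commuting_square C f g p q \<longleftrightarrow>
     f \<in> Arr C \<and> g \<in> Arr C \<and> p \<in> Arr C \<and> q \<in> Arr C \<and>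
     Src C f = Src C g \<and> Src C p = Tgt C f \<and> Src C q = Tgt C g \<and> Tgt C p = Tgt C q \<and>
     p \<odot>\<^bsub>C\<^esub> f = q \<odot>\<^bsub>C\<^esub> g"

text \<open>\<open>is_pushout C f g p q\<close>: the cospan \<open>(p, q)\<close> is a pushout of the span \<open>(f, g)\<close>, \<open>p f = q g\<close>.\<close>

definition is_pushout :: "('o, 'a, 'x) cat_scheme \<Rightarrow> 'a \<Rightarrow> 'a \<Rightarrow> 'a \<Rightarrow> 'a \<Rightarrow> bool" where
  "is_pushout C f g p q \<longleftrightarrow>
     commuting_square C f g p q \<and>
     (\<forall>x y. commuting_square C f g x y \<longrightarrow>
        (\<exists>!u. u \<in> hom C (Tgt C p) (Tgt C x) \<and> u \<odot>\<^bsub>C\<^esub> p = x \<and> u \<odot>\<^bsub>C\<^esub> q = y))"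

text \<open>\<open>is_pullback C f g p q\<close>: the span \<open>(p, q)\<close> is a pullback of the cospan \<open>(f, g)\<close>, \<open>f p = g q\<close>.\<close>

definition is_pullback :: "('o, 'a, 'x) cat_scheme \<Rightarrow> 'a \<Rightarrow> 'a \<Rightarrow> 'a \<Rightarrow> 'a \<Rightarrow> bool" where
  "is_pullback C f g p q \<longleftrightarrow>
     commuting_square C p q f g \<and>
     (\<forall>x y. commuting_square C x y f g \<longrightarrow>
        (\<exists>!u. u \<in> hom C (Src C x) (Src C p) \<and> p \<odot>\<^bsub>C\<^esub> u = x \<and> q \<odot>\<^bsub>C\<^esub> u = y))"

definition is_equalizer :: "('o, 'a, 'x) cat_scheme \<Rightarrow> 'a \<Rightarrow> 'a \<Rightarrow> 'a \<Rightarrow> bool" where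
  "is_equalizer C f g e \<longleftrightarrow>
     f \<in> Arr C \<and> g \<in> Arr C \<and> e \<in> Arr C \<and>
     Src C f = Tgt C e \<and> Src C g = Tgt C e \<and> Tgt C f = Tgt C g \<and> f \<odot>\<^bsub>C\<^esub> e = g \<odot>\<^bsub>C\<^esub> e \<and>
     (\<forall>h\<in>Arr C. Tgt C h = Tgt C e \<and> f \<odot>\<^bsub>C\<^esub> h = g \<odot>\<^bsub>C\<^esub> h \<longrightarrow>
        (\<exists>!k. k \<in> hom C (Src C h) (Src C e) \<and> e \<odot>\<^bsub>C\<^esub> k = h))"

definition regular_mono :: "('o, 'a, 'x) cat_scheme \<Rightarrow> 'a \<Rightarrow> bool" where
  "regular_mono C e \<longleftrightarrow> (\<exists>f g. is_equalizer C f g e)"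


section \<open>Quasi-toposes and rm-adhesive categories\<close>

definition is_terminal :: "('o, 'a, 'x) cat_scheme \<Rightarrow> 'o \<Rightarrow> bool" where
  "is_terminal C T \<longleftrightarrow> T \<in> Obj C \<and> (\<forall>A\<in>Obj C. \<exists>!t. t \<in> hom C A T)"

definition is_product :: "('o, 'a, 'x) cat_scheme \<Rightarrow> 'o \<Rightarrow> 'o \<Rightarrow> 'o \<Rightarrow> 'a \<Rightarrow> 'a \<Rightarrow> bool" where
  "is_product C A B P p q \<longleftrightarrow>
     p \<in> hom C P A \<and> q \<in> hom C P B \<and>
     (\<forall>Z. \<forall>x\<in>hom C Z A. \<forall>y\<in>hom C Z B. \<exists>!u. u \<in> hom C Z P \<and> p \<odot>\<^bsub>C\<^esub> u = x \<and> q \<odot>\<^bsub>C\<^esub> u = y)"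

text \<open>
  \<open>W\<close> with evaluation \<open>ev : W \<times> A \<rightarrow> B\<close> is an exponential of \<open>B\<close> by \<open>A\<close>. Here \<open>(P, p, q)\<close> is the
  product \<open>W \<times> A\<close>, and the arrow \<open>h\<close> below is \<open>g \<times> id\<^sub>A\<close>.
\<close>

definition is_exponential ::
    "('o, 'a, 'x) cat_scheme \<Rightarrow> 'o \<Rightarrow> 'o \<Rightarrow> 'o \<Rightarrow> 'o \<Rightarrow> 'a \<Rightarrow> 'a \<Rightarrow> 'a \<Rightarrow> bool" where
  "is_exponential C A B W P p q ev \<longleftrightarrow>
     is_product C W A P p q \<and> ev \<in> hom C P B \<and>
     (\<forall>Z Q s t. is_product C Z A Q s t \<longrightarrow>
        (\<forall>f\<in>hom C Q B. \<exists>!g. g \<in> hom C Z W \<and>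
           (\<exists>h\<in>hom C Q P. p \<odot>\<^bsub>C\<^esub> h = g \<odot>\<^bsub>C\<^esub> s \<and> q \<odot>\<^bsub>C\<^esub> h = t \<and> ev \<odot>\<^bsub>C\<^esub> h = f)))"

definition cartesian_closed :: "('o, 'a, 'x) cat_scheme \<Rightarrow> bool" where
  "cartesian_closed C \<longleftrightarrow>
     (\<exists>T. is_terminal C T) \<and>
     (\<forall>A\<in>Obj C. \<forall>B\<in>Obj C. \<exists>P p q. is_product C A B P p q) \<and>
     (\<forall>A\<in>Obj C. \<forall>B\<in>Obj C. \<exists>W P p q ev. is_exponential C A B W P p q ev)"

text \<open>An arrow \<open>f \<rightarrow> g\<close> of the slice over \<open>X\<close> is a triple \<open>(f, h, g)\<close> with \<open>g h = f\<close>.\<close>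

definition slice :: "('o, 'a, 'x) cat_scheme \<Rightarrow> 'o \<Rightarrow> ('a, 'a \<times> 'a \<times> 'a) cat" where
  "slice C X =
     \<lparr>Obj = {f \<in> Arr C. Tgt C f = X},
      Arr = {(f, h, g). f \<in> Arr C \<and> Tgt C f = X \<and> g \<in> Arr C \<and> Tgt C g = X \<and>
                        h \<in> hom C (Src C f) (Src C g) \<and> g \<odot>\<^bsub>C\<^esub> h = f},
      Src = (\<lambda>(f, h, g). f),
      Tgt = (\<lambda>(f, h, g). g),
      Ident = (\<lambda>f. (f, Ident C (Src C f), f)),
      Cmp = (\<lambda>(f', k, g') (f, h, g). (f, k \<odot>\<^bsub>C\<^esub> h, g'))\<rparr>"

definition locally_cartesian_closed :: "('o, 'a, 'x) cat_scheme \<Rightarrow> bool" where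
  "locally_cartesian_closed C \<longleftrightarrow> (\<forall>X\<in>Obj C. cartesian_closed (slice C X))"

definition has_regular_subobject_classifier :: "('o, 'a, 'x) cat_scheme \<Rightarrow> bool" where
  "has_regular_subobject_classifier C \<longleftrightarrow>
     (\<exists>T \<Omega> tr. is_terminal C T \<and> tr \<in> hom C T \<Omega> \<and>
        (\<forall>m. regular_mono C m \<longrightarrow>
           (\<exists>!\<chi>. \<chi> \<in> hom C (Tgt C m) \<Omega> \<and> (\<exists>t\<in>hom C (Src C m) T. is_pullback C \<chi> tr m t))))"

definition quasi_topos :: "('o, 'a, 'x) cat_scheme \<Rightarrow> bool" where
  "quasi_topos C \<longleftrightarrow>
     category C \<and> has_finite_limits C \<and> has_finite_colimits C \<and>
     locally_cartesian_closed C \<and> has_regular_subobject_classifier C"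

text \<open>
  The pushout square \<open>p f = q m\<close> is the bottom of the cube, the commuting square \<open>p' f' = q' m'\<close>
  its top, and \<open>a\<close>, \<open>b\<close>, \<open>d\<close>, \<open>e\<close> are the vertical arrows from top to bottom.
\<close>

definition van_kampen :: "('o, 'a, 'x) cat_scheme \<Rightarrow> 'a \<Rightarrow> 'a \<Rightarrow> 'a \<Rightarrow> 'a \<Rightarrow> bool" where
  "van_kampen C f m p q \<longleftrightarrow>
     is_pushout C f m p q \<and>
     (\<forall>f' m' p' q' a b d e.
        commuting_square C f' m' p' q' \<and>
        is_pullback C f b a f' \<and> is_pullback C m d a m' \<and>
        e \<in> hom C (Tgt C p') (Tgt C p) \<and> e \<odot>\<^bsub>C\<^esub> p' = p \<odot>\<^bsub>C\<^esub> b \<and> e \<odot>\<^bsub>C\<^esub> q' = q \<odot>\<^bsub>C\<^esub> d \<longrightarrow>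
        (is_pushout C f' m' p' q' \<longleftrightarrow> is_pullback C p e b p' \<and> is_pullback C q e d q'))"

definition rm_adhesive :: "('o, 'a, 'x) cat_scheme \<Rightarrow> bool" where
  "rm_adhesive C \<longleftrightarrow>
     quasi_topos C \<and>
     (\<forall>f m p q. regular_mono C m \<and> is_pushout C f m p q \<longrightarrow> van_kampen C f m p q)"

definition regular_subobject_equiv :: "('o, 'a, 'x) cat_scheme \<Rightarrow> 'o \<Rightarrow> ('a \<times> 'a) set" where
  "regular_subobject_equiv C X =
     {(m, n). regular_mono C m \<and> Tgt C m = X \<and> regular_mono C n \<and> Tgt C n = X \<and>
              (\<exists>\<phi>\<in>isos C (Src C m) (Src C n). n \<odot>\<^bsub>C\<^esub> \<phi> = m)}"

definition finitary :: "('o, 'a, 'x) cat_scheme \<Rightarrow> bool" where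
  "finitary C \<longleftrightarrow>
     (\<forall>X\<in>Obj C. finite ({m. regular_mono C m \<and> Tgt C m = X} // regular_subobject_equiv C X))"


section \<open>Multi-sums, multi-pushout complements, chosen pushouts and pullbacks\<close>

definition is_multi_sum :: "('o, 'a, 'x) cat_scheme \<Rightarrow> 'o \<Rightarrow> 'o \<Rightarrow> ('a \<times> 'a) set \<Rightarrow> bool" where
  "is_multi_sum C A B S \<longleftrightarrow>
     (\<forall>(f, g)\<in>S. regular_mono C f \<and> regular_mono C g \<and>
        Src C f = A \<and> Src C g = B \<and> Tgt C f = Tgt C g) \<and>
     (\<forall>a b. regular_mono C a \<and> regular_mono C b \<and> Src C a = A \<and> Src C b = B \<and> Tgt C a = Tgt C b \<longrightarrow>
        (\<exists>(f, g)\<in>S. \<exists>y\<in>hom C (Tgt C f) (Tgt C a).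
           regular_mono C y \<and> y \<odot>\<^bsub>C\<^esub> f = a \<and> y \<odot>\<^bsub>C\<^esub> g = b) \<and>
        (\<forall>(f, g)\<in>S. \<forall>(f', g')\<in>S. \<forall>y\<in>hom C (Tgt C f) (Tgt C a). \<forall>y'\<in>hom C (Tgt C f') (Tgt C a).
           regular_mono C y \<and> y \<odot>\<^bsub>C\<^esub> f = a \<and> y \<odot>\<^bsub>C\<^esub> g = b \<and>
           regular_mono C y' \<and> y' \<odot>\<^bsub>C\<^esub> f' = a \<and> y' \<odot>\<^bsub>C\<^esub> g' = b \<longrightarrow>
           (\<exists>!\<phi>. \<phi> \<in> isos C (Tgt C f) (Tgt C f') \<and>
              \<phi> \<odot>\<^bsub>C\<^esub> f = f' \<and> \<phi> \<odot>\<^bsub>C\<^esub> g = g' \<and> y' \<odot>\<^bsub>C\<^esub> \<phi> = y)))"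

text \<open>
  Multi-sums, pushouts and pullbacks are determined up to universal isomorphism only; as usual,
  one of each is chosen once and for all.
\<close>

definition Msum :: "('o, 'a, 'x) cat_scheme \<Rightarrow> 'o \<Rightarrow> 'o \<Rightarrow> ('a \<times> 'a) set" where
  "Msum C A B = (SOME S. is_multi_sum C A B S)"

definition po :: "('o, 'a, 'x) cat_scheme \<Rightarrow> 'a \<Rightarrow> 'a \<Rightarrow> 'a \<times> 'a" where
  "po C f g = (SOME (p, q). is_pushout C f g p q)"

definition pb :: "('o, 'a, 'x) cat_scheme \<Rightarrow> 'a \<Rightarrow> 'a \<Rightarrow> 'a \<times> 'a" where
  "pb C f g = (SOME (p, q). is_pullback C f g p q)"

definition mPOC :: "('o, 'a, 'x) cat_scheme \<Rightarrow> 'a \<Rightarrow> 'a \<Rightarrow> ('a \<times> 'a) set" where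
  "mPOC C f b = {(a, d). regular_mono C a \<and> is_pushout C f a b d}"


section \<open>Double-pushout rewriting\<close>

text \<open>
  A rule \<open>O \<leftarrow> K \<rightarrow> I\<close> is the pair \<open>(o, i)\<close> of its legs, the output leg first.
\<close>

definition is_span :: "('o, 'a, 'x) cat_scheme \<Rightarrow> 'a \<times> 'a \<Rightarrow> bool" where
  "is_span C = (\<lambda>(u, i). u \<in> Arr C \<and> i \<in> Arr C \<and> Src C u = Src C i)"

definition span_comp :: "('o, 'a, 'x) cat_scheme \<Rightarrow> 'a \<times> 'a \<Rightarrow> 'a \<times> 'a \<Rightarrow> 'a \<times> 'a" where
  "span_comp C = (\<lambda>(u, v) (w, x). let (p, q) = pb C v w in (u \<odot>\<^bsub>C\<^esub> p, x \<odot>\<^bsub>C\<^esub> q))"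

text \<open>
  In the definitions below \<open>mb\<close>, \<open>ib\<close>, \<open>jb2\<close>, \<open>ob1\<close> etc. stand for the barred arrows
  \<open>m\<close>-bar, \<open>i\<close>-bar, \<open>j\<^sub>2\<close>-bar, \<open>o\<^sub>1\<close>-bar.
\<close>

definition dpo_matches :: "('o, 'a, 'x) cat_scheme \<Rightarrow> 'a \<times> 'a \<Rightarrow> 'o \<Rightarrow> ('a \<times> 'a \<times> 'a) set" where
  "dpo_matches C = (\<lambda>(u, i) X.
     {(m, mb, ib). regular_mono C m \<and> m \<in> hom C (Tgt C i) X \<and> (mb, ib) \<in> mPOC C i m})"

definition dpo_result :: "('o, 'a, 'x) cat_scheme \<Rightarrow> 'a \<times> 'a \<Rightarrow> 'a \<times> 'a \<times> 'a \<Rightarrow> 'o" where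
  "dpo_result C = (\<lambda>(u, i) (m, mb, ib). Tgt C (fst (po C u mb)))"

type_synonym 'a rule_match = "'a \<times> 'a \<times> 'a \<times> 'a \<times> 'a \<times> 'a"

text \<open>A match of \<open>r\<^sub>2\<close> into \<open>r\<^sub>1\<close>; passing to classes under universal isomorphisms is done below.\<close>

definition dpo_rule_matches ::
    "('o, 'a, 'x) cat_scheme \<Rightarrow> 'a \<times> 'a \<Rightarrow> 'a \<times> 'a \<Rightarrow> 'a rule_match set" where
  "dpo_rule_matches C = (\<lambda>(o2, i2) (o1, i1).
     {(j2, j1, jb2, ib2, jb1, ob1).
        (j2, j1) \<in> Msum C (Tgt C i2) (Tgt C o1) \<and>
        (jb2, ib2) \<in> mPOC C i2 j2 \<and> (jb1, ob1) \<in> mPOC C o1 j1})"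

definition dpo_compose ::
    "('o, 'a, 'x) cat_scheme \<Rightarrow> 'a \<times> 'a \<Rightarrow> 'a rule_match \<Rightarrow> 'a \<times> 'a \<Rightarrow> 'a \<times> 'a" where
  "dpo_compose C = (\<lambda>(o2, i2) (j2, j1, jb2, ib2, jb1, ob1) (o1, i1).
     span_comp C (snd (po C o2 jb2), ib2) (ob1, snd (po C i1 jb1)))"


section \<open>The two sets of pairs and their universal isomorphisms\<close>

definition match_sequences ::
    "('o, 'a, 'x) cat_scheme \<Rightarrow> 'a \<times> 'a \<Rightarrow> 'a \<times> 'a \<Rightarrow> 'o \<Rightarrow>
     (('a \<times> 'a \<times> 'a) \<times> ('a \<times> 'a \<times> 'a)) set" where
  "match_sequences C r2 r1 X0 =
     {(m1, m2). m1 \<in> dpo_matches C r1 X0 \<and> m2 \<in> dpo_matches C r2 (dpo_result C r1 m1)}"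

definition composite_matches ::
    "('o, 'a, 'x) cat_scheme \<Rightarrow> 'a \<times> 'a \<Rightarrow> 'a \<times> 'a \<Rightarrow> 'o \<Rightarrow>
     ('a rule_match \<times> ('a \<times> 'a \<times> 'a)) set" where
  "composite_matches C r2 r1 X0 =
     {(\<mu>, m21). \<mu> \<in> dpo_rule_matches C r2 r1 \<and> m21 \<in> dpo_matches C (dpo_compose C r2 \<mu> r1) X0}"

text \<open>
  Isomorphism of the two-step derivations \<open>X\<^sub>0 \<Rightarrow> X\<^sub>1 \<Rightarrow> X\<^sub>2\<close> determined by two pairs of matches,
  fixing \<open>X\<^sub>0\<close> and the rules: \<open>\<alpha>\<close> and \<open>\<beta>\<close> relate the pushout complements of the two steps,
  \<open>\<xi>\<close> and \<open>\<zeta>\<close> are the induced isomorphisms of \<open>X\<^sub>1\<close> and \<open>X\<^sub>2\<close>.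
\<close>

definition sequence_equiv ::
    "('o, 'a, 'x) cat_scheme \<Rightarrow> 'a \<times> 'a \<Rightarrow> 'a \<times> 'a \<Rightarrow> 'o \<Rightarrow>
     ((('a \<times> 'a \<times> 'a) \<times> ('a \<times> 'a \<times> 'a)) \<times> (('a \<times> 'a \<times> 'a) \<times> ('a \<times> 'a \<times> 'a))) set" where
  "sequence_equiv C = (\<lambda>(o2, i2) (o1, i1) X0.
     {(((m1, mb1, ib1), (m2, mb2, ib2)), ((m1', mb1', ib1'), (m2', mb2', ib2'))).
        ((m1, mb1, ib1), (m2, mb2, ib2)) \<in> match_sequences C (o2, i2) (o1, i1) X0 \<and>
        ((m1', mb1', ib1'), (m2', mb2', ib2')) \<in> match_sequences C (o2, i2) (o1, i1) X0 \<and>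
        m1 = m1' \<and>
        (let (n1, d1) = po C o1 mb1; (n1', d1') = po C o1 mb1';
             (n2, d2) = po C o2 mb2; (n2', d2') = po C o2 mb2' in
         \<exists>\<alpha> \<in> isos C (Tgt C mb1) (Tgt C mb1').
         \<exists>\<xi> \<in> isos C (Tgt C n1) (Tgt C n1').
         \<exists>\<beta> \<in> isos C (Tgt C mb2) (Tgt C mb2').
         \<exists>\<zeta> \<in> isos C (Tgt C n2) (Tgt C n2').
           \<alpha> \<odot>\<^bsub>C\<^esub> mb1 = mb1' \<and> ib1' \<odot>\<^bsub>C\<^esub> \<alpha> = ib1 \<and>
           \<xi> \<odot>\<^bsub>C\<^esub> n1 = n1' \<and> \<xi> \<odot>\<^bsub>C\<^esub> d1 = d1' \<odot>\<^bsub>C\<^esub> \<alpha> \<and>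
           \<xi> \<odot>\<^bsub>C\<^esub> m2 = m2' \<and>
           \<beta> \<odot>\<^bsub>C\<^esub> mb2 = mb2' \<and> ib2' \<odot>\<^bsub>C\<^esub> \<beta> = \<xi> \<odot>\<^bsub>C\<^esub> ib2 \<and>
           \<zeta> \<odot>\<^bsub>C\<^esub> n2 = n2' \<and> \<zeta> \<odot>\<^bsub>C\<^esub> d2 = d2' \<odot>\<^bsub>C\<^esub> \<beta>)})"

text \<open>
  Here \<open>\<psi>\<close> is a universal isomorphism of multi-sums, \<open>\<kappa>2\<close>, \<open>\<kappa>1\<close> and \<open>\<chi>\<close> are isomorphisms of
  multi-pushout complements (two for the match of rules, one for the match into \<open>X\<^sub>0\<close>), and
  \<open>\<iota>\<close> and \<open>\<kappa>\<close> are the isomorphisms they induce between the inputs \<open>I\<^sub>2\<^sub>1\<close> and between the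
  apexes \<open>K\<^sub>2\<^sub>1\<close> of the two composite rules.
\<close>

definition composite_equiv ::
    "('o, 'a, 'x) cat_scheme \<Rightarrow> 'a \<times> 'a \<Rightarrow> 'a \<times> 'a \<Rightarrow> 'o \<Rightarrow>
     (('a rule_match \<times> ('a \<times> 'a \<times> 'a)) \<times> ('a rule_match \<times> ('a \<times> 'a \<times> 'a))) set" where
  "composite_equiv C = (\<lambda>(o2, i2) (o1, i1) X0.
     {(((j2, j1, jb2, ib2, jb1, ob1), (m, mb, ib)),
       ((j2', j1', jb2', ib2', jb1', ob1'), (m', mb', ib'))).
        ((j2, j1, jb2, ib2, jb1, ob1), (m, mb, ib))
          \<in> composite_matches C (o2, i2) (o1, i1) X0 \<and>
        ((j2', j1', jb2', ib2', jb1', ob1'), (m', mb', ib'))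
          \<in> composite_matches C (o2, i2) (o1, i1) X0 \<and>
        (let (s, t) = po C i1 jb1; (s', t') = po C i1 jb1';
             (p, q) = pb C ib2 ob1; (p', q') = pb C ib2' ob1' in
         \<exists>\<psi> \<in> isos C (Tgt C j2) (Tgt C j2').
         \<exists>\<kappa>2 \<in> isos C (Tgt C jb2) (Tgt C jb2').
         \<exists>\<kappa>1 \<in> isos C (Tgt C jb1) (Tgt C jb1').
         \<exists>\<iota> \<in> isos C (Tgt C s) (Tgt C s').
         \<exists>\<kappa> \<in> isos C (Src C p) (Src C p').
         \<exists>\<chi> \<in> isos C (Tgt C mb) (Tgt C mb').
           \<psi> \<odot>\<^bsub>C\<^esub> j2 = j2' \<and> \<psi> \<odot>\<^bsub>C\<^esub> j1 = j1' \<and>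
           \<kappa>2 \<odot>\<^bsub>C\<^esub> jb2 = jb2' \<and> ib2' \<odot>\<^bsub>C\<^esub> \<kappa>2 = \<psi> \<odot>\<^bsub>C\<^esub> ib2 \<and>
           \<kappa>1 \<odot>\<^bsub>C\<^esub> jb1 = jb1' \<and> ob1' \<odot>\<^bsub>C\<^esub> \<kappa>1 = \<psi> \<odot>\<^bsub>C\<^esub> ob1 \<and>
           \<iota> \<odot>\<^bsub>C\<^esub> s = s' \<and> \<iota> \<odot>\<^bsub>C\<^esub> t = t' \<odot>\<^bsub>C\<^esub> \<kappa>1 \<and>
           p' \<odot>\<^bsub>C\<^esub> \<kappa> = \<kappa>2 \<odot>\<^bsub>C\<^esub> p \<and> q' \<odot>\<^bsub>C\<^esub> \<kappa> = \<kappa>1 \<odot>\<^bsub>C\<^esub> q \<and>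
           m' \<odot>\<^bsub>C\<^esub> \<iota> = m \<and>
           \<chi> \<odot>\<^bsub>C\<^esub> mb = mb' \<odot>\<^bsub>C\<^esub> \<kappa> \<and> ib' \<odot>\<^bsub>C\<^esub> \<chi> = ib)})"

end

theory Submission
  imports Defs
begin

text \<open>
  A two-step derivation and a composite derivation are related when they are two views of one
  diagram: an embedding \<open>y : J \<rightarrow> X1\<close> of the overlap of the rules into the intermediate object, along
  which the pushouts with apex \<open>X1\<close> restrict to the pushouts with apex \<open>J\<close>, while the
  context of the composite derivation is the intersection over \<open>X1\<close> of the two contexts. From a
  two-step derivation the diagram arises by pulling back along \<open>y\<close>, from a composite derivation
  by pushing out the arrow from \<open>K21\<close> to its context; the van Kampen property makes the remaining
  squares pushouts or pullbacks. Hence the relation is total on both sides. The vertices of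
  either derivation are limits or colimits of parts of the diagram that the other one determines, so
  isomorphisms transport in both directions and the relation induces a bijection of quotients.
\<close>

text \<open>The legs of the rules are arbitrary arrows, so pushout complements need not be unique:
  the contexts \<open>Y0\<close>, \<open>Y1\<close>, \<open>L1\<close>, \<open>L2\<close>,
  \<open>Z\<close> are data of their own, and no argument may use monicity of a rule leg. What can
  be used is that the arrows into contexts (\<open>mb1\<close>, \<open>mb2\<close>,
  \<open>k1\<close>, \<open>k2\<close>, \<open>x\<close>) are regular monos, and the van Kampen
  property is applied along these. Hence regular monos must be closed under composition and pushout.
  Both closures are derived from the classifier together with the van Kampen property; closure under
  composition then gives the (epi, regular mono)-factorization and, through coproducts, the
  existence of multi-sums. Multi-sums, pushouts and pullbacks are picked by choice, so neither
  direction of the correspondence is a canonical function on derivations. A relation needs no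
  further choice: it suffices that links preserve and reflect equivalence. The same property spares
  a direct proof that \<open>composite_equiv\<close> is an equivalence, since it can be carried over
  from \<open>sequence_equiv\<close>.\<close>

locale cat =
  fixes C :: "('o, 'a) cat" (structure)
  assumes category: "category C"
begin

lemma hom_iff: "f \<in> hom C A B \<longleftrightarrow> f \<in> Arr C \<and> Src C f = A \<and> Tgt C f = B"
  by (auto simp: hom_def)

text \<open>Composition is a total function on the type of arrows, so every categorical law carries
  typing side conditions. Membership in a hom-set is unfolded here into exactly those
  conditions.\<close>

lemma hom_types:
  "f \<in> hom C A B \<Longrightarrow> f \<in> Arr C \<and> Src C f = A \<and> Tgt C f = B \<and> A \<in> Obj C \<and> B \<in> Obj C"
  using category unfolding category_def hom_def by auto

lemma Src_Tgt_Obj [simp]: "f \<in> Arr C \<Longrightarrow> Src C f \<in> Obj C" "f \<in> Arr C \<Longrightarrow> Tgt C f \<in> Obj C"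
  using category unfolding category_def by auto

lemma comp_types [simp]:
  assumes "f \<in> Arr C" "g \<in> Arr C" "Src C g = Tgt C f"
  shows "g \<odot> f \<in> Arr C" "Src C (g \<odot> f) = Src C f" "Tgt C (g \<odot> f) = Tgt C g"
proof -
  have "g \<odot> f \<in> hom C (Src C f) (Tgt C g)"
    using category assms unfolding category_def hom_def by fastforce
  then show "g \<odot> f \<in> Arr C" "Src C (g \<odot> f) = Src C f" "Tgt C (g \<odot> f) = Tgt C g"
    by (auto simp: hom_iff)
qed

lemma comp_assoc [simp]:
  assumes "f \<in> Arr C" "g \<in> Arr C" "h \<in> Arr C" "Src C g = Tgt C f" "Src C h = Tgt C g"
  shows "(h \<odot> g) \<odot> f = h \<odot> (g \<odot> f)"
proof -
  have "\<forall>A B D E. \<forall>f\<in>hom C A B. \<forall>g\<in>hom C B D. \<forall>h\<in>hom C D E. h \<odot> (g \<odot> f) = (h \<odot> g) \<odot> f"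
    using category unfolding category_def by blast
  moreover have "f \<in> hom C (Src C f) (Tgt C f)" "g \<in> hom C (Tgt C f) (Tgt C g)"
    "h \<in> hom C (Tgt C g) (Tgt C h)"
    using assms by (auto simp: hom_iff)
  ultimately show ?thesis by metis
qed

lemma Ident_types [simp]:
  assumes "A \<in> Obj C"
  shows "Ident C A \<in> Arr C" "Src C (Ident C A) = A" "Tgt C (Ident C A) = A"
proof -
  have "Ident C A \<in> hom C A A"
    using category assms unfolding category_def by blast
  then show "Ident C A \<in> Arr C" "Src C (Ident C A) = A" "Tgt C (Ident C A) = A"
    by (auto simp: hom_iff)
qed

lemma comp_Ident [simp]:
  "f \<in> Arr C \<Longrightarrow> Src C f = A \<Longrightarrow> f \<odot> Ident C A = f"
  "f \<in> Arr C \<Longrightarrow> Tgt C f = B \<Longrightarrow> Ident C B \<odot> f = f"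
  using category unfolding category_def hom_def by auto

text \<open>Reassociated form of an equation between composites, for rewriting in right-nested composites.\<close>

lemma comp_eq:
  assumes "g \<odot> f = h" "f \<in> Arr C" "g \<in> Arr C" "Src C g = Tgt C f" "x \<in> Arr C" "Tgt C x = Src C f"
  shows "g \<odot> (f \<odot> x) = h \<odot> x"
  using assms comp_assoc[of x f g] by simp

definition monic :: "'a \<Rightarrow> bool" where
  "monic m \<longleftrightarrow> m \<in> Arr C \<and>
     (\<forall>u\<in>Arr C. \<forall>v\<in>Arr C. Tgt C u = Src C m \<longrightarrow> Tgt C v = Src C m \<longrightarrow> Src C u = Src C v \<longrightarrow>
        m \<odot> u = m \<odot> v \<longrightarrow> u = v)"

lemma monic_cancel:
  "monic m \<Longrightarrow> m \<odot> u = m \<odot> v \<Longrightarrow> u \<in> Arr C \<Longrightarrow> v \<in> Arr C \<Longrightarrow> Tgt C u = Src C m \<Longrightarrow>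
   Tgt C v = Src C m \<Longrightarrow> Src C u = Src C v \<Longrightarrow> u = v"
  unfolding monic_def by blast

subsection \<open>Isomorphisms\<close>

lemma isos_hom: "f \<in> isos C A B \<Longrightarrow> f \<in> hom C A B"
  by (simp add: isos_def)

lemma isosI:
  assumes "f \<in> hom C A B" "g \<in> hom C B A" "g \<odot> f = Ident C A" "f \<odot> g = Ident C B"
  shows "f \<in> isos C A B"
  using assms by (auto simp: isos_def)

lemma isosE:
  assumes "f \<in> isos C A B"
  obtains g where "g \<in> isos C B A" "g \<in> hom C B A" "g \<odot> f = Ident C A" "f \<odot> g = Ident C B"
  using assms by (auto simp: isos_def)

lemma Ident_isos: "A \<in> Obj C \<Longrightarrow> Ident C A \<in> isos C A A"
  by (rule isosI[where g = "Ident C A"]) (auto simp: hom_iff)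

lemma isos_comp:
  assumes "f \<in> isos C A B" "g \<in> isos C B D"
  shows "g \<odot> f \<in> isos C A D"
proof -
  obtain f' where f': "f' \<in> hom C B A" "f' \<odot> f = Ident C A" "f \<odot> f' = Ident C B"
    using assms(1) by (rule isosE)
  obtain g' where g': "g' \<in> hom C D B" "g' \<odot> g = Ident C B" "g \<odot> g' = Ident C D"
    using assms(2) by (rule isosE)
  note [simp] = isos_hom[OF assms(1), THEN hom_types] isos_hom[OF assms(2), THEN hom_types]
    f'(1)[THEN hom_types] g'(1)[THEN hom_types]
  show ?thesis
    by (rule isosI[where g = "f' \<odot> g'"])
      (simp_all add: hom_iff f'(2,3) g'(2,3) f'(2,3)[THEN comp_eq] g'(2,3)[THEN comp_eq])
qed

lemma isomorphic_sym: "isomorphic C A B \<Longrightarrow> isomorphic C B A"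
  unfolding isomorphic_def by (metis isosE equals0D equals0I)

lemma isomorphic_trans: "isomorphic C A B \<Longrightarrow> isomorphic C B D \<Longrightarrow> isomorphic C A D"
  unfolding isomorphic_def by (metis isos_comp equals0D equals0I)

text \<open>Compose the square with the inverse of one side before and of the other side after it.
  The inverses of comparison arrows and the symmetry of \<open>sequence_equiv\<close> rest on
  squares inverted in this way.\<close>

lemma iso_square_inverse:
  assumes "\<alpha>' \<odot> \<alpha> = Ident C A" "\<alpha> \<odot> \<alpha>' = Ident C A'" "\<beta>' \<odot> \<beta> = Ident C B"
    and \<alpha>: "\<alpha> \<in> hom C A A'" "\<alpha>' \<in> hom C A' A" and \<beta>: "\<beta> \<in> hom C B B'" "\<beta>' \<in> hom C B' B"
    and f: "f \<in> hom C A B" "f' \<in> hom C A' B'" and sq: "f' \<odot> \<alpha> = \<beta> \<odot> f"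
  shows "f \<odot> \<alpha>' = \<beta>' \<odot> f'"
proof -
  note [simp] = \<alpha>[THEN hom_types] \<beta>[THEN hom_types] f[THEN hom_types]
  have "\<beta>' \<odot> f' = \<beta>' \<odot> (f' \<odot> (\<alpha> \<odot> \<alpha>'))"
    by (simp add: assms(2))
  also have "\<dots> = \<beta>' \<odot> ((f' \<odot> \<alpha>) \<odot> \<alpha>')"
    by simp
  also have "\<dots> = f \<odot> \<alpha>'"
    unfolding sq using assms(3)[THEN comp_eq] by simp
  finally show ?thesis by simp
qed

subsection \<open>Pushouts\<close>

text \<open>The unique mediating arrow is split into existence and joint cancellation, because later
  proofs obtain the two from different sources.\<close>

lemma pushoutI:
  assumes "f \<in> hom C A B" "g \<in> hom C A G" "p \<in> hom C B D" "q \<in> hom C G D" "p \<odot> f = q \<odot> g"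
    and "\<And>Z x y. x \<in> hom C B Z \<Longrightarrow> y \<in> hom C G Z \<Longrightarrow> x \<odot> f = y \<odot> g \<Longrightarrow>
       \<exists>u. u \<in> hom C D Z \<and> u \<odot> p = x \<and> u \<odot> q = y"
    and "\<And>Z u v. u \<in> hom C D Z \<Longrightarrow> v \<in> hom C D Z \<Longrightarrow> u \<odot> p = v \<odot> p \<Longrightarrow> u \<odot> q = v \<odot> q \<Longrightarrow> u = v"
  shows "is_pushout C f g p q"
  unfolding is_pushout_def
proof (intro conjI allI impI)
  show "commuting_square C f g p q"
    using assms(1-5) by (auto simp: commuting_square_def hom_iff)
next
  fix x y
  assume "commuting_square C f g x y"
  then have "x \<in> hom C B (Tgt C x)" "y \<in> hom C G (Tgt C x)" "x \<odot> f = y \<odot> g"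
    using assms(1-5) by (auto simp: commuting_square_def hom_iff)
  from assms(6)[OF this] assms(7) show "\<exists>!u. u \<in> hom C (Tgt C p) (Tgt C x) \<and> u \<odot> p = x \<and> u \<odot> q = y"
    using assms(3) by (intro ex_ex1I) (auto simp: hom_iff)
qed

lemma pushout_comm: "is_pushout C f g p q \<Longrightarrow> p \<odot> f = q \<odot> g"
  by (simp add: is_pushout_def commuting_square_def)

lemma pushout_types:
  assumes "is_pushout C f g p q"
  obtains A B G D where "f \<in> hom C A B" "g \<in> hom C A G" "p \<in> hom C B D" "q \<in> hom C G D"
  using assms by (auto simp: is_pushout_def commuting_square_def hom_iff)

lemma pushout_cocone_types:
  assumes "is_pushout C f g p q" "f \<in> hom C A B" "g \<in> hom C A G"
  obtains D where "p \<in> hom C B D" "q \<in> hom C G D"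
  using assms by (auto simp: is_pushout_def commuting_square_def hom_iff)

lemma pushout_factor:
  assumes po: "is_pushout C f g p q" and "p \<in> hom C B D" "q \<in> hom C G D"
    and "x \<in> hom C B Z" "y \<in> hom C G Z" "x \<odot> f = y \<odot> g"
  obtains u where "u \<in> hom C D Z" "u \<odot> p = x" "u \<odot> q = y"
proof -
  have "commuting_square C f g x y"
    using assms by (auto simp: is_pushout_def commuting_square_def hom_iff)
  then obtain u where "u \<in> hom C (Tgt C p) (Tgt C x)" "u \<odot> p = x" "u \<odot> q = y"
    using po unfolding is_pushout_def by blast
  then show ?thesis
    using assms that by (auto simp: hom_iff)
qed

text \<open>Both arrows mediate to the same cocone. This joint epicity is the standard way below to
  prove equations between arrows out of a pushout.\<close>

lemma pushout_cancel:
  assumes po: "is_pushout C f g p q" and p: "p \<in> hom C B D"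
    and u: "u \<in> hom C D Z" and v: "v \<in> hom C D Z" and eqs: "u \<odot> p = v \<odot> p" "u \<odot> q = v \<odot> q"
  shows "u = v"
proof -
  obtain A B' G D' where t: "f \<in> hom C A B'" "g \<in> hom C A G" "p \<in> hom C B' D'" "q \<in> hom C G D'"
    using po by (rule pushout_types)
  have [simp]: "D' = D" using t p by (simp add: hom_iff)
  note [simp] = t[THEN hom_types] u[THEN hom_types] v[THEN hom_types]
  have "(u \<odot> p) \<odot> f = (u \<odot> q) \<odot> g"
    using pushout_comm[OF po] by simp
  then have "commuting_square C f g (u \<odot> p) (u \<odot> q)"
    unfolding commuting_square_def by simp
  then have "\<exists>!w. w \<in> hom C (Tgt C p) (Tgt C (u \<odot> p)) \<and> w \<odot> p = u \<odot> p \<and> w \<odot> q = u \<odot> q"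
    using po unfolding is_pushout_def by blast
  moreover have "u \<in> hom C (Tgt C p) (Tgt C (u \<odot> p))" "v \<in> hom C (Tgt C p) (Tgt C (u \<odot> p))"
    by (auto simp: hom_iff)
  ultimately show ?thesis
    using eqs by metis
qed

lemma pushout_swap: "is_pushout C f g p q \<Longrightarrow> is_pushout C g f q p"
  unfolding is_pushout_def commuting_square_def by (auto; metis)

lemma pushout_paste:
  assumes po1: "is_pushout C f g p q" and po2: "is_pushout C h p r s"
  shows "is_pushout C (h \<odot> f) g r (s \<odot> q)"
proof -
  obtain A B G D where t: "f \<in> hom C A B" "g \<in> hom C A G" "p \<in> hom C B D" "q \<in> hom C G D"
    using po1 by (rule pushout_types)
  obtain E F where t2: "h \<in> hom C B E" "r \<in> hom C E F" "s \<in> hom C D F"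
    using po2 t by (elim pushout_types) (auto simp: hom_iff)
  note [simp] = t[THEN hom_types] t2[THEN hom_types]
  note c = pushout_comm[OF po1] pushout_comm[OF po2]
  show ?thesis
  proof (rule pushoutI)
    show "h \<odot> f \<in> hom C A E" "g \<in> hom C A G" "r \<in> hom C E F" "s \<odot> q \<in> hom C G F"
      by (simp_all add: hom_iff)
    show "r \<odot> (h \<odot> f) = s \<odot> q \<odot> g"
      using c c(2)[THEN comp_eq, of f] by simp
  next
    fix Z x y
    assume x: "x \<in> hom C E Z" and y: "y \<in> hom C G Z" and "x \<odot> (h \<odot> f) = y \<odot> g"
    note [simp] = x[THEN hom_types] y[THEN hom_types]
    have "(x \<odot> h) \<odot> f = y \<odot> g" using \<open>x \<odot> (h \<odot> f) = y \<odot> g\<close> by simp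
    then obtain u where u: "u \<in> hom C D Z" "u \<odot> p = x \<odot> h" "u \<odot> q = y"
      using pushout_factor[OF po1 t(3,4), of "x \<odot> h" Z y] by (auto simp: hom_iff)
    obtain v where v: "v \<in> hom C F Z" "v \<odot> r = x" "v \<odot> s = u"
      using pushout_factor[OF po2 t2(2,3) x u(1)] u(2) by metis
    note [simp] = v(1)[THEN hom_types]
    show "\<exists>u. u \<in> hom C F Z \<and> u \<odot> r = x \<and> u \<odot> (s \<odot> q) = y"
      using v u(3) v(3)[THEN comp_eq, of q] by (intro exI[of _ v]) simp
  next
    fix Z u v
    assume u: "u \<in> hom C F Z" and v: "v \<in> hom C F Z" and
      eqs: "u \<odot> r = v \<odot> r" "u \<odot> (s \<odot> q) = v \<odot> (s \<odot> q)"
    note [simp] = u[THEN hom_types] v[THEN hom_types]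
    have "(u \<odot> s) \<odot> p = (v \<odot> s) \<odot> p"
      using eqs(1)[THEN comp_eq, of h] by (simp flip: c(2))
    moreover have "(u \<odot> s) \<odot> q = (v \<odot> s) \<odot> q" using eqs(2) by simp
    ultimately have "u \<odot> s = v \<odot> s"
      using pushout_cancel[OF po1 t(3), of "u \<odot> s" Z "v \<odot> s"] by (simp add: hom_iff)
    with eqs(1) show "u = v" using pushout_cancel[OF po2 t2(2) u v] by simp
  qed
qed

text \<open>A cocone \<open>(x, y)\<close> on the second square extends to the cocone
  \<open>(x, y \<odot> q)\<close> on the outer rectangle. The arrow mediating for the rectangle also
  gives back \<open>y\<close>, since \<open>p\<close> and \<open>q\<close> are jointly epic.\<close>

lemma pushout_decompose:
  assumes po1: "is_pushout C f g p q" and po2: "is_pushout C (h \<odot> f) g r t"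
    and h: "h \<in> hom C B E" and r: "r \<in> hom C E F" and s: "s \<in> hom C D F"
    and p: "p \<in> hom C B D" and sp: "s \<odot> p = r \<odot> h" and sq: "s \<odot> q = t"
  shows "is_pushout C h p r s"
proof -
  obtain A G where t: "f \<in> hom C A B" "g \<in> hom C A G" "q \<in> hom C G D"
    using po1 p by (elim pushout_types) (auto simp: hom_iff)
  note [simp] = t[THEN hom_types] h[THEN hom_types] r[THEN hom_types] s[THEN hom_types] p[THEN hom_types]
  have tt: "t \<in> hom C G F"
    using po2 by (elim pushout_types) (auto simp: hom_iff)
  note [simp] = tt[THEN hom_types]
  show ?thesis
  proof (rule pushoutI[OF h p r s sp[symmetric]])
    fix Z x y
    assume x: "x \<in> hom C E Z" and y: "y \<in> hom C D Z" and xy: "x \<odot> h = y \<odot> p"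
    note [simp] = x[THEN hom_types] y[THEN hom_types]
    have "x \<odot> (h \<odot> f) = (y \<odot> q) \<odot> g"
      using xy[THEN comp_eq, of f] by (simp add: pushout_comm[OF po1])
    then obtain u where u: "u \<in> hom C F Z" "u \<odot> r = x" "u \<odot> t = y \<odot> q"
      using pushout_factor[OF po2 r tt x, of "y \<odot> q"] by (auto simp: hom_iff)
    note [simp] = u(1)[THEN hom_types]
    have "(u \<odot> s) \<odot> p = y \<odot> p"
      using xy u(2)[THEN comp_eq, of h] by (simp add: sp)
    moreover have "(u \<odot> s) \<odot> q = y \<odot> q"
      by (simp add: sq u)
    ultimately have "u \<odot> s = y"
      by - (rule pushout_cancel[OF po1 p], auto simp: hom_iff)
    with u show "\<exists>u. u \<in> hom C F Z \<and> u \<odot> r = x \<and> u \<odot> s = y" by blast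
  next
    fix Z u v
    assume u: "u \<in> hom C F Z" and v: "v \<in> hom C F Z" and
      eqs: "u \<odot> r = v \<odot> r" "u \<odot> s = v \<odot> s"
    note [simp] = u[THEN hom_types] v[THEN hom_types]
    have "u \<odot> t = v \<odot> t"
      using eqs(2)[THEN comp_eq, of q] by (simp add: sq)
    then show "u = v" using pushout_cancel[OF po2 r u v eqs(1)] by simp
  qed
qed

lemma pushout_map:
  assumes po: "is_pushout C f g p q"
    and t: "f \<in> hom C A B" "g \<in> hom C A G" "p \<in> hom C B D" "q \<in> hom C G D"
    and t': "f' \<in> hom C A' B'" "g' \<in> hom C A' G'" "p' \<in> hom C B' D'" "q' \<in> hom C G' D'"
    and c': "p' \<odot> f' = q' \<odot> g'"
    and m: "\<alpha> \<in> hom C A A'" "\<beta> \<in> hom C B B'" "\<gamma> \<in> hom C G G'"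
    and sq: "f' \<odot> \<alpha> = \<beta> \<odot> f" "g' \<odot> \<alpha> = \<gamma> \<odot> g"
  obtains \<delta> where "\<delta> \<in> hom C D D'" "\<delta> \<odot> p = p' \<odot> \<beta>" "\<delta> \<odot> q = q' \<odot> \<gamma>"
proof -
  note [simp] = t[THEN hom_types] t'[THEN hom_types] m[THEN hom_types]
  have "(p' \<odot> \<beta>) \<odot> f = (q' \<odot> \<gamma>) \<odot> g"
    using c'[THEN comp_eq, of \<alpha>] by (simp flip: sq)
  then show ?thesis
    by - (rule pushout_factor[OF po t(3,4), of "p' \<odot> \<beta>" D' "q' \<odot> \<gamma>"], auto simp: hom_iff intro!: that)
qed

text \<open>Together with \<open>pullback_iso\<close> this supplies the universal isomorphisms that
  the two equivalences ask for: an isomorphism of spans extends to any pushouts of them, in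
  particular to the chosen ones.\<close>

lemma pushout_iso:
  assumes po: "is_pushout C f g p q" and po': "is_pushout C f' g' p' q'"
    and t: "f \<in> hom C A B" "g \<in> hom C A G" "p \<in> hom C B D" "q \<in> hom C G D"
    and t': "f' \<in> hom C A' B'" "g' \<in> hom C A' G'" "p' \<in> hom C B' D'" "q' \<in> hom C G' D'"
    and i: "\<alpha> \<in> isos C A A'" "\<beta> \<in> isos C B B'" "\<gamma> \<in> isos C G G'"
    and sq: "f' \<odot> \<alpha> = \<beta> \<odot> f" "g' \<odot> \<alpha> = \<gamma> \<odot> g"
  obtains \<delta> where "\<delta> \<in> isos C D D'" "\<delta> \<odot> p = p' \<odot> \<beta>" "\<delta> \<odot> q = q' \<odot> \<gamma>"
proof -
  obtain \<alpha>' where \<alpha>': "\<alpha>' \<in> hom C A' A" "\<alpha>' \<odot> \<alpha> = Ident C A" "\<alpha> \<odot> \<alpha>' = Ident C A'"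
    using i(1) by (rule isosE)
  obtain \<beta>' where \<beta>': "\<beta>' \<in> hom C B' B" "\<beta>' \<odot> \<beta> = Ident C B" "\<beta> \<odot> \<beta>' = Ident C B'"
    using i(2) by (rule isosE)
  obtain \<gamma>' where \<gamma>': "\<gamma>' \<in> hom C G' G" "\<gamma>' \<odot> \<gamma> = Ident C G" "\<gamma> \<odot> \<gamma>' = Ident C G'"
    using i(3) by (rule isosE)
  note ih = i[THEN isos_hom]
  note [simp] = t[THEN hom_types] t'[THEN hom_types] ih[THEN hom_types]
    \<alpha>'(1)[THEN hom_types] \<beta>'(1)[THEN hom_types] \<gamma>'(1)[THEN hom_types]
  have sq': "f \<odot> \<alpha>' = \<beta>' \<odot> f'" "g \<odot> \<alpha>' = \<gamma>' \<odot> g'"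
    by (rule iso_square_inverse; (rule \<alpha>' \<beta>' \<gamma>' ih t t' sq))+
  obtain \<delta> where \<delta>: "\<delta> \<in> hom C D D'" "\<delta> \<odot> p = p' \<odot> \<beta>" "\<delta> \<odot> q = q' \<odot> \<gamma>"
    using pushout_map[OF po t t' pushout_comm[OF po'] ih sq] by metis
  obtain \<epsilon> where \<epsilon>: "\<epsilon> \<in> hom C D' D" "\<epsilon> \<odot> p' = p \<odot> \<beta>'" "\<epsilon> \<odot> q' = q \<odot> \<gamma>'"
    using pushout_map[OF po' t' t pushout_comm[OF po] \<alpha>'(1) \<beta>'(1) \<gamma>'(1) sq'] by metis
  note [simp] = \<delta>(1)[THEN hom_types] \<epsilon>(1)[THEN hom_types]
  note e = \<delta>(2,3)[THEN comp_eq] \<epsilon>(2,3)[THEN comp_eq]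
  have "\<epsilon> \<odot> \<delta> = Ident C D"
    by (rule pushout_cancel[OF po t(3)]) (simp_all add: hom_iff \<delta> \<epsilon> e \<beta>' \<gamma>')
  moreover have "\<delta> \<odot> \<epsilon> = Ident C D'"
    by (rule pushout_cancel[OF po' t'(3)]) (simp_all add: hom_iff \<delta> \<epsilon> e \<beta>' \<gamma>')
  ultimately have "\<delta> \<in> isos C D D'"
    using isosI \<delta>(1) \<epsilon>(1) by metis
  then show ?thesis using that \<delta> by blast
qed

subsection \<open>Pullbacks\<close>

lemma pullbackI:
  assumes "f \<in> hom C B D" "g \<in> hom C G D" "p \<in> hom C P B" "q \<in> hom C P G" "f \<odot> p = g \<odot> q"
    and "\<And>Z x y. x \<in> hom C Z B \<Longrightarrow> y \<in> hom C Z G \<Longrightarrow> f \<odot> x = g \<odot> y \<Longrightarrow>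
       \<exists>u. u \<in> hom C Z P \<and> p \<odot> u = x \<and> q \<odot> u = y"
    and "\<And>Z u v. u \<in> hom C Z P \<Longrightarrow> v \<in> hom C Z P \<Longrightarrow> p \<odot> u = p \<odot> v \<Longrightarrow> q \<odot> u = q \<odot> v \<Longrightarrow> u = v"
  shows "is_pullback C f g p q"
  unfolding is_pullback_def
proof (intro conjI allI impI)
  show "commuting_square C p q f g"
    using assms(1-5) by (auto simp: commuting_square_def hom_iff)
next
  fix x y
  assume "commuting_square C x y f g"
  then have "x \<in> hom C (Src C x) B" "y \<in> hom C (Src C x) G" "f \<odot> x = g \<odot> y"
    using assms(1-5) by (auto simp: commuting_square_def hom_iff)
  from assms(6)[OF this] assms(7) show "\<exists>!u. u \<in> hom C (Src C x) (Src C p) \<and> p \<odot> u = x \<and> q \<odot> u = y"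
    using assms(3) by (intro ex_ex1I) (auto simp: hom_iff)
qed

lemma pullback_comm: "is_pullback C f g p q \<Longrightarrow> f \<odot> p = g \<odot> q"
  by (simp add: is_pullback_def commuting_square_def)

lemma pullback_types:
  assumes "is_pullback C f g p q"
  obtains P B G D where "f \<in> hom C B D" "g \<in> hom C G D" "p \<in> hom C P B" "q \<in> hom C P G"
  using assms by (auto simp: is_pullback_def commuting_square_def hom_iff)

lemma pullback_cone_types:
  assumes "is_pullback C f g p q" "f \<in> hom C B D" "g \<in> hom C G D"
  obtains P where "p \<in> hom C P B" "q \<in> hom C P G"
  using assms by (auto simp: is_pullback_def commuting_square_def hom_iff)

lemma pullback_factor:
  assumes pb: "is_pullback C f g p q" and "p \<in> hom C P B" "q \<in> hom C P G"
    and "x \<in> hom C Z B" "y \<in> hom C Z G" "f \<odot> x = g \<odot> y"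
  obtains u where "u \<in> hom C Z P" "p \<odot> u = x" "q \<odot> u = y"
proof -
  have "commuting_square C x y f g"
    using assms by (auto simp: is_pullback_def commuting_square_def hom_iff)
  then obtain u where "u \<in> hom C (Src C x) (Src C p)" "p \<odot> u = x" "q \<odot> u = y"
    using pb unfolding is_pullback_def by blast
  then show ?thesis
    using assms that by (auto simp: hom_iff)
qed

lemma pullback_cancel:
  assumes pb: "is_pullback C f g p q" and p: "p \<in> hom C P B"
    and u: "u \<in> hom C Z P" and v: "v \<in> hom C Z P" and eqs: "p \<odot> u = p \<odot> v" "q \<odot> u = q \<odot> v"
  shows "u = v"
proof -
  obtain D B' G P' where t: "f \<in> hom C B' D" "g \<in> hom C G D" "p \<in> hom C P' B'" "q \<in> hom C P' G"
    using pb by (rule pullback_types)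
  have [simp]: "P' = P" using t p by (simp add: hom_iff)
  note [simp] = t[THEN hom_types] u[THEN hom_types] v[THEN hom_types]
  have "f \<odot> (p \<odot> u) = g \<odot> (q \<odot> u)"
    using pullback_comm[OF pb, THEN comp_eq] by simp
  then have "commuting_square C (p \<odot> u) (q \<odot> u) f g"
    unfolding commuting_square_def by simp
  then have "\<exists>!w. w \<in> hom C (Src C (p \<odot> u)) (Src C p) \<and> p \<odot> w = p \<odot> u \<and> q \<odot> w = q \<odot> u"
    using pb unfolding is_pullback_def by blast
  moreover have "u \<in> hom C (Src C (p \<odot> u)) (Src C p)" "v \<in> hom C (Src C (p \<odot> u)) (Src C p)"
    by (auto simp: hom_iff)
  ultimately show ?thesis
    using eqs by metis
qed

lemma pullback_swap: "is_pullback C f g p q \<Longrightarrow> is_pullback C g f q p"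
  unfolding is_pullback_def commuting_square_def by (auto; metis)

lemma pullback_paste:
  assumes pb1: "is_pullback C f g p q" and pb2: "is_pullback C h p r s"
  shows "is_pullback C (f \<odot> h) g r (q \<odot> s)"
proof -
  obtain D B G P where t: "f \<in> hom C B D" "g \<in> hom C G D" "p \<in> hom C P B" "q \<in> hom C P G"
    using pb1 by (rule pullback_types)
  obtain E Q where t2: "h \<in> hom C E B" "r \<in> hom C Q E" "s \<in> hom C Q P"
    using pb2 t by (elim pullback_types) (auto simp: hom_iff)
  note [simp] = t[THEN hom_types] t2[THEN hom_types]
  note c = pullback_comm[OF pb1] pullback_comm[OF pb2]
  show ?thesis
  proof (rule pullbackI)
    show "f \<odot> h \<in> hom C E D" "g \<in> hom C G D" "r \<in> hom C Q E" "q \<odot> s \<in> hom C Q G"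
      by (simp_all add: hom_iff)
    show "f \<odot> h \<odot> r = g \<odot> (q \<odot> s)"
      by (simp add: c c[THEN comp_eq])
  next
    fix Z x y
    assume x: "x \<in> hom C Z E" and y: "y \<in> hom C Z G" and xy: "f \<odot> h \<odot> x = g \<odot> y"
    note [simp] = x[THEN hom_types] y[THEN hom_types]
    obtain u where u: "u \<in> hom C Z P" "p \<odot> u = h \<odot> x" "q \<odot> u = y"
      using pullback_factor[OF pb1 t(3,4), of "h \<odot> x" Z y] xy by (auto simp: hom_iff)
    obtain v where v: "v \<in> hom C Z Q" "r \<odot> v = x" "s \<odot> v = u"
      using pullback_factor[OF pb2 t2(2,3) x u(1)] u(2) by metis
    note [simp] = v(1)[THEN hom_types]
    show "\<exists>u. u \<in> hom C Z Q \<and> r \<odot> u = x \<and> q \<odot> s \<odot> u = y"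
      using v u(3) by (intro exI[of _ v]) simp
  next
    fix Z u v
    assume u: "u \<in> hom C Z Q" and v: "v \<in> hom C Z Q" and
      eqs: "r \<odot> u = r \<odot> v" "q \<odot> s \<odot> u = q \<odot> s \<odot> v"
    note [simp] = u[THEN hom_types] v[THEN hom_types]
    have "p \<odot> (s \<odot> u) = p \<odot> (s \<odot> v)"
      by (simp add: eqs c(2)[symmetric, THEN comp_eq])
    moreover have "q \<odot> (s \<odot> u) = q \<odot> (s \<odot> v)" using eqs(2) by simp
    ultimately have "s \<odot> u = s \<odot> v"
      using pullback_cancel[OF pb1 t(3), of "s \<odot> u" Z "s \<odot> v"] by (simp add: hom_iff)
    with eqs(1) show "u = v" using pullback_cancel[OF pb2 t2(2) u v] by simp
  qed
qed

lemma pullback_decompose: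
  assumes pb1: "is_pullback C f g p q" and pb2: "is_pullback C (f \<odot> h) g r t"
    and h: "h \<in> hom C E B" and r: "r \<in> hom C Q E" and s: "s \<in> hom C Q P"
    and p: "p \<in> hom C P B" and ps: "p \<odot> s = h \<odot> r" and qs: "q \<odot> s = t"
  shows "is_pullback C h p r s"
proof -
  obtain D G where t: "f \<in> hom C B D" "g \<in> hom C G D" "q \<in> hom C P G"
    using pb1 p by (elim pullback_types) (auto simp: hom_iff)
  note [simp] = t[THEN hom_types] h[THEN hom_types] r[THEN hom_types] s[THEN hom_types] p[THEN hom_types]
  have tt: "t \<in> hom C Q G"
    using pb2 by (elim pullback_types) (auto simp: hom_iff)
  note [simp] = tt[THEN hom_types]
  note c = pullback_comm[OF pb1]
  show ?thesis
  proof (rule pullbackI[OF h p r s ps[symmetric]])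
    fix Z x y
    assume x: "x \<in> hom C Z E" and y: "y \<in> hom C Z P" and xy: "h \<odot> x = p \<odot> y"
    note [simp] = x[THEN hom_types] y[THEN hom_types]
    have "(f \<odot> h) \<odot> x = g \<odot> (q \<odot> y)"
      using c[THEN comp_eq, of y] by (simp add: xy)
    then obtain u where u: "u \<in> hom C Z Q" "r \<odot> u = x" "t \<odot> u = q \<odot> y"
      using pullback_factor[OF pb2 r tt x, of "q \<odot> y"] by (auto simp: hom_iff)
    note [simp] = u(1)[THEN hom_types]
    have "p \<odot> (s \<odot> u) = p \<odot> y"
      using ps[THEN comp_eq, of u] by (simp add: u xy)
    moreover have "q \<odot> (s \<odot> u) = q \<odot> y"
      using qs[THEN comp_eq, of u] by (simp add: u)
    ultimately have "s \<odot> u = y"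
      by - (rule pullback_cancel[OF pb1 p], auto simp: hom_iff)
    with u show "\<exists>u. u \<in> hom C Z Q \<and> r \<odot> u = x \<and> s \<odot> u = y" by blast
  next
    fix Z u v
    assume u: "u \<in> hom C Z Q" and v: "v \<in> hom C Z Q" and
      eqs: "r \<odot> u = r \<odot> v" "s \<odot> u = s \<odot> v"
    note [simp] = u[THEN hom_types] v[THEN hom_types]
    have "t \<odot> u = t \<odot> v"
      using eqs(2) by (simp flip: qs)
    then show "u = v" using pullback_cancel[OF pb2 r u v eqs(1)] by simp
  qed
qed

lemma pullback_map:
  assumes pb: "is_pullback C f g p q"
    and t: "f \<in> hom C B D" "g \<in> hom C G D" "p \<in> hom C P B" "q \<in> hom C P G"
    and t': "f' \<in> hom C B' D'" "g' \<in> hom C G' D'" "p' \<in> hom C P' B'" "q' \<in> hom C P' G'"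
    and c': "f' \<odot> p' = g' \<odot> q'"
    and m: "\<beta> \<in> hom C B' B" "\<gamma> \<in> hom C G' G" "\<delta> \<in> hom C D' D"
    and sq: "f \<odot> \<beta> = \<delta> \<odot> f'" "g \<odot> \<gamma> = \<delta> \<odot> g'"
  obtains \<alpha> where "\<alpha> \<in> hom C P' P" "p \<odot> \<alpha> = \<beta> \<odot> p'" "q \<odot> \<alpha> = \<gamma> \<odot> q'"
proof -
  note [simp] = t[THEN hom_types] t'[THEN hom_types] m[THEN hom_types]
  have "f \<odot> (\<beta> \<odot> p') = g \<odot> (\<gamma> \<odot> q')"
    using c' by (simp add: sq[THEN comp_eq])
  then show ?thesis
    by - (rule pullback_factor[OF pb t(3,4), of "\<beta> \<odot> p'" P' "\<gamma> \<odot> q'"], auto simp: hom_iff intro!: that)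
qed

lemma pullback_iso:
  assumes pb: "is_pullback C f g p q" and pb': "is_pullback C f' g' p' q'"
    and t: "f \<in> hom C B D" "g \<in> hom C G D" "p \<in> hom C P B" "q \<in> hom C P G"
    and t': "f' \<in> hom C B' D'" "g' \<in> hom C G' D'" "p' \<in> hom C P' B'" "q' \<in> hom C P' G'"
    and i: "\<beta> \<in> isos C B B'" "\<gamma> \<in> isos C G G'" "\<delta> \<in> isos C D D'"
    and sq: "f' \<odot> \<beta> = \<delta> \<odot> f" "g' \<odot> \<gamma> = \<delta> \<odot> g"
  obtains \<alpha> where "\<alpha> \<in> isos C P P'" "p' \<odot> \<alpha> = \<beta> \<odot> p" "q' \<odot> \<alpha> = \<gamma> \<odot> q"
proof -
  obtain \<beta>' where \<beta>': "\<beta>' \<in> hom C B' B" "\<beta>' \<odot> \<beta> = Ident C B" "\<beta> \<odot> \<beta>' = Ident C B'"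
    using i(1) by (rule isosE)
  obtain \<gamma>' where \<gamma>': "\<gamma>' \<in> hom C G' G" "\<gamma>' \<odot> \<gamma> = Ident C G" "\<gamma> \<odot> \<gamma>' = Ident C G'"
    using i(2) by (rule isosE)
  obtain \<delta>' where \<delta>': "\<delta>' \<in> hom C D' D" "\<delta>' \<odot> \<delta> = Ident C D" "\<delta> \<odot> \<delta>' = Ident C D'"
    using i(3) by (rule isosE)
  note ih = i[THEN isos_hom]
  note [simp] = t[THEN hom_types] t'[THEN hom_types] ih[THEN hom_types]
    \<beta>'(1)[THEN hom_types] \<gamma>'(1)[THEN hom_types] \<delta>'(1)[THEN hom_types]
  have sq': "f \<odot> \<beta>' = \<delta>' \<odot> f'" "g \<odot> \<gamma>' = \<delta>' \<odot> g'"
    by (rule iso_square_inverse; (rule \<delta>' \<beta>' \<gamma>' ih t t' sq))+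
  obtain \<alpha> where \<alpha>: "\<alpha> \<in> hom C P P'" "p' \<odot> \<alpha> = \<beta> \<odot> p" "q' \<odot> \<alpha> = \<gamma> \<odot> q"
    using pullback_map[OF pb' t' t pullback_comm[OF pb] ih sq] by metis
  obtain \<epsilon> where \<epsilon>: "\<epsilon> \<in> hom C P' P" "p \<odot> \<epsilon> = \<beta>' \<odot> p'" "q \<odot> \<epsilon> = \<gamma>' \<odot> q'"
    using pullback_map[OF pb t t' pullback_comm[OF pb'] \<beta>'(1) \<gamma>'(1) \<delta>'(1) sq'] by metis
  note [simp] = \<alpha>(1)[THEN hom_types] \<epsilon>(1)[THEN hom_types]
  note e = \<alpha>(2,3)[THEN comp_eq] \<epsilon>(2,3)[THEN comp_eq] \<beta>'(2,3)[THEN comp_eq] \<gamma>'(2,3)[THEN comp_eq]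
  have "\<epsilon> \<odot> \<alpha> = Ident C P"
    by (rule pullback_cancel[OF pb t(3)]) (simp_all add: hom_iff \<alpha> \<epsilon> e)
  moreover have "\<alpha> \<odot> \<epsilon> = Ident C P'"
    by (rule pullback_cancel[OF pb' t'(3)]) (simp_all add: hom_iff \<alpha> \<epsilon> e)
  ultimately have "\<alpha> \<in> isos C P P'"
    using isosI \<alpha>(1) \<epsilon>(1) by metis
  then show ?thesis using that \<alpha> by blast
qed

text \<open>Commuting over \<open>X\<close> means commuting over \<open>J\<close> once
  \<open>y\<close> is cancelled. Such squares serve as the faces with an identity edge in the van
  Kampen cubes below.\<close>

lemma pullback_of_mono_factor:
  assumes "monic y" and t: "y \<in> hom C J X" "j \<in> hom C I J" and eq: "y \<odot> j = m"
  shows "is_pullback C m y (Ident C I) j"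
proof -
  note [simp] = t[THEN hom_types]
  show ?thesis
  proof (rule pullbackI)
    show "m \<in> hom C I X" "y \<in> hom C J X" "Ident C I \<in> hom C I I" "j \<in> hom C I J"
      "m \<odot> Ident C I = y \<odot> j"
      by (auto simp: hom_iff simp flip: eq)
  next
    fix Z x w
    assume x: "x \<in> hom C Z I" and w: "w \<in> hom C Z J" and xw: "m \<odot> x = y \<odot> w"
    note [simp] = x[THEN hom_types] w[THEN hom_types]
    have "j \<odot> x = w"
      using xw by - (rule monic_cancel[OF \<open>monic y\<close>], simp_all flip: eq)
    then show "\<exists>u. u \<in> hom C Z I \<and> Ident C I \<odot> u = x \<and> j \<odot> u = w"
      using x by (intro exI[of _ x]) simp
  next
    fix Z u v
    assume "u \<in> hom C Z I" "v \<in> hom C Z I" "Ident C I \<odot> u = Ident C I \<odot> v"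
    then show "u = v" by (simp add: hom_iff)
  qed
qed

lemma pullback_Ident:
  assumes f: "f \<in> hom C A B"
  shows "is_pullback C f (Ident C B) (Ident C A) f"
proof (rule pullback_of_mono_factor)
  note [simp] = f[THEN hom_types]
  show "monic (Ident C B)" by (auto simp: monic_def)
  show "Ident C B \<in> hom C B B" "f \<in> hom C A B" "Ident C B \<odot> f = f" by (auto simp: hom_iff)
qed

subsection \<open>Regular monomorphisms\<close>

lemma regular_monoI:
  assumes t: "e \<in> hom C E A" "f \<in> hom C A B" "g \<in> hom C A B" and eq: "f \<odot> e = g \<odot> e"
    and ex: "\<And>Z h. h \<in> hom C Z A \<Longrightarrow> f \<odot> h = g \<odot> h \<Longrightarrow> \<exists>k. k \<in> hom C Z E \<and> e \<odot> k = h"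
    and un: "\<And>Z k k'. k \<in> hom C Z E \<Longrightarrow> k' \<in> hom C Z E \<Longrightarrow> e \<odot> k = e \<odot> k' \<Longrightarrow> k = k'"
  shows "regular_mono C e"
  unfolding regular_mono_def is_equalizer_def
proof (rule exI[of _ f], rule exI[of _ g], intro conjI ballI impI)
  fix h
  assume "h \<in> Arr C" and "Tgt C h = Tgt C e \<and> f \<odot> h = g \<odot> h"
  then have "h \<in> hom C (Src C h) A" "f \<odot> h = g \<odot> h" using t by (auto simp: hom_iff)
  from ex[OF this] un show "\<exists>!k. k \<in> hom C (Src C h) (Src C e) \<and> e \<odot> k = h"
    using t by (intro ex_ex1I) (auto simp: hom_iff)
qed (use t eq in \<open>auto simp: hom_iff\<close>)

lemma regular_monoE:
  assumes e: "regular_mono C e"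
  obtains f g E A B where "e \<in> hom C E A" "f \<in> hom C A B" "g \<in> hom C A B" "f \<odot> e = g \<odot> e"
    "\<And>Z h. h \<in> hom C Z A \<Longrightarrow> f \<odot> h = g \<odot> h \<Longrightarrow> \<exists>k. k \<in> hom C Z E \<and> e \<odot> k = h"
proof -
  obtain f g where fg: "is_equalizer C f g e" using e by (auto simp: regular_mono_def)
  show ?thesis
  proof (rule that)
    show "e \<in> hom C (Src C e) (Tgt C e)" "f \<in> hom C (Tgt C e) (Tgt C f)"
      "g \<in> hom C (Tgt C e) (Tgt C f)" "f \<odot> e = g \<odot> e"
      using fg by (auto simp: is_equalizer_def hom_iff)
  next
    fix Z h
    assume "h \<in> hom C Z (Tgt C e)" "f \<odot> h = g \<odot> h"
    moreover have "\<forall>h\<in>Arr C. Tgt C h = Tgt C e \<and> f \<odot> h = g \<odot> h \<longrightarrow>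
        (\<exists>!k. k \<in> hom C (Src C h) (Src C e) \<and> e \<odot> k = h)"
      using fg unfolding is_equalizer_def by blast
    ultimately show "\<exists>k. k \<in> hom C Z (Src C e) \<and> e \<odot> k = h"
      unfolding hom_iff by metis
  qed
qed

lemma regular_mono_Arr: "regular_mono C e \<Longrightarrow> e \<in> Arr C"
  by (auto simp: regular_mono_def is_equalizer_def)

lemma regular_mono_monic:
  assumes "regular_mono C e"
  shows "monic e"
proof -
  obtain f g where fg: "is_equalizer C f g e" using assms by (auto simp: regular_mono_def)
  then have [simp]: "e \<in> Arr C" "f \<in> Arr C" "g \<in> Arr C" "Src C f = Tgt C e" "Src C g = Tgt C e"
    and fe: "f \<odot> e = g \<odot> e"
    by (auto simp: is_equalizer_def)
  show ?thesis
    unfolding monic_def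
  proof (intro conjI ballI impI)
    fix u v
    assume [simp]: "u \<in> Arr C" "v \<in> Arr C" "Tgt C u = Src C e" "Tgt C v = Src C e" "Src C u = Src C v"
      and uv: "e \<odot> u = e \<odot> v"
    have "\<forall>h\<in>Arr C. Tgt C h = Tgt C e \<and> f \<odot> h = g \<odot> h \<longrightarrow>
        (\<exists>!k. k \<in> hom C (Src C h) (Src C e) \<and> e \<odot> k = h)"
      using fg unfolding is_equalizer_def by blast
    then have "\<exists>!k. k \<in> hom C (Src C (e \<odot> u)) (Src C e) \<and> e \<odot> k = e \<odot> u"
      by - (drule bspec[of _ _ "e \<odot> u"], simp, erule mp, simp add: fe[THEN comp_eq])
    moreover have "u \<in> hom C (Src C (e \<odot> u)) (Src C e)" "v \<in> hom C (Src C (e \<odot> u)) (Src C e)"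
      by (simp_all add: hom_iff)
    ultimately show "u = v" using uv by metis
  qed simp
qed

text \<open>A split mono is the equalizer of the identity and the idempotent
  \<open>m \<odot> r\<close>.\<close>

lemma regular_mono_section:
  assumes t: "m \<in> hom C A B" "r \<in> hom C B A" and rm: "r \<odot> m = Ident C A"
  shows "regular_mono C m"
proof -
  note [simp] = t[THEN hom_types]
  show ?thesis
  proof (rule regular_monoI[OF t(1), where B = B])
    show "Ident C B \<in> hom C B B" "m \<odot> r \<in> hom C B B" "Ident C B \<odot> m = m \<odot> r \<odot> m"
      by (auto simp: hom_iff rm)
  next
    fix Z h
    assume h: "h \<in> hom C Z B" and "Ident C B \<odot> h = m \<odot> r \<odot> h"
    note [simp] = h[THEN hom_types]
    have "m \<odot> (r \<odot> h) = h" using \<open>Ident C B \<odot> h = m \<odot> r \<odot> h\<close> by simp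
    then show "\<exists>k. k \<in> hom C Z A \<and> m \<odot> k = h" by (intro exI[of _ "r \<odot> h"]) (simp add: hom_iff)
  next
    fix Z k k'
    assume k: "k \<in> hom C Z A" "k' \<in> hom C Z A" and "m \<odot> k = m \<odot> k'"
    note [simp] = k[THEN hom_types]
    have "r \<odot> (m \<odot> k) = r \<odot> (m \<odot> k')" using \<open>m \<odot> k = m \<odot> k'\<close> by simp
    then show "k = k'" by (simp add: rm[THEN comp_eq])
  qed
qed

lemma regular_mono_iso: "m \<in> isos C A B \<Longrightarrow> regular_mono C m"
  using isosE isos_hom regular_mono_section by metis

text \<open>If \<open>m\<close> equalizes \<open>c\<close> and \<open>d\<close>, then its pullback
  along \<open>f\<close> equalizes \<open>c \<odot> f\<close> and
  \<open>d \<odot> f\<close>.\<close>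

lemma regular_mono_pullback:
  assumes pb: "is_pullback C f m p q" and m: "regular_mono C m"
  shows "regular_mono C p"
proof -
  obtain P B G D where t: "f \<in> hom C B D" "m \<in> hom C G D" "p \<in> hom C P B" "q \<in> hom C P G"
    using pb by (rule pullback_types)
  obtain c d Z where cd: "c \<in> hom C D Z" "d \<in> hom C D Z" "c \<odot> m = d \<odot> m"
    and ex: "\<And>Y h. h \<in> hom C Y D \<Longrightarrow> c \<odot> h = d \<odot> h \<Longrightarrow> \<exists>k. k \<in> hom C Y G \<and> m \<odot> k = h"
    using m t by (elim regular_monoE) (auto simp: hom_iff)
  note [simp] = t[THEN hom_types] cd(1,2)[THEN hom_types]
  note comm = pullback_comm[OF pb]
  show ?thesis
  proof (rule regular_monoI[OF t(3), where B = Z])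
    show "c \<odot> f \<in> hom C B Z" "d \<odot> f \<in> hom C B Z"
      by (auto simp: hom_iff)
    show "c \<odot> f \<odot> p = d \<odot> f \<odot> p"
      by (simp add: comm cd(3)[THEN comp_eq])
  next
    fix Y h
    assume h: "h \<in> hom C Y B" and eq: "c \<odot> f \<odot> h = d \<odot> f \<odot> h"
    note [simp] = h[THEN hom_types]
    obtain k where "k \<in> hom C Y G" "m \<odot> k = f \<odot> h"
      using ex[of "f \<odot> h" Y] eq by (auto simp: hom_iff)
    then show "\<exists>k. k \<in> hom C Y P \<and> p \<odot> k = h"
      using pullback_factor[OF pb t(3,4) h] by metis
  next
    fix Y k k'
    assume k: "k \<in> hom C Y P" "k' \<in> hom C Y P" and eq: "p \<odot> k = p \<odot> k'"
    note [simp] = k[THEN hom_types]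
    have "m \<odot> (q \<odot> k) = m \<odot> (q \<odot> k')"
      using eq by (simp add: comm[symmetric, THEN comp_eq])
    then have "q \<odot> k = q \<odot> k'"
      by (rule monic_cancel[OF regular_mono_monic[OF m]]) simp_all
    with eq show "k = k'" by (rule pullback_cancel[OF pb t(3) k])
  qed
qed

text \<open>Since \<open>y\<close> is monic, \<open>j\<close> is the pullback of \<open>m\<close>
  along \<open>y\<close>.\<close>

lemma regular_mono_factor:
  assumes "regular_mono C m" "monic y" "y \<in> hom C J X" "j \<in> hom C I J" "y \<odot> j = m"
  shows "regular_mono C j"
  using pullback_swap[OF pullback_of_mono_factor[OF assms(2-5)]] assms(1)
  by (rule regular_mono_pullback)

end

section \<open>Regular monomorphisms in rm-adhesive categories\<close>

locale rm_cat =
  fixes C :: "('o, 'a) cat" (structure)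
  assumes rm_adhesive: "rm_adhesive C"

sublocale rm_cat \<subseteq> cat
  using rm_adhesive by unfold_locales (auto simp: rm_adhesive_def quasi_topos_def)

context rm_cat
begin

section \<open>Pushouts, pullbacks, equalizers and coproducts from finite diagrams\<close>

lemma ex_pushout:
  assumes t: "f \<in> hom C A B" "g \<in> hom C A G"
  shows "\<exists>p q. is_pushout C f g p q"
proof -
  note [simp] = t[THEN hom_types]
  define Dg :: "nat \<Rightarrow> 'o" where "Dg = (\<lambda>n. if n = 0 then A else if n = 1 then B else G)"
  define E where "E = {(0::nat, f, 1::nat), (0, g, 2)}"
  have "finite_diagram C {0,1,2} Dg E"
    by (auto simp: finite_diagram_def Dg_def E_def hom_iff)
  then obtain L l where L: "is_colimit C {0,1,2} Dg E L l"
    using rm_adhesive unfolding rm_adhesive_def quasi_topos_def has_finite_colimits_def by blast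
  then have l: "l 0 \<in> hom C A L" "l 1 \<in> hom C B L" "l 2 \<in> hom C G L" "l 1 \<odot> f = l 0" "l 2 \<odot> g = l 0"
    by (auto simp: is_colimit_def is_cocone_def Dg_def E_def)
  have univ: "\<exists>!u. u \<in> hom C L M \<and> u \<odot> l 0 = x \<odot> f \<and> u \<odot> l 1 = x \<and> u \<odot> l 2 = y"
    if x: "x \<in> hom C B M" and y: "y \<in> hom C G M" and xy: "x \<odot> f = y \<odot> g" for M x y
  proof -
    note [simp] = x[THEN hom_types] y[THEN hom_types]
    have "is_cocone C {0,1,2} Dg E M (\<lambda>n. if n = 0 then x \<odot> f else if n = 1 then x else y)"
      using xy by (auto simp: is_cocone_def Dg_def E_def hom_iff)
    with L have "\<exists>!u. u \<in> hom C L M \<and>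
        (\<forall>v\<in>{0,1,2}. u \<odot> l v = (if v = 0 then x \<odot> f else if v = 1 then x else y))"
      unfolding is_colimit_def by blast
    then show ?thesis by simp
  qed
  note [simp] = l(1-3)[THEN hom_types] and [simp del] = One_nat_def
  have "is_pushout C f g (l 1) (l 2)"
  proof (rule pushoutI[OF t l(2,3)])
    fix Z x y
    assume "x \<in> hom C B Z" "y \<in> hom C G Z" "x \<odot> f = y \<odot> g"
    from univ[OF this] show "\<exists>u. u \<in> hom C L Z \<and> u \<odot> l 1 = x \<and> u \<odot> l 2 = y" by blast
  next
    fix Z u v
    assume u: "u \<in> hom C L Z" and v: "v \<in> hom C L Z" and eqs: "u \<odot> l 1 = v \<odot> l 1" "u \<odot> l 2 = v \<odot> l 2"
    note [simp] = u[THEN hom_types] v[THEN hom_types]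
    \<comment> \<open>A colimit cocone also has a component \<open>l 0\<close> at the apex of the
      span, so uniqueness requires agreement there too. It follows because \<open>l 0\<close> equals
      \<open>l 1 \<odot> f\<close>.\<close>
    have uf: "u \<odot> l 1 \<odot> f = u \<odot> l 0" "u \<odot> l 2 \<odot> g = u \<odot> l 0" "v \<odot> l 1 \<odot> f = v \<odot> l 0"
      by (simp_all add: l(4,5))
    have "\<exists>!w. w \<in> hom C L Z \<and> w \<odot> l 0 = u \<odot> l 1 \<odot> f \<and> w \<odot> l 1 = u \<odot> l 1 \<and> w \<odot> l 2 = u \<odot> l 2"
      by (rule univ) (simp_all add: hom_iff l(4,5))
    moreover have "v \<odot> l 0 = u \<odot> l 1 \<odot> f"
      using uf(3) eqs(1) by simp
    ultimately show "u = v"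
      using u v eqs uf(1) by metis
  qed (simp add: l)
  then show ?thesis by blast
qed

lemma ex_pullback:
  assumes t: "f \<in> hom C B D" "g \<in> hom C G D"
  shows "\<exists>p q. is_pullback C f g p q"
proof -
  note [simp] = t[THEN hom_types]
  define Dg :: "nat \<Rightarrow> 'o" where "Dg = (\<lambda>n. if n = 0 then D else if n = 1 then B else G)"
  define E where "E = {(1::nat, f, 0::nat), (2, g, 0)}"
  have "finite_diagram C {0,1,2} Dg E"
    by (auto simp: finite_diagram_def Dg_def E_def hom_iff)
  then obtain L l where L: "is_limit C {0,1,2} Dg E L l"
    using rm_adhesive unfolding rm_adhesive_def quasi_topos_def has_finite_limits_def by blast
  then have l: "l 0 \<in> hom C L D" "l 1 \<in> hom C L B" "l 2 \<in> hom C L G" "f \<odot> l 1 = l 0" "g \<odot> l 2 = l 0"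
    by (auto simp: is_limit_def is_cone_def Dg_def E_def)
  have univ: "\<exists>!u. u \<in> hom C M L \<and> l 0 \<odot> u = f \<odot> x \<and> l 1 \<odot> u = x \<and> l 2 \<odot> u = y"
    if x: "x \<in> hom C M B" and y: "y \<in> hom C M G" and xy: "f \<odot> x = g \<odot> y" for M x y
  proof -
    note [simp] = x[THEN hom_types] y[THEN hom_types]
    have "is_cone C {0,1,2} Dg E M (\<lambda>n. if n = 0 then f \<odot> x else if n = 1 then x else y)"
      using xy by (auto simp: is_cone_def Dg_def E_def hom_iff)
    with L have "\<exists>!u. u \<in> hom C M L \<and>
        (\<forall>v\<in>{0,1,2}. l v \<odot> u = (if v = 0 then f \<odot> x else if v = 1 then x else y))"
      unfolding is_limit_def by blast
    then show ?thesis by simp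
  qed
  note [simp] = l(1-3)[THEN hom_types] and [simp del] = One_nat_def
  have "is_pullback C f g (l 1) (l 2)"
  proof (rule pullbackI[OF t l(2,3)])
    fix Z x y
    assume "x \<in> hom C Z B" "y \<in> hom C Z G" "f \<odot> x = g \<odot> y"
    from univ[OF this] show "\<exists>u. u \<in> hom C Z L \<and> l 1 \<odot> u = x \<and> l 2 \<odot> u = y" by blast
  next
    fix Z u v
    assume u: "u \<in> hom C Z L" and v: "v \<in> hom C Z L" and eqs: "l 1 \<odot> u = l 1 \<odot> v" "l 2 \<odot> u = l 2 \<odot> v"
    note [simp] = u[THEN hom_types] v[THEN hom_types]
    have uf: "f \<odot> (l 1 \<odot> u) = l 0 \<odot> u" "g \<odot> (l 2 \<odot> u) = l 0 \<odot> u" "f \<odot> (l 1 \<odot> v) = l 0 \<odot> v"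
      by (rule comp_eq; simp add: l(4,5))+
    have "\<exists>!w. w \<in> hom C Z L \<and> l 0 \<odot> w = f \<odot> (l 1 \<odot> u) \<and> l 1 \<odot> w = l 1 \<odot> u \<and> l 2 \<odot> w = l 2 \<odot> u"
      by (rule univ) (simp_all add: hom_iff uf)
    moreover have "l 0 \<odot> v = f \<odot> (l 1 \<odot> u)"
      using uf(3) eqs(1) by simp
    ultimately show "u = v"
      using u v eqs uf(1) by metis
  qed (simp add: l)
  then show ?thesis by blast
qed

lemma ex_equalizer:
  assumes t: "f \<in> hom C A B" "g \<in> hom C A B"
  obtains E e where "e \<in> hom C E A" "regular_mono C e" "f \<odot> e = g \<odot> e"
    "\<And>Z h. h \<in> hom C Z A \<Longrightarrow> f \<odot> h = g \<odot> h \<Longrightarrow> \<exists>k. k \<in> hom C Z E \<and> e \<odot> k = h"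
proof -
  note [simp] = t[THEN hom_types]
  define Dg :: "nat \<Rightarrow> 'o" where "Dg = (\<lambda>n. if n = 0 then A else B)"
  define E where "E = {(0::nat, f, 1::nat), (0, g, 1)}"
  have "finite_diagram C {0,1} Dg E"
    by (auto simp: finite_diagram_def Dg_def E_def hom_iff)
  then obtain L l where L: "is_limit C {0,1} Dg E L l"
    using rm_adhesive unfolding rm_adhesive_def quasi_topos_def has_finite_limits_def by blast
  then have l: "l 0 \<in> hom C L A" "l 1 \<in> hom C L B" "f \<odot> l 0 = l 1" "g \<odot> l 0 = l 1"
    by (auto simp: is_limit_def is_cone_def Dg_def E_def)
  have univ: "\<exists>!u. u \<in> hom C M L \<and> l 0 \<odot> u = x \<and> l 1 \<odot> u = f \<odot> x"
    if x: "x \<in> hom C M A" and xx: "f \<odot> x = g \<odot> x" for M x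
  proof -
    note [simp] = x[THEN hom_types]
    have "is_cone C {0,1} Dg E M (\<lambda>n. if n = 0 then x else f \<odot> x)"
      using xx by (auto simp: is_cone_def Dg_def E_def hom_iff)
    with L have "\<exists>!u. u \<in> hom C M L \<and> (\<forall>v\<in>{0,1}. l v \<odot> u = (if v = 0 then x else f \<odot> x))"
      unfolding is_limit_def by blast
    then show ?thesis by simp
  qed
  note [simp] = l(1,2)[THEN hom_types] and [simp del] = One_nat_def
  have eq: "f \<odot> l 0 = g \<odot> l 0" using l by simp
  have ex: "\<exists>k. k \<in> hom C Z L \<and> l 0 \<odot> k = h" if "h \<in> hom C Z A" "f \<odot> h = g \<odot> h" for Z h
    using univ[OF that] by blast
  have "regular_mono C (l 0)"
  proof (rule regular_monoI[OF l(1) t eq ex])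
    fix Z k k'
    assume k: "k \<in> hom C Z L" and k': "k' \<in> hom C Z L" and kk: "l 0 \<odot> k = l 0 \<odot> k'"
    note [simp] = k[THEN hom_types] k'[THEN hom_types]
    have uf: "f \<odot> (l 0 \<odot> k) = l 1 \<odot> k" "g \<odot> (l 0 \<odot> k) = l 1 \<odot> k" "f \<odot> (l 0 \<odot> k') = l 1 \<odot> k'"
      by (rule comp_eq; simp add: l(3,4))+
    have "\<exists>!w. w \<in> hom C Z L \<and> l 0 \<odot> w = l 0 \<odot> k \<and> l 1 \<odot> w = f \<odot> (l 0 \<odot> k)"
      by (rule univ) (simp_all add: hom_iff uf)
    then show "k = k'" using k k' kk uf by metis
  qed
  then show ?thesis by (rule that[OF l(1) _ eq ex])
qed

lemma ex_coproduct:
  assumes t [simp]: "A \<in> Obj C" "B \<in> Obj C"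
  obtains S i j where "i \<in> hom C A S" "j \<in> hom C B S"
    "\<And>Z x y. x \<in> hom C A Z \<Longrightarrow> y \<in> hom C B Z \<Longrightarrow> \<exists>u. u \<in> hom C S Z \<and> u \<odot> i = x \<and> u \<odot> j = y"
    "\<And>Z u v. u \<in> hom C S Z \<Longrightarrow> v \<in> hom C S Z \<Longrightarrow> u \<odot> i = v \<odot> i \<Longrightarrow> u \<odot> j = v \<odot> j \<Longrightarrow> u = v"
proof -
  define Dg :: "nat \<Rightarrow> 'o" where "Dg = (\<lambda>n. if n = 0 then A else B)"
  have "finite_diagram C {0,1} Dg {}"
    by (auto simp: finite_diagram_def Dg_def)
  then obtain L l where L: "is_colimit C {0,1} Dg {} L l"
    using rm_adhesive unfolding rm_adhesive_def quasi_topos_def has_finite_colimits_def by blast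
  then have l: "l 0 \<in> hom C A L" "l 1 \<in> hom C B L"
    by (auto simp: is_colimit_def is_cocone_def Dg_def)
  note [simp] = l[THEN hom_types] and [simp del] = One_nat_def
  have univ: "\<exists>!u. u \<in> hom C L M \<and> u \<odot> l 0 = x \<and> u \<odot> l 1 = y"
    if x: "x \<in> hom C A M" and y: "y \<in> hom C B M" for M x y
  proof -
    note [simp] = x[THEN hom_types] y[THEN hom_types]
    have "is_cocone C {0,1} Dg {} M (\<lambda>n. if n = 0 then x else y)"
      by (auto simp: is_cocone_def Dg_def hom_iff)
    with L have "\<exists>!u. u \<in> hom C L M \<and> (\<forall>v\<in>{0,1}. u \<odot> l v = (if v = 0 then x else y))"
      unfolding is_colimit_def by blast
    then show ?thesis by simp
  qed
  show ?thesis
  proof (rule that[OF l])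
    fix Z x y
    assume "x \<in> hom C A Z" "y \<in> hom C B Z"
    from univ[OF this] show "\<exists>u. u \<in> hom C L Z \<and> u \<odot> l 0 = x \<and> u \<odot> l 1 = y" by blast
  next
    fix Z u v
    assume u: "u \<in> hom C L Z" and v: "v \<in> hom C L Z" and eqs: "u \<odot> l 0 = v \<odot> l 0" "u \<odot> l 1 = v \<odot> l 1"
    note [simp] = u[THEN hom_types] v[THEN hom_types]
    have "\<exists>!w. w \<in> hom C L Z \<and> w \<odot> l 0 = u \<odot> l 0 \<and> w \<odot> l 1 = u \<odot> l 1"
      by (rule univ) (simp_all add: hom_iff)
    then show "u = v" using u v eqs by metis
  qed
qed

section \<open>The van Kampen property and closure properties of regular monomorphisms\<close>

lemma van_kampen:
  assumes "regular_mono C m" "is_pushout C f m p q"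
    and "is_pullback C f b a f'" "is_pullback C m d a m'"
    and "commuting_square C f' m' p' q'"
    and "e \<in> hom C D' D" "p \<in> hom C B D" "p' \<in> hom C B' D'" "e \<odot> p' = p \<odot> b" "e \<odot> q' = q \<odot> d"
  shows "is_pushout C f' m' p' q' \<longleftrightarrow> is_pullback C p e b p' \<and> is_pullback C q e d q'"
proof -
  have "van_kampen C f m p q"
    using rm_adhesive assms(1,2) unfolding rm_adhesive_def by blast
  moreover have "e \<in> hom C (Tgt C p') (Tgt C p)"
    using assms by (simp add: hom_iff)
  ultimately show ?thesis
    using assms unfolding van_kampen_def by blast
qed

lemma pushout_Ident:
  assumes f: "f \<in> hom C A B"
  shows "is_pushout C f (Ident C A) (Ident C B) f"
proof -
  note [simp] = f[THEN hom_types]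
  show ?thesis
  proof (rule pushoutI)
    show "f \<in> hom C A B" "Ident C A \<in> hom C A A" "Ident C B \<in> hom C B B" "f \<in> hom C A B"
      "Ident C B \<odot> f = f \<odot> Ident C A"
      by (auto simp: hom_iff)
  next
    fix Z x y
    assume x: "x \<in> hom C B Z" and y: "y \<in> hom C A Z" and "x \<odot> f = y \<odot> Ident C A"
    note [simp] = x[THEN hom_types] y[THEN hom_types]
    have "x \<odot> f = y" using \<open>x \<odot> f = y \<odot> Ident C A\<close> by simp
    then show "\<exists>u. u \<in> hom C B Z \<and> u \<odot> Ident C B = x \<and> u \<odot> f = y"
      using x by (intro exI[of _ x]) simp
  next
    fix Z u v
    assume "u \<in> hom C B Z" "v \<in> hom C B Z" "u \<odot> Ident C B = v \<odot> Ident C B"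
    then show "u = v" by (simp add: hom_iff)
  qed
qed

text \<open>Take the cube whose top is the trivial pushout of \<open>f\<close> along an identity,
  with vertical arrows \<open>m\<close> and \<open>p\<close> beside identities. Its back faces are
  pullbacks because \<open>m\<close> is monic; the front faces are then pullbacks, and one of them
  is the given square itself.\<close>

lemma pushout_regular_mono_pullback:
  assumes m: "regular_mono C m" and po: "is_pushout C f m p q"
  shows "is_pullback C q p m f"
proof -
  obtain A B G D where t: "f \<in> hom C A B" "m \<in> hom C A G" "p \<in> hom C B D" "q \<in> hom C G D"
    using po by (rule pushout_types)
  note [simp] = t[THEN hom_types]
  have "is_pullback C p p (Ident C B) (Ident C B) \<and> is_pullback C q p m f"
  proof (rule van_kampen[OF m po, THEN iffD1])
    show "is_pullback C f (Ident C B) (Ident C A) f"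
      using t(1) by (rule pullback_Ident)
    show "is_pullback C m m (Ident C A) (Ident C A)"
      using regular_mono_monic[OF m] t(2) by (rule pullback_of_mono_factor) (auto simp: hom_iff)
    show "is_pushout C f (Ident C A) (Ident C B) f"
      using t(1) by (rule pushout_Ident)
    show "commuting_square C f (Ident C A) (Ident C B) f"
      by (auto simp: commuting_square_def)
    show "p \<odot> f = q \<odot> m" using po by (rule pushout_comm)
  qed (use t in \<open>auto simp: hom_iff\<close>)
  then show ?thesis ..
qed

text \<open>Every regular mono becomes a pullback of one arrow out of a terminal object, which
  reduces closure questions about regular monos to arrows of that special kind.\<close>

lemma classifier:
  obtains T \<Omega> tr where "is_terminal C T" "tr \<in> hom C T \<Omega>"
    "\<forall>m. regular_mono C m \<longrightarrow>
      (\<exists>\<chi> t. \<chi> \<in> hom C (Tgt C m) \<Omega> \<and> t \<in> hom C (Src C m) T \<and> is_pullback C \<chi> tr m t)"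
proof -
  have "has_regular_subobject_classifier C"
    using rm_adhesive by (simp add: rm_adhesive_def quasi_topos_def)
  then obtain T \<Omega> tr where T: "is_terminal C T" "tr \<in> hom C T \<Omega>" and
    cl: "\<forall>m. regular_mono C m \<longrightarrow> (\<exists>!\<chi>. \<chi> \<in> hom C (Tgt C m) \<Omega> \<and>
      (\<exists>t\<in>hom C (Src C m) T. is_pullback C \<chi> tr m t))"
    unfolding has_regular_subobject_classifier_def by blast
  show ?thesis
  proof (rule that[OF T], intro allI impI)
    fix m
    assume "regular_mono C m"
    with cl have "\<exists>\<chi>. \<chi> \<in> hom C (Tgt C m) \<Omega> \<and>
      (\<exists>t\<in>hom C (Src C m) T. is_pullback C \<chi> tr m t)" by (metis (no_types, lifting))
    then show "\<exists>\<chi> t. \<chi> \<in> hom C (Tgt C m) \<Omega> \<and> t \<in> hom C (Src C m) T \<and> is_pullback C \<chi> tr m t"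
      by blast
  qed
qed

lemma terminal_ex: "is_terminal C T \<Longrightarrow> A \<in> Obj C \<Longrightarrow> \<exists>f. f \<in> hom C A T"
  unfolding is_terminal_def by blast

lemma terminal_unique:
  "is_terminal C T \<Longrightarrow> f \<in> hom C A T \<Longrightarrow> g \<in> hom C A T \<Longrightarrow> f = g"
  unfolding is_terminal_def by (metis hom_types)

text \<open>An arrow out of a terminal object is split by the arrow back to it.\<close>

lemma terminal_regular_mono:
  assumes T: "is_terminal C T" and m: "m \<in> hom C T A"
  shows "regular_mono C m"
proof -
  note [simp] = m[THEN hom_types]
  obtain r where r: "r \<in> hom C A T" using terminal_ex[OF T] by fastforce
  note [simp] = r[THEN hom_types]
  have "r \<odot> m = Ident C T"
    by (rule terminal_unique[OF T, of _ T]) (simp_all add: hom_iff)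
  with m r show ?thesis by (rule regular_mono_section)
qed

text \<open>
  The pushout of \<open>n\<close> along the characteristic arrow of \<open>m\<close> is a pullback, so \<open>n \<odot> m\<close> is a pullback
  of an arrow out of the terminal object.
\<close>

lemma regular_mono_comp:
  assumes m: "regular_mono C m" "m \<in> hom C A B" and n: "regular_mono C n" "n \<in> hom C B D"
  shows "regular_mono C (n \<odot> m)"
proof -
  obtain T \<Omega> tr where T: "is_terminal C T" and tr: "tr \<in> hom C T \<Omega>"
    and cl: "\<forall>m. regular_mono C m \<longrightarrow>
      (\<exists>\<chi> t. \<chi> \<in> hom C (Tgt C m) \<Omega> \<and> t \<in> hom C (Src C m) T \<and> is_pullback C \<chi> tr m t)"
    by (rule classifier) blast
  note [simp] = m(2)[THEN hom_types] n(2)[THEN hom_types] tr[THEN hom_types]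
  obtain \<chi> t where \<chi>: "\<chi> \<in> hom C B \<Omega>" and t: "t \<in> hom C A T" and pb: "is_pullback C \<chi> tr m t"
    using cl[rule_format, OF m(1)] by auto
  obtain p q where po: "is_pushout C \<chi> n p q" using ex_pushout[OF \<chi> n(2)] by blast
  obtain P where p: "p \<in> hom C \<Omega> P" and q: "q \<in> hom C D P"
    using po \<chi> n(2) by (rule pushout_cocone_types)
  have "is_pullback C p q \<chi> n"
    using pushout_regular_mono_pullback[OF n(1) po] by (rule pullback_swap)
  then have "is_pullback C (p \<odot> tr) q t (n \<odot> m)"
    using pullback_swap[OF pb] by (rule pullback_paste)
  then have "is_pullback C q (p \<odot> tr) (n \<odot> m) t" by (rule pullback_swap)
  moreover have "regular_mono C (p \<odot> tr)"
    using T by (rule terminal_regular_mono) (use p tr in \<open>auto simp: hom_iff\<close>)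
  ultimately show ?thesis by (rule regular_mono_pullback)
qed

text \<open>
  The pushout \<open>p\<close> of \<open>m\<close> is the subobject classified by the arrow that the characteristic arrow of
  \<open>m\<close> and the true arrow on \<open>B\<close> induce: the van Kampen property shows that \<open>p\<close> and the
  classified subobject agree.
\<close>

lemma regular_mono_pushout:
  assumes m: "regular_mono C m" and po: "is_pushout C f m p q"
  shows "regular_mono C p"
proof -
  obtain A B G D where t: "f \<in> hom C A B" "m \<in> hom C A G" "p \<in> hom C B D" "q \<in> hom C G D"
    using po by (rule pushout_types)
  obtain T \<Omega> tr where T: "is_terminal C T" and tr: "tr \<in> hom C T \<Omega>"
    and cl: "\<forall>m. regular_mono C m \<longrightarrow>
      (\<exists>\<chi> t. \<chi> \<in> hom C (Tgt C m) \<Omega> \<and> t \<in> hom C (Src C m) T \<and> is_pullback C \<chi> tr m t)"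
    by (rule classifier) blast
  note [simp] = t[THEN hom_types] tr[THEN hom_types]
  obtain \<chi> s where \<chi>: "\<chi> \<in> hom C G \<Omega>" and s: "s \<in> hom C A T" and pb: "is_pullback C \<chi> tr m s"
    using cl[rule_format, OF m] by auto
  obtain b where b: "b \<in> hom C B T" using terminal_ex[OF T] by fastforce
  note [simp] = \<chi>[THEN hom_types] s[THEN hom_types] b[THEN hom_types]
  have bf: "b \<odot> f = s"
    by (rule terminal_unique[OF T, of _ A]) (simp_all add: hom_iff)
  have "(tr \<odot> b) \<odot> f = \<chi> \<odot> m"
    using pullback_comm[OF pb] bf by simp
  then obtain u where u: "u \<in> hom C D \<Omega>" and up: "u \<odot> p = tr \<odot> b" and uq: "u \<odot> q = \<chi>"
    using pushout_factor[OF po t(3,4), of "tr \<odot> b" \<Omega> \<chi>] \<chi> by (auto simp: hom_iff)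
  note [simp] = u[THEN hom_types]
  obtain e w where pb_e: "is_pullback C u tr e w" using ex_pullback[OF u tr] by blast
  obtain E where e: "e \<in> hom C E D" and w: "w \<in> hom C E T"
    using pb_e u tr by (rule pullback_cone_types)
  note [simp] = e[THEN hom_types] w[THEN hom_types]
  have reg_e: "regular_mono C e"
    using pb_e terminal_regular_mono[OF T tr] by (rule regular_mono_pullback)
  obtain p' where p': "p' \<in> hom C B E" "e \<odot> p' = p" "w \<odot> p' = b"
    using pullback_factor[OF pb_e e w t(3) b up] .
  note [simp] = p'(1)[THEN hom_types]
  have "u \<odot> (q \<odot> m) = tr \<odot> s"
    using uq[THEN comp_eq, of m] pullback_comm[OF pb] by simp
  then obtain q' where q': "q' \<in> hom C A E" "e \<odot> q' = q \<odot> m" "w \<odot> q' = s"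
    using pullback_factor[OF pb_e e w, of "q \<odot> m" A s] by (auto simp: hom_iff)
  note [simp] = q'(1)[THEN hom_types]
  have p'f: "p' \<odot> f = q'"
  proof (rule pullback_cancel[OF pb_e e])
    show "e \<odot> (p' \<odot> f) = e \<odot> q'"
      using p'(2)[THEN comp_eq, of f] q'(2) pushout_comm[OF po] by simp
    show "w \<odot> (p' \<odot> f) = w \<odot> q'"
      using p'(3)[THEN comp_eq, of f] q'(3) bf by simp
  qed (auto simp: hom_iff)
  \<comment> \<open>The cube now stands on the given pushout with \<open>e\<close> as the vertical
    arrow into its tip. Its front faces are pullbacks: over \<open>p\<close> because
    \<open>p\<close> factors through the monic \<open>e\<close>, over \<open>q\<close> because the
    pullback square classifying \<open>m\<close> is the one of \<open>e\<close> pasted with it.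
    Hence the top is a pushout.\<close>
  have "is_pushout C f (Ident C A) p' q'"
  proof (rule van_kampen[OF m po, THEN iffD2])
    show "is_pullback C f (Ident C B) (Ident C A) f"
      using t(1) by (rule pullback_Ident)
    show "is_pullback C m m (Ident C A) (Ident C A)"
      using regular_mono_monic[OF m] t(2) by (rule pullback_of_mono_factor) (auto simp: hom_iff)
    show "commuting_square C f (Ident C A) p' q'"
      by (auto simp: commuting_square_def p'f)
    have "is_pullback C p e (Ident C B) p'"
      using regular_mono_monic[OF reg_e] e p'(1,2) by (rule pullback_of_mono_factor)
    moreover have "is_pullback C q e m q'"
      by (rule pullback_decompose[OF pb_e pb[folded uq] t(4) t(2) q'(1) e q'(2,3)])
    ultimately show "is_pullback C p e (Ident C B) p' \<and> is_pullback C q e m q'" ..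
  qed (use t e p' q' in \<open>auto simp: hom_iff\<close>)
  \<comment> \<open>Both cospans are pushouts of \<open>f\<close> along the identity, so
    \<open>p'\<close> is an isomorphism and \<open>p\<close> is regular along with
    \<open>e\<close>.\<close>
  moreover have "is_pushout C f (Ident C A) (Ident C B) f"
    using t(1) by (rule pushout_Ident)
  ultimately obtain i where i: "i \<in> isos C B E" "i \<odot> Ident C B = p' \<odot> Ident C B"
    using pushout_iso[of f "Ident C A" "Ident C B" f f "Ident C A" p' q' A B A B A B A E
        "Ident C A" "Ident C B" "Ident C A"] t p'(1) q'(1) Ident_isos[of A] Ident_isos[of B]
    by (auto simp: hom_iff)
  then have "p' \<in> isos C B E" using isos_hom[OF i(1)] by (simp add: hom_iff)
  then have "regular_mono C p'" by (rule regular_mono_iso)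
  then show ?thesis using regular_mono_comp[OF _ p'(1) reg_e e] p'(2) by simp
qed

text \<open>Let \<open>e\<close> be the equalizer of the cokernel pair of \<open>f\<close>. If
  \<open>u\<close> and \<open>v\<close> agree after \<open>h\<close>, then \<open>f\<close> factors
  through \<open>e \<odot> n\<close>, where \<open>n\<close> is their equalizer. Arrows
  \<open>c\<close>, \<open>d\<close> with equalizer \<open>e \<odot> n\<close> agree on
  \<open>f\<close>, hence factor through the cokernel pair, hence agree on \<open>e\<close>. So
  \<open>e\<close> factors through \<open>e \<odot> n\<close>, which splits \<open>n\<close> and
  forces \<open>u = v\<close>.\<close>

lemma epi_regular_mono_factorization:
  assumes f: "f \<in> hom C A B"
  obtains E h e where "h \<in> hom C A E" "e \<in> hom C E B" "regular_mono C e" "e \<odot> h = f"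
    "\<And>Z u v. u \<in> hom C E Z \<Longrightarrow> v \<in> hom C E Z \<Longrightarrow> u \<odot> h = v \<odot> h \<Longrightarrow> u = v"
proof -
  note [simp] = f[THEN hom_types]
  obtain r s where po: "is_pushout C f f r s" using ex_pushout[OF f f] by blast
  obtain P where rs: "r \<in> hom C B P" "s \<in> hom C B P"
    using po f f by (rule pushout_cocone_types)
  obtain E e where e: "e \<in> hom C E B" "regular_mono C e" "r \<odot> e = s \<odot> e"
    and ex: "\<And>Z h. h \<in> hom C Z B \<Longrightarrow> r \<odot> h = s \<odot> h \<Longrightarrow> \<exists>k. k \<in> hom C Z E \<and> e \<odot> k = h"
    using ex_equalizer[OF rs] by metis
  note [simp] = rs[THEN hom_types] e(1)[THEN hom_types]
  obtain h where h: "h \<in> hom C A E" "e \<odot> h = f"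
    using ex[OF f pushout_comm[OF po]] by blast
  note [simp] = h(1)[THEN hom_types]
  have "u = v" if u: "u \<in> hom C E Z" and v: "v \<in> hom C E Z" and uv: "u \<odot> h = v \<odot> h" for Z u v
  proof -
    note [simp] = u[THEN hom_types] v[THEN hom_types]
    obtain N n where n: "n \<in> hom C N E" "regular_mono C n" "u \<odot> n = v \<odot> n"
      and exn: "\<And>Y k. k \<in> hom C Y E \<Longrightarrow> u \<odot> k = v \<odot> k \<Longrightarrow> \<exists>l. l \<in> hom C Y N \<and> n \<odot> l = k"
      using ex_equalizer[OF u v] by metis
    note [simp] = n(1)[THEN hom_types]
    obtain l where l: "l \<in> hom C A N" "n \<odot> l = h" using exn[OF h(1) uv] by blast
    note [simp] = l(1)[THEN hom_types]
    \<comment> \<open>Here the closure under composition is essential: it presents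
      \<open>e \<odot> n\<close> as an equalizer of arrows out of \<open>B\<close>, the object on
      which the cokernel pair is defined.\<close>
    have "regular_mono C (e \<odot> n)" using n(2,1) e(2,1) by (rule regular_mono_comp)
    then obtain c d Y where cd: "c \<in> hom C B Y" "d \<in> hom C B Y" "c \<odot> (e \<odot> n) = d \<odot> (e \<odot> n)"
      and exc: "\<And>Z k. k \<in> hom C Z B \<Longrightarrow> c \<odot> k = d \<odot> k \<Longrightarrow> \<exists>l. l \<in> hom C Z N \<and> e \<odot> n \<odot> l = k"
      by (elim regular_monoE) (auto simp: hom_iff)
    note [simp] = cd(1,2)[THEN hom_types]
    have "c \<odot> f = c \<odot> (e \<odot> n) \<odot> l" "d \<odot> f = d \<odot> (e \<odot> n) \<odot> l"
      using l(2) h(2) by simp_all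
    then have "c \<odot> f = d \<odot> f" using cd(3) by simp
    then obtain x where x: "x \<in> hom C P Y" "x \<odot> r = c" "x \<odot> s = d"
      by (rule pushout_factor[OF po rs cd(1,2)])
    note [simp] = x(1)[THEN hom_types]
    have "c \<odot> e = d \<odot> e"
      using e(3) x(2)[THEN comp_eq, of e] x(3)[THEN comp_eq, of e] by simp
    then obtain k where k: "k \<in> hom C E N" "e \<odot> n \<odot> k = e" using exc[OF e(1)] by blast
    note [simp] = k(1)[THEN hom_types]
    have "n \<odot> k = Ident C E"
      using k(2) by - (rule monic_cancel[OF regular_mono_monic[OF e(2)]], simp_all)
    then show "u = v"
      using n(3)[THEN comp_eq, of k] by simp
  qed
  with h(1) e(1,2) h(2) show ?thesis by (rule that)
qed

end

section \<open>Multi-sums and chosen pushouts and pullbacks\<close>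

context rm_cat
begin

lemma po_is_pushout:
  assumes "f \<in> hom C A B" "g \<in> hom C A G" "po C f g = (p, q)"
  shows "is_pushout C f g p q"
proof -
  have "\<exists>pq. case pq of (p, q) \<Rightarrow> is_pushout C f g p q"
    using ex_pushout[OF assms(1,2)] by auto
  from someI_ex[OF this] show ?thesis
    using assms(3) by (simp add: po_def)
qed

lemma pb_is_pullback:
  assumes "f \<in> hom C B D" "g \<in> hom C G D" "pb C f g = (p, q)"
  shows "is_pullback C f g p q"
proof -
  have "\<exists>pq. case pq of (p, q) \<Rightarrow> is_pullback C f g p q"
    using ex_pullback[OF assms(1,2)] by auto
  from someI_ex[OF this] show ?thesis
    using assms(3) by (simp add: pb_def)
qed

text \<open>Equivalent to the copairing out of a coproduct being epi, but stated without naming a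
  coproduct. Cospans of regular monos with this property form the multi-sum exhibited in
  \<open>ex_multi_sum\<close>.\<close>

definition jointly_epi :: "'a \<Rightarrow> 'a \<Rightarrow> bool" where
  "jointly_epi f g \<longleftrightarrow> (\<forall>Z. \<forall>u\<in>hom C (Tgt C f) Z. \<forall>v\<in>hom C (Tgt C f) Z.
     u \<odot> f = v \<odot> f \<longrightarrow> u \<odot> g = v \<odot> g \<longrightarrow> u = v)"

text \<open>Diagonal fill-in: present \<open>y'\<close> as the equalizer of \<open>c\<close> and
  \<open>d\<close>. Then \<open>c \<odot> y\<close> and \<open>d \<odot> y\<close> agree on
  \<open>f\<close> and on \<open>g\<close>, hence are equal, and \<open>y\<close> factors through
  \<open>y'\<close>.\<close>

lemma jointly_epi_lift:
  assumes e: "jointly_epi f g" and y': "regular_mono C y'"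
    and t: "f \<in> hom C A Y" "g \<in> hom C B Y" "f' \<in> hom C A Y'" "g' \<in> hom C B Y'"
      "y \<in> hom C Y Z" "y' \<in> hom C Y' Z"
    and eq: "y \<odot> f = y' \<odot> f'" "y \<odot> g = y' \<odot> g'"
  obtains \<phi> where "\<phi> \<in> hom C Y Y'" "y' \<odot> \<phi> = y" "\<phi> \<odot> f = f'" "\<phi> \<odot> g = g'"
proof -
  note [simp] = t[THEN hom_types]
  obtain c d W where cd: "c \<in> hom C Z W" "d \<in> hom C Z W" "c \<odot> y' = d \<odot> y'"
    and ex: "\<And>V h. h \<in> hom C V Z \<Longrightarrow> c \<odot> h = d \<odot> h \<Longrightarrow> \<exists>k. k \<in> hom C V Y' \<and> y' \<odot> k = h"
    using y' t(6) by (elim regular_monoE) (auto simp: hom_iff)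
  note [simp] = cd(1,2)[THEN hom_types]
  have "(c \<odot> y) \<odot> f = (d \<odot> y) \<odot> f" "(c \<odot> y) \<odot> g = (d \<odot> y) \<odot> g"
    using cd(3)[THEN comp_eq, of f'] cd(3)[THEN comp_eq, of g'] by (simp_all add: eq)
  then have "c \<odot> y = d \<odot> y"
    using e[unfolded jointly_epi_def, rule_format, of "c \<odot> y" W "d \<odot> y"] by (simp add: hom_iff)
  then obtain \<phi> where \<phi>: "\<phi> \<in> hom C Y Y'" "y' \<odot> \<phi> = y" using ex[OF t(5)] by blast
  note [simp] = \<phi>(1)[THEN hom_types]
  have "\<phi> \<odot> f = f'"
    using \<phi>(2)[THEN comp_eq, of f] eq
    by - (rule monic_cancel[OF regular_mono_monic[OF y']], simp_all)
  moreover have "\<phi> \<odot> g = g'"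
    using \<phi>(2)[THEN comp_eq, of g] eq
    by - (rule monic_cancel[OF regular_mono_monic[OF y']], simp_all)
  ultimately show ?thesis using that \<phi> by blast
qed

text \<open>Factor the copairing of \<open>a\<close> and \<open>b\<close> as an epi followed by a
  regular mono \<open>y\<close>. Joint epicity is inherited from the coproduct injections, and
  regularity of \<open>f\<close> and \<open>g\<close> from \<open>a\<close> and \<open>b\<close>
  because \<open>y\<close> is monic.\<close>

lemma jointly_epi_regular_factorization:
  assumes a: "regular_mono C a" "a \<in> hom C A Z" and b: "regular_mono C b" "b \<in> hom C B Z"
  obtains Y f g y where "f \<in> hom C A Y" "g \<in> hom C B Y" "y \<in> hom C Y Z" "jointly_epi f g"
    "regular_mono C f" "regular_mono C g" "regular_mono C y" "y \<odot> f = a" "y \<odot> g = b"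
proof -
  note [simp] = a(2)[THEN hom_types] b(2)[THEN hom_types]
  obtain S i j where ij: "i \<in> hom C A S" "j \<in> hom C B S"
    and ex: "\<And>Z x y. x \<in> hom C A Z \<Longrightarrow> y \<in> hom C B Z \<Longrightarrow> \<exists>u. u \<in> hom C S Z \<and> u \<odot> i = x \<and> u \<odot> j = y"
    and un: "\<And>Z u v. u \<in> hom C S Z \<Longrightarrow> v \<in> hom C S Z \<Longrightarrow> u \<odot> i = v \<odot> i \<Longrightarrow> u \<odot> j = v \<odot> j \<Longrightarrow> u = v"
    by (rule ex_coproduct[of A B]) auto
  note [simp] = ij[THEN hom_types]
  obtain ab where ab: "ab \<in> hom C S Z" "ab \<odot> i = a" "ab \<odot> j = b" using ex[OF a(2) b(2)] by blast
  obtain Y h y where h: "h \<in> hom C S Y" and y: "y \<in> hom C Y Z" "regular_mono C y" "y \<odot> h = ab"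
    and epi: "\<And>V u v. u \<in> hom C Y V \<Longrightarrow> v \<in> hom C Y V \<Longrightarrow> u \<odot> h = v \<odot> h \<Longrightarrow> u = v"
    using epi_regular_mono_factorization[OF ab(1)] by metis
  note [simp] = h[THEN hom_types] y(1)[THEN hom_types]
  have fa: "y \<odot> (h \<odot> i) = a" "y \<odot> (h \<odot> j) = b"
    using y(3)[THEN comp_eq, of i] y(3)[THEN comp_eq, of j] ab(2,3) by simp_all
  have t: "h \<odot> i \<in> hom C A Y" "h \<odot> j \<in> hom C B Y" by (simp_all add: hom_iff)
  have "jointly_epi (h \<odot> i) (h \<odot> j)"
    unfolding jointly_epi_def
  proof (intro allI ballI impI)
    fix V u v
    assume "u \<in> hom C (Tgt C (h \<odot> i)) V" "v \<in> hom C (Tgt C (h \<odot> i)) V"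
      and eqs: "u \<odot> (h \<odot> i) = v \<odot> (h \<odot> i)" "u \<odot> (h \<odot> j) = v \<odot> (h \<odot> j)"
    then have uv: "u \<in> hom C Y V" "v \<in> hom C Y V" by (simp_all add: hom_iff)
    note [simp] = uv[THEN hom_types]
    show "u = v"
      using eqs by - (rule epi[OF uv], rule un[of _ V], simp_all add: hom_iff)
  qed
  moreover have "regular_mono C (h \<odot> i)" "regular_mono C (h \<odot> j)"
    using regular_mono_factor[OF a(1) regular_mono_monic[OF y(2)] y(1) t(1) fa(1)]
      regular_mono_factor[OF b(1) regular_mono_monic[OF y(2)] y(1) t(2) fa(2)] by auto
  ultimately show ?thesis using that t y(1,2) fa by blast
qed

text \<open>All jointly epic cospans of regular monos are taken, isomorphic ones included, which the
  definition allows since it only demands comparison isomorphisms. Two factorizations of one cospan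
  lift through each other by \<open>jointly_epi_lift\<close>, and the lifts are mutually inverse
  because \<open>y\<close> and \<open>y'\<close> are monic.\<close>

lemma ex_multi_sum: "\<exists>S. is_multi_sum C A B S"
proof
  let ?S = "{(f, g). regular_mono C f \<and> regular_mono C g \<and> Src C f = A \<and> Src C g = B \<and>
      Tgt C f = Tgt C g \<and> jointly_epi f g}"
  show "is_multi_sum C A B ?S"
    unfolding is_multi_sum_def
  proof (rule conjI, blast, intro allI impI, elim conjE, rule conjI)
    fix a b
    assume ab: "regular_mono C a" "regular_mono C b"
      and "Src C a = A" "Src C b = B" "Tgt C a = Tgt C b"
    then have t: "a \<in> hom C A (Tgt C a)" "b \<in> hom C B (Tgt C a)"
      by (auto simp: hom_iff regular_mono_Arr)
    obtain Y f g y where "f \<in> hom C A Y" "g \<in> hom C B Y" "y \<in> hom C Y (Tgt C a)" "jointly_epi f g"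
      "regular_mono C f" "regular_mono C g" "regular_mono C y" "y \<odot> f = a" "y \<odot> g = b"
      using jointly_epi_regular_factorization[OF ab(1) t(1) ab(2) t(2)] by metis
    then show "\<exists>(f, g)\<in>?S. \<exists>y\<in>hom C (Tgt C f) (Tgt C a). regular_mono C y \<and> y \<odot> f = a \<and> y \<odot> g = b"
      by (intro bexI[of _ "(f, g)"]) (auto simp: hom_iff)
    have "\<exists>!\<phi>. \<phi> \<in> isos C (Tgt C f) (Tgt C f') \<and> \<phi> \<odot> f = f' \<and> \<phi> \<odot> g = g' \<and> y' \<odot> \<phi> = y"
      if f: "(f, g) \<in> ?S" "(f', g') \<in> ?S" and y: "y \<in> hom C (Tgt C f) (Tgt C a)"
        "y' \<in> hom C (Tgt C f') (Tgt C a)" "regular_mono C y" "y \<odot> f = a" "y \<odot> g = b"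
        "regular_mono C y'" "y' \<odot> f' = a" "y' \<odot> g' = b" for f g f' g' y y'
    proof -
      from f have t: "f \<in> hom C A (Tgt C f)" "g \<in> hom C B (Tgt C f)"
        "f' \<in> hom C A (Tgt C f')" "g' \<in> hom C B (Tgt C f')"
        and e: "jointly_epi f g" "jointly_epi f' g'"
        by (auto simp: hom_iff regular_mono_Arr)
      have eqs: "y \<odot> f = y' \<odot> f'" "y \<odot> g = y' \<odot> g'" using y by simp_all
      obtain \<phi> where \<phi>: "\<phi> \<in> hom C (Tgt C f) (Tgt C f')" "y' \<odot> \<phi> = y" "\<phi> \<odot> f = f'" "\<phi> \<odot> g = g'"
        using jointly_epi_lift[OF e(1) y(6) t y(1,2) eqs] by metis
      obtain \<psi> where \<psi>: "\<psi> \<in> hom C (Tgt C f') (Tgt C f)" "y \<odot> \<psi> = y'"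
        using jointly_epi_lift[OF e(2) y(3) t(3,4,1,2) y(2,1) eqs[symmetric]] by metis
      note [simp] = \<phi>(1)[THEN hom_types] \<psi>(1)[THEN hom_types] y(1,2)[THEN hom_types]
      have "\<psi> \<odot> \<phi> = Ident C (Tgt C f)"
        using \<psi>(2)[THEN comp_eq, of \<phi>] \<phi>(2)
        by - (rule monic_cancel[OF regular_mono_monic[OF y(3)]], simp_all)
      moreover have "\<phi> \<odot> \<psi> = Ident C (Tgt C f')"
        using \<phi>(2)[THEN comp_eq, of \<psi>] \<psi>(2)
        by - (rule monic_cancel[OF regular_mono_monic[OF y(6)]], simp_all)
      ultimately have "\<phi> \<in> isos C (Tgt C f) (Tgt C f')" using \<phi>(1) \<psi>(1) isosI by metis
      moreover have "\<phi>' = \<phi>" if "\<phi>' \<in> isos C (Tgt C f) (Tgt C f')" "y' \<odot> \<phi>' = y" for \<phi>'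
        using that(2) \<phi>(2) isos_hom[OF that(1), THEN hom_types]
        by - (rule monic_cancel[OF regular_mono_monic[OF y(6)]], simp_all)
      ultimately show ?thesis using \<phi> by blast
    qed
    then show "\<forall>(f, g)\<in>?S. \<forall>(f', g')\<in>?S. \<forall>y\<in>hom C (Tgt C f) (Tgt C a). \<forall>y'\<in>hom C (Tgt C f') (Tgt C a).
           regular_mono C y \<and> y \<odot> f = a \<and> y \<odot> g = b \<and>
           regular_mono C y' \<and> y' \<odot> f' = a \<and> y' \<odot> g' = b \<longrightarrow>
           (\<exists>!\<phi>. \<phi> \<in> isos C (Tgt C f) (Tgt C f') \<and> \<phi> \<odot> f = f' \<and> \<phi> \<odot> g = g' \<and> y' \<odot> \<phi> = y)"
      by blast
  qed
qed

lemma Msum_is_multi_sum: "is_multi_sum C A B (Msum C A B)"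
  unfolding Msum_def by (rule someI_ex[OF ex_multi_sum])

lemma Msum_types:
  assumes "(f, g) \<in> Msum C A B"
  obtains Y where "f \<in> hom C A Y" "g \<in> hom C B Y"
proof -
  have "\<forall>(f, g)\<in>Msum C A B. regular_mono C f \<and> regular_mono C g \<and>
        Src C f = A \<and> Src C g = B \<and> Tgt C f = Tgt C g"
    using Msum_is_multi_sum unfolding is_multi_sum_def by (rule conjunct1)
  with assms show ?thesis
    using that[of "Tgt C f"] by (auto simp: hom_iff regular_mono_Arr)
qed

lemma Msum_factor:
  assumes "regular_mono C a" "regular_mono C b" "a \<in> hom C A Z" "b \<in> hom C B Z"
  obtains f g Y y where "(f, g) \<in> Msum C A B" "f \<in> hom C A Y" "g \<in> hom C B Y" "y \<in> hom C Y Z"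
    "regular_mono C y" "y \<odot> f = a" "y \<odot> g = b"
proof -
  have "\<exists>(f, g)\<in>Msum C A B. \<exists>y\<in>hom C (Tgt C f) (Tgt C a).
           regular_mono C y \<and> y \<odot> f = a \<and> y \<odot> g = b"
    using Msum_is_multi_sum[of A B, unfolded is_multi_sum_def, THEN conjunct2, rule_format, of a b]
      assms by (auto simp: hom_iff)
  then obtain f g y where fg: "(f, g) \<in> Msum C A B" and
    y: "y \<in> hom C (Tgt C f) (Tgt C a)" "regular_mono C y" "y \<odot> f = a" "y \<odot> g = b"
    by blast
  obtain Y where Y: "f \<in> hom C A Y" "g \<in> hom C B Y" using fg by (rule Msum_types)
  with y(1) assms(3) have "y \<in> hom C Y Z" by (simp add: hom_iff)
  with that fg Y y show ?thesis by blast
qed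

text \<open>This is the uniqueness clause of a multi-sum at the cospan
  \<open>(y \<odot> f, y \<odot> g)\<close>. It identifies the overlaps of the rules in two
  equivalent two-step derivations.\<close>

lemma Msum_iso:
  assumes fg: "(f, g) \<in> Msum C A B" "(f', g') \<in> Msum C A B"
    and y: "regular_mono C y" "regular_mono C y'"
    and t: "f \<in> hom C A Y" "g \<in> hom C B Y" "f' \<in> hom C A Y'" "g' \<in> hom C B Y'"
      "y \<in> hom C Y Z" "y' \<in> hom C Y' Z"
    and eqs: "y \<odot> f = y' \<odot> f'" "y \<odot> g = y' \<odot> g'"
    and reg: "regular_mono C (y \<odot> f)" "regular_mono C (y \<odot> g)"
  obtains \<phi> where "\<phi> \<in> isos C Y Y'" "\<phi> \<odot> f = f'" "\<phi> \<odot> g = g'" "y' \<odot> \<phi> = y"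
proof -
  note [simp] = t[THEN hom_types]
  have *: "regular_mono C (y \<odot> f) \<and> regular_mono C (y \<odot> g) \<and> Src C (y \<odot> f) = A \<and>
      Src C (y \<odot> g) = B \<and> Tgt C (y \<odot> f) = Tgt C (y \<odot> g)"
    using reg by simp
  note Q = Msum_is_multi_sum[of A B, unfolded is_multi_sum_def, THEN conjunct2, rule_format,
      OF *, THEN conjunct2]
  note Q = bspec[OF Q fg(1), unfolded prod.case]
  note Q = bspec[OF Q fg(2), unfolded prod.case]
  have "y \<in> hom C (Tgt C f) (Tgt C (y \<odot> f))" "y' \<in> hom C (Tgt C f') (Tgt C (y \<odot> f))"
    by (simp_all add: hom_iff)
  note Q = bspec[OF bspec[OF Q this(1)] this(2)]
  have "\<exists>!\<phi>. \<phi> \<in> isos C (Tgt C f) (Tgt C f') \<and> \<phi> \<odot> f = f' \<and> \<phi> \<odot> g = g' \<and> y' \<odot> \<phi> = y"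
    by (rule Q[THEN mp]) (simp add: y eqs)
  then show ?thesis using that by auto
qed

section \<open>Van Kampen cubes\<close>

text \<open>Contexts of derivations are reached through contexts of the rules, as in
  \<open>mb1 = k1 \<odot> jb1\<close>. A pushout along such a composite is cut here at the
  intermediate context; the second half is a pushout by the decomposition law.\<close>

lemma pushout_split:
  assumes po: "is_pushout C f g p q" and po': "is_pushout C f (k \<odot> g) p' q'"
    and t: "f \<in> hom C A B" "g \<in> hom C A G" "p \<in> hom C B D" "q \<in> hom C G D"
    and t': "p' \<in> hom C B D'" "q' \<in> hom C G' D'" and k: "k \<in> hom C G G'"
  obtains v where "v \<in> hom C D D'" "v \<odot> p = p'" "v \<odot> q = q' \<odot> k" "is_pushout C q k v q'"
proof -
  note [simp] = t[THEN hom_types] t'[THEN hom_types] k[THEN hom_types]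
  have "p' \<odot> f = (q' \<odot> k) \<odot> g" using pushout_comm[OF po'] by simp
  then obtain v where v: "v \<in> hom C D D'" "v \<odot> p = p'" "v \<odot> q = q' \<odot> k"
    using pushout_factor[OF po t(3,4) t'(1), of "q' \<odot> k"] by (auto simp: hom_iff)
  have "is_pushout C k q q' v"
    by (rule pushout_decompose[OF pushout_swap[OF po] pushout_swap[OF po'] k t'(2) v(1) t(4) v(3,2)])
  then show ?thesis using that v pushout_swap by blast
qed

text \<open>Pull the pushout back along \<open>y\<close>. Because \<open>p\<close> factors through
  the monic \<open>y\<close>, nothing changes over \<open>B\<close> and \<open>A\<close>, so all
  side faces are pullbacks and the van Kampen property makes the restricted square a pushout. As
  \<open>m = k \<odot> n\<close>, the complementary square is a pushout by decomposition.\<close>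

lemma pushout_restrict:
  assumes po: "is_pushout C f m p q" and m: "regular_mono C m"
    and t: "f \<in> hom C A B" "m \<in> hom C A G" "p \<in> hom C B D" "q \<in> hom C G D"
    and y: "y \<in> hom C J D" "regular_mono C y" and j: "j \<in> hom C B J" "y \<odot> j = p"
    and pb: "is_pullback C y q c k" and ck: "c \<in> hom C P J" "k \<in> hom C P G"
  obtains n where "n \<in> hom C A P" "k \<odot> n = m" "is_pushout C f n j c" "regular_mono C n"
    "is_pushout C c k y q"
proof -
  note [simp] = t[THEN hom_types] y(1)[THEN hom_types] j(1)[THEN hom_types] ck[THEN hom_types]
  have reg_k: "regular_mono C k"
    using pullback_swap[OF pb] y(2) by (rule regular_mono_pullback)
  have "y \<odot> (j \<odot> f) = q \<odot> m"
    using j(2)[THEN comp_eq, of f] pushout_comm[OF po] by simp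
  then obtain n where n: "n \<in> hom C A P" "c \<odot> n = j \<odot> f" "k \<odot> n = m"
    using pullback_factor[OF pb ck, of "j \<odot> f" A m] t(2) by (auto simp: hom_iff)
  note [simp] = n(1)[THEN hom_types]
  have po_n: "is_pushout C f n j c"
  proof (rule van_kampen[OF m po, THEN iffD2])
    show "is_pullback C f (Ident C B) (Ident C A) f"
      using t(1) by (rule pullback_Ident)
    show "is_pullback C m k (Ident C A) n"
      using regular_mono_monic[OF reg_k] ck(2) n(1,3) by (rule pullback_of_mono_factor)
    show "commuting_square C f n j c"
      by (simp add: commuting_square_def n)
    show "is_pullback C p y (Ident C B) j \<and> is_pullback C q y k c"
      using pullback_of_mono_factor[OF regular_mono_monic[OF y(2)] y(1) j] pullback_swap[OF pb] ..
    show "y \<odot> c = q \<odot> k" using pb by (rule pullback_comm)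
  qed (use t y j in \<open>auto simp: hom_iff\<close>)
  have "regular_mono C n"
    using m regular_mono_monic[OF reg_k] ck(2) n(1,3) by (rule regular_mono_factor)
  moreover have "is_pushout C k c q y"
    using pushout_swap[OF po_n] pushout_swap[OF po, folded n(3)] ck(2) t(4) y(1) ck(1)
      pullback_comm[OF pb] j(2) by (rule pushout_decompose)
  ultimately show ?thesis using that n po_n pushout_swap by blast
qed

text \<open>The van Kampen property asks for both back faces. One of them is given as a pullback,
  and the other is forced by it and by the front faces.\<close>

lemma cube_pullback:
  assumes po: "is_pushout C f m p q" and m: "regular_mono C m"
    and t: "f \<in> hom C A B" "m \<in> hom C A G" "p \<in> hom C B D" "q \<in> hom C G D"
    and e: "e \<in> hom C D' D"
    and pbs: "is_pullback C p e b p'" "is_pullback C q e d q'" "is_pullback C f b a f'"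
    and t': "a \<in> hom C A' A" "d \<in> hom C G' G" "m' \<in> hom C A' G'"
    and eqs: "d \<odot> m' = m \<odot> a" "q' \<odot> m' = p' \<odot> f'"
  shows "is_pullback C m d a m'" "is_pushout C f' m' p' q'"
proof -
  obtain B' where b: "b \<in> hom C B' B" "p' \<in> hom C B' D'"
    using pbs(1) t(3) e by (rule pullback_cone_types)
  have q': "q' \<in> hom C G' D'" and f': "f' \<in> hom C A' B'"
    using pbs(2,3) t' b t e by (elim pullback_types; simp add: hom_iff)+
  \<comment> \<open>The diagonal of the bottom is both \<open>p \<odot> f\<close> and
    \<open>q \<odot> m\<close>: the pullback pasted along the first path is decomposed along the
    second.\<close>
  have "is_pullback C (q \<odot> m) e a (p' \<odot> f')"
    using pullback_paste[OF pbs(1,3)] pushout_comm[OF po] by simp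
  then show pb: "is_pullback C m d a m'"
    by (rule pullback_decompose[OF pbs(2) _ t(2) t'(1) t'(3) t'(2) eqs])
  show "is_pushout C f' m' p' q'"
  proof (rule van_kampen[OF m po, THEN iffD2])
    show "commuting_square C f' m' p' q'"
      using b q' f' t' eqs(2) by (simp add: commuting_square_def hom_iff)
    show "is_pullback C p e b p' \<and> is_pullback C q e d q'" using pbs by simp
    show "e \<odot> p' = p \<odot> b" "e \<odot> q' = q \<odot> d" using pbs(1,2)[THEN pullback_comm] by simp_all
  qed (fact pbs pb e t b)+
qed

end

section \<open>Bijections of quotients\<close>

text \<open>The partners of the members of one class fill exactly one class: \<open>compat\<close>
  puts them into a common class, and totality on the side of \<open>B\<close> together with the
  reverse implication in \<open>compat\<close> shows that no element of it is missed. Injectivity is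
  \<open>compat\<close> once more.\<close>

lemma quotient_bij_of_relation:
  assumes r: "equiv A r" and s: "equiv B s"
    and total: "\<And>a. a \<in> A \<Longrightarrow> \<exists>b\<in>B. R a b" "\<And>b. b \<in> B \<Longrightarrow> \<exists>a\<in>A. R a b"
    and compat: "\<And>a a' b b'. R a b \<Longrightarrow> R a' b' \<Longrightarrow> (a, a') \<in> r \<longleftrightarrow> (b, b') \<in> s"
    and dom: "\<And>a b. R a b \<Longrightarrow> a \<in> A \<and> b \<in> B"
  shows "bij_betw (\<lambda>S. {b. \<exists>a\<in>S. R a b}) (A // r) (B // s)"
proof -
  have image_class: "{b. \<exists>a\<in>r `` {a0}. R a b} = s `` {b0}" if "R a0 b0" for a0 b0
  proof (intro equalityI subsetI)
    fix b
    assume "b \<in> {b. \<exists>a\<in>r `` {a0}. R a b}"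
    then show "b \<in> s `` {b0}" using compat[OF that] by auto
  next
    fix b
    assume b: "b \<in> s `` {b0}"
    then have "b \<in> B" using s by (auto simp: equiv_def)
    then obtain a where "R a b" using total(2) by blast
    then show "b \<in> {b. \<exists>a\<in>r `` {a0}. R a b}" using b compat[OF that] by auto
  qed
  show ?thesis
  proof (rule bij_betwI')
    fix S T
    assume "S \<in> A // r" "T \<in> A // r"
    then obtain a a' where a: "a \<in> A" "S = r `` {a}" "a' \<in> A" "T = r `` {a'}"
      by (auto elim!: quotientE)
    obtain b b' where b: "R a b" "R a' b'" using total(1) a(1,3) by blast
    have "r `` {a} = r `` {a'} \<longleftrightarrow> (a, a') \<in> r" using eq_equiv_class_iff[OF r a(1,3)] .
    moreover have "s `` {b} = s `` {b'} \<longleftrightarrow> (b, b') \<in> s"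
      using eq_equiv_class_iff[OF s] dom[OF b(1)] dom[OF b(2)] by blast
    ultimately show "({b. \<exists>a\<in>S. R a b} = {b. \<exists>a\<in>T. R a b}) = (S = T)"
      unfolding a(2,4) image_class[OF b(1)] image_class[OF b(2)] using compat[OF b] by simp
  next
    fix S
    assume "S \<in> A // r"
    then obtain a where a: "a \<in> A" "S = r `` {a}" by (auto elim!: quotientE)
    obtain b where b: "b \<in> B" "R a b" using total(1) a(1) by blast
    show "{b. \<exists>a\<in>S. R a b} \<in> B // s"
      unfolding a(2) image_class[OF b(2)] using b(1) by (rule quotientI)
  next
    fix T
    assume "T \<in> B // s"
    then obtain b where b: "b \<in> B" "T = s `` {b}" by (auto elim!: quotientE)
    obtain a where a: "a \<in> A" "R a b" using total(2) b(1) by blast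
    show "\<exists>S\<in>A // r. T = {b. \<exists>a\<in>S. R a b}"
      unfolding b(2) image_class[OF a(2), symmetric] using quotientI[OF a(1)] by blast
  qed
qed

section \<open>Two-step derivations and composite derivations\<close>

locale rule_pair = rm_cat +
  fixes o1 i1 o2 i2 K1 O1 I1 K2 O2 I2 X0
  assumes rule_types: "o1 \<in> hom C K1 O1" "i1 \<in> hom C K1 I1" "o2 \<in> hom C K2 O2" "i2 \<in> hom C K2 I2"
    and X0: "X0 \<in> Obj C"

text \<open>The vertices of both steps and the chosen pushouts are given names, so that arguments
  concern one diagram instead of nested tuples. \<open>n1\<close> is the comatch of the first rule,
  \<open>X1\<close> the intermediate object and \<open>X2\<close> the result.\<close>

locale sequence = rule_pair +
  fixes m1 mb1 ib1 n1 d1 m2 mb2 ib2 n2 d2 Y0 X1 Y1 X2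
  assumes sequence_types:
      "mb1 \<in> hom C K1 Y0" "ib1 \<in> hom C Y0 X0" "m1 \<in> hom C I1 X0"
      "n1 \<in> hom C O1 X1" "d1 \<in> hom C Y0 X1" "m2 \<in> hom C I2 X1" "mb2 \<in> hom C K2 Y1"
      "ib2 \<in> hom C Y1 X1" "n2 \<in> hom C O2 X2" "d2 \<in> hom C Y1 X2"
    and sequence_regular:
      "regular_mono C m1" "regular_mono C mb1" "regular_mono C m2" "regular_mono C mb2"
    and po_in1: "is_pushout C i1 mb1 m1 ib1" and po_in2: "is_pushout C i2 mb2 m2 ib2"
    and po_eq1: "po C o1 mb1 = (n1, d1)" and po_eq2: "po C o2 mb2 = (n2, d2)"

text \<open>\<open>c2\<close> and \<open>c1\<close> are the barred \<open>i2\<close> and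
  \<open>o1\<close> of the match of rules; \<open>(w, x, z)\<close> is the match of the composite
  rule into \<open>X0\<close>, whose input leg is \<open>t \<odot> q : K21 \<rightarrow> I21\<close>
  and whose output leg is \<open>u \<odot> p : K21 \<rightarrow> O21\<close>.\<close>

locale composite = rule_pair +
  fixes j2 j1 jb2 c2 jb1 c1 s t p q u0 u w x z J L2 L1 I21 K21 O21 Z
  assumes composite_types:
      "j2 \<in> hom C I2 J" "j1 \<in> hom C O1 J" "jb2 \<in> hom C K2 L2" "c2 \<in> hom C L2 J"
      "jb1 \<in> hom C K1 L1" "c1 \<in> hom C L1 J" "s \<in> hom C I1 I21" "t \<in> hom C L1 I21"
      "p \<in> hom C K21 L2" "q \<in> hom C K21 L1" "u0 \<in> hom C O2 O21" "u \<in> hom C L2 O21"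
      "w \<in> hom C I21 X0" "x \<in> hom C K21 Z" "z \<in> hom C Z X0"
    and composite_regular:
      "regular_mono C jb2" "regular_mono C jb1" "regular_mono C w" "regular_mono C x"
    and multi_sum: "(j2, j1) \<in> Msum C I2 O1"
    and po_j2: "is_pushout C i2 jb2 j2 c2" and po_j1: "is_pushout C o1 jb1 j1 c1"
    and po_st_eq: "po C i1 jb1 = (s, t)" and po_u_eq: "po C o2 jb2 = (u0, u)"
    and pb_pq_eq: "pb C c2 c1 = (p, q)"
    and po_in21: "is_pushout C (t \<odot> q) x w z"

text \<open>
  A linked pair is a common refinement of a two-step derivation and a composite derivation: \<open>y\<close>
  embeds the overlap \<open>J\<close> of the rules into \<open>X1\<close>, \<open>k1\<close> and \<open>k2\<close> are the pullbacks of \<open>y\<close> along the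
  two contexts, and the context \<open>Z\<close> of the composite derivation is the intersection of the contexts
  of the two steps.
\<close>

locale link = sequence + composite +
  fixes y k1 k2 a b
  assumes link_types: "y \<in> hom C J X1" "k1 \<in> hom C L1 Y0" "k2 \<in> hom C L2 Y1"
      "a \<in> hom C Z Y1" "b \<in> hom C Z Y0"
    and y_regular: "regular_mono C y"
    and y_j: "y \<odot> j2 = m2" "y \<odot> j1 = n1"
    and k_jb: "k1 \<odot> jb1 = mb1" "k2 \<odot> jb2 = mb2"
    and w_eqs: "w \<odot> s = m1" "w \<odot> t = ib1 \<odot> k1" and z_eq: "ib1 \<odot> b = z"
    and pb_c2: "is_pullback C y ib2 c2 k2" and pb_c1: "is_pullback C y d1 c1 k1"
    and pb_ab: "is_pullback C ib2 d1 a b"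
    and po_k2: "is_pushout C p x k2 a" and po_k1: "is_pushout C q x k1 b"

context sequence
begin

lemma po_out1: "is_pushout C o1 mb1 n1 d1"
  using rule_types(1) sequence_types(1) po_eq1 by (rule po_is_pushout)

lemma po_out2: "is_pushout C o2 mb2 n2 d2"
  using rule_types(3) sequence_types(7) po_eq2 by (rule po_is_pushout)

lemma n1_regular: "regular_mono C n1"
  using sequence_regular(2) po_out1 by (rule regular_mono_pushout)

end

context composite
begin

lemma po_st: "is_pushout C i1 jb1 s t"
  using rule_types(2) composite_types(5) po_st_eq by (rule po_is_pushout)

lemma po_u: "is_pushout C o2 jb2 u0 u"
  using rule_types(3) composite_types(3) po_u_eq by (rule po_is_pushout)

lemma pb_pq: "is_pullback C c2 c1 p q"
  using composite_types(4,6) pb_pq_eq by (rule pb_is_pullback)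

lemma dpo_compose_eq:
  "dpo_compose C (o2, i2) (j2, j1, jb2, c2, jb1, c1) (o1, i1) = (u \<odot> p, t \<odot> q)"
  by (simp add: dpo_compose_def span_comp_def po_st_eq po_u_eq pb_pq_eq)

end

section \<open>Passage between the sets of pairs of matches and the named diagrams\<close>

context rule_pair
begin

lemma sequence_mem:
  assumes "sequence C o1 i1 o2 i2 K1 O1 I1 K2 O2 I2 X0
      m1 mb1 ib1 n1 d1 m2 mb2 ib2 n2 d2 Y0 X1 Y1 X2"
  shows "((m1, mb1, ib1), (m2, mb2, ib2)) \<in> match_sequences C (o2, i2) (o1, i1) X0"
proof -
  interpret sequence C o1 i1 o2 i2 K1 O1 I1 K2 O2 I2 X0
      m1 mb1 ib1 n1 d1 m2 mb2 ib2 n2 d2 Y0 X1 Y1 X2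
    by fact
  note [simp] = rule_types[THEN hom_types] sequence_types[THEN hom_types]
  show ?thesis
    by (simp add: match_sequences_def dpo_matches_def dpo_result_def mPOC_def hom_iff po_eq1
        sequence_regular po_in1 po_in2)
qed

lemma match_sequencesE:
  assumes "S \<in> match_sequences C (o2, i2) (o1, i1) X0"
  obtains m1 mb1 ib1 n1 d1 m2 mb2 ib2 n2 d2 Y0 X1 Y1 X2
  where "S = ((m1, mb1, ib1), (m2, mb2, ib2))"
    "sequence C o1 i1 o2 i2 K1 O1 I1 K2 O2 I2 X0 m1 mb1 ib1 n1 d1 m2 mb2 ib2 n2 d2 Y0 X1 Y1 X2"
proof -
  note [simp] = rule_types[THEN hom_types]
  obtain m1 mb1 ib1 m2 mb2 ib2 where S: "S = ((m1, mb1, ib1), (m2, mb2, ib2))"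
    by (metis prod.exhaust)
  obtain n1 d1 where po1: "po C o1 mb1 = (n1, d1)" by (metis prod.exhaust)
  obtain n2 d2 where po2: "po C o2 mb2 = (n2, d2)" by (metis prod.exhaust)
  from assms have m1: "regular_mono C m1" "m1 \<in> hom C I1 X0"
      "regular_mono C mb1" "is_pushout C i1 mb1 m1 ib1"
    and m2: "regular_mono C m2" "m2 \<in> hom C I2 (Tgt C n1)"
      "regular_mono C mb2" "is_pushout C i2 mb2 m2 ib2"
    by (auto simp: S match_sequences_def dpo_matches_def dpo_result_def mPOC_def po1)
  obtain Y0 where Y0: "mb1 \<in> hom C K1 Y0" "ib1 \<in> hom C Y0 X0"
    using m1(4,2) by (elim pushout_types) (auto simp: hom_iff)
  have po1': "is_pushout C o1 mb1 n1 d1"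
    using rule_types(1) Y0(1) po1 by (rule po_is_pushout)
  obtain X1 where X1: "n1 \<in> hom C O1 X1" "d1 \<in> hom C Y0 X1"
    using po1' rule_types(1) Y0(1) by (rule pushout_cocone_types)
  have m2X1: "m2 \<in> hom C I2 X1" using m2(2) X1 by (simp add: hom_iff)
  obtain Y1 where Y1: "mb2 \<in> hom C K2 Y1" "ib2 \<in> hom C Y1 X1"
    using m2(4) m2X1 by (elim pushout_types) (auto simp: hom_iff)
  have po2': "is_pushout C o2 mb2 n2 d2"
    using rule_types(3) Y1(1) po2 by (rule po_is_pushout)
  obtain X2 where X2: "n2 \<in> hom C O2 X2" "d2 \<in> hom C Y1 X2"
    using po2' rule_types(3) Y1(1) by (rule pushout_cocone_types)
  have "sequence C o1 i1 o2 i2 K1 O1 I1 K2 O2 I2 X0 m1 mb1 ib1 n1 d1 m2 mb2 ib2 n2 d2 Y0 X1 Y1 X2"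
    by unfold_locales (fact Y0 m1 X1 m2X1 Y1 X2 m2 po1 po2)+
  with S show ?thesis by (rule that)
qed

lemma composite_mem:
  assumes "composite C o1 i1 o2 i2 K1 O1 I1 K2 O2 I2 X0
    j2 j1 jb2 c2 jb1 c1 s t p q u0 u w x z J L2 L1 I21 K21 O21 Z"
  shows "((j2, j1, jb2, c2, jb1, c1), (w, x, z)) \<in> composite_matches C (o2, i2) (o1, i1) X0"
proof -
  interpret composite C o1 i1 o2 i2 K1 O1 I1 K2 O2 I2 X0
    j2 j1 jb2 c2 jb1 c1 s t p q u0 u w x z J L2 L1 I21 K21 O21 Z
    by fact
  note [simp] = rule_types[THEN hom_types] composite_types[THEN hom_types]
  show ?thesis
    unfolding composite_matches_def
    by (simp add: dpo_compose_eq dpo_rule_matches_def dpo_matches_def mPOC_def hom_iff multi_sum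
        composite_regular po_j2 po_j1 po_in21)
qed

lemma composite_matchesE:
  assumes "T \<in> composite_matches C (o2, i2) (o1, i1) X0"
  obtains j2 j1 jb2 c2 jb1 c1 s t p q u0 u w x z J L2 L1 I21 K21 O21 Z
  where "T = ((j2, j1, jb2, c2, jb1, c1), (w, x, z))"
    "composite C o1 i1 o2 i2 K1 O1 I1 K2 O2 I2 X0
       j2 j1 jb2 c2 jb1 c1 s t p q u0 u w x z J L2 L1 I21 K21 O21 Z"
proof -
  note [simp] = rule_types[THEN hom_types]
  obtain j2 j1 jb2 c2 jb1 c1 w x z where T: "T = ((j2, j1, jb2, c2, jb1, c1), (w, x, z))"
    by (metis prod.exhaust)
  obtain s t where st_eq: "po C i1 jb1 = (s, t)" by (metis prod.exhaust)
  obtain u0 u where u_eq: "po C o2 jb2 = (u0, u)" by (metis prod.exhaust)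
  obtain p q where pq_eq: "pb C c2 c1 = (p, q)" by (metis prod.exhaust)
  from assms have M: "(j2, j1) \<in> Msum C I2 O1" "regular_mono C jb2" "regular_mono C jb1"
      "is_pushout C i2 jb2 j2 c2" "is_pushout C o1 jb1 j1 c1"
    and w: "regular_mono C w" "w \<in> hom C (Tgt C (t \<odot> q)) X0" "regular_mono C x"
      "is_pushout C (t \<odot> q) x w z"
    by (auto simp: T composite_matches_def dpo_rule_matches_def dpo_matches_def mPOC_def
        dpo_compose_def span_comp_def st_eq u_eq pq_eq)
  obtain J where J: "j2 \<in> hom C I2 J" "j1 \<in> hom C O1 J" using M(1) by (rule Msum_types)
  obtain L2 where L2: "jb2 \<in> hom C K2 L2" "c2 \<in> hom C L2 J"
    using M(4) J(1) by (elim pushout_types) (auto simp: hom_iff)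
  obtain L1 where L1: "jb1 \<in> hom C K1 L1" "c1 \<in> hom C L1 J"
    using M(5) J(2) by (elim pushout_types) (auto simp: hom_iff)
  have "is_pushout C i1 jb1 s t" using rule_types(2) L1(1) st_eq by (rule po_is_pushout)
  then obtain I21 where I21: "s \<in> hom C I1 I21" "t \<in> hom C L1 I21"
    using rule_types(2) L1(1) by (rule pushout_cocone_types)
  have "is_pushout C o2 jb2 u0 u" using rule_types(3) L2(1) u_eq by (rule po_is_pushout)
  then obtain O21 where O21: "u0 \<in> hom C O2 O21" "u \<in> hom C L2 O21"
    using rule_types(3) L2(1) by (rule pushout_cocone_types)
  have "is_pullback C c2 c1 p q" using L2(2) L1(2) pq_eq by (rule pb_is_pullback)
  then obtain K21 where K21: "p \<in> hom C K21 L2" "q \<in> hom C K21 L1"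
    using L2(2) L1(2) by (rule pullback_cone_types)
  note [simp] = K21[THEN hom_types] I21[THEN hom_types]
  have wX0: "w \<in> hom C I21 X0" using w(2) by simp
  obtain Z where Z: "x \<in> hom C K21 Z" "z \<in> hom C Z X0"
    using w(4) wX0 by (elim pushout_types) (auto simp: hom_iff)
  have "composite C o1 i1 o2 i2 K1 O1 I1 K2 O2 I2 X0
       j2 j1 jb2 c2 jb1 c1 s t p q u0 u w x z J L2 L1 I21 K21 O21 Z"
    by unfold_locales (fact J L2 L1 I21 K21 O21 wX0 Z M w st_eq u_eq pq_eq)+
  with T show ?thesis by (rule that)
qed

text \<open>There is no recursion: the inductive form hides the existential quantification over the
  vertices and arrows of a link that the two tuples do not mention.\<close>

inductive linked :: "('b \<times> 'b \<times> 'b) \<times> ('b \<times> 'b \<times> 'b) \<Rightarrow> 'b rule_match \<times> ('b \<times> 'b \<times> 'b) \<Rightarrow> bool" where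
  linkI: "link C o1 i1 o2 i2 K1 O1 I1 K2 O2 I2 X0 m1 mb1 ib1 n1 d1 m2 mb2 ib2 n2 d2 Y0 X1 Y1 X2
      j2 j1 jb2 c2 jb1 c1 s t p q u0 u w x z J L2 L1 I21 K21 O21 Z y k1 k2 a b \<Longrightarrow>
    linked ((m1, mb1, ib1), (m2, mb2, ib2)) ((j2, j1, jb2, c2, jb1, c1), (w, x, z))"

end

text \<open>
  Synthesis: factor the match of the second rule and the comatch of the first through a multi-sum
  and pull both pushouts with apex \<open>X1\<close> back along the resulting embedding.
\<close>

lemma (in sequence) ex_linked: "\<exists>T. linked ((m1, mb1, ib1), (m2, mb2, ib2)) T"
proof -
  note [simp] = rule_types[THEN hom_types] sequence_types[THEN hom_types]
  obtain j2 j1 J y where ms: "(j2, j1) \<in> Msum C I2 O1"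
    and J: "j2 \<in> hom C I2 J" "j1 \<in> hom C O1 J" and y: "y \<in> hom C J X1" "regular_mono C y"
    and yj: "y \<odot> j2 = m2" "y \<odot> j1 = n1"
    using Msum_factor[OF sequence_regular(3) n1_regular sequence_types(6,4)] by metis
  obtain c2 k2 where pb2: "is_pullback C y ib2 c2 k2"
    using ex_pullback[OF y(1) sequence_types(8)] by blast
  obtain L2 where L2: "c2 \<in> hom C L2 J" "k2 \<in> hom C L2 Y1"
    using pb2 y(1) sequence_types(8) by (rule pullback_cone_types)
  obtain jb2 where jb2: "jb2 \<in> hom C K2 L2" "k2 \<odot> jb2 = mb2" "is_pushout C i2 jb2 j2 c2"
    "regular_mono C jb2" "is_pushout C c2 k2 y ib2"
    using pushout_restrict[OF po_in2 sequence_regular(4) rule_types(4) sequence_types(7,6,8) y J(1) yj(1)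
        pb2 L2] by metis
  obtain c1 k1 where pb1: "is_pullback C y d1 c1 k1"
    using ex_pullback[OF y(1) sequence_types(5)] by blast
  obtain L1 where L1: "c1 \<in> hom C L1 J" "k1 \<in> hom C L1 Y0"
    using pb1 y(1) sequence_types(5) by (rule pullback_cone_types)
  obtain jb1 where jb1: "jb1 \<in> hom C K1 L1" "k1 \<odot> jb1 = mb1" "is_pushout C o1 jb1 j1 c1"
    "regular_mono C jb1" "is_pushout C c1 k1 y d1"
    using pushout_restrict[OF po_out1 sequence_regular(2) rule_types(1) sequence_types(1,4,5) y J(2) yj(2)
        pb1 L1] by metis
  have regk: "regular_mono C k2" "regular_mono C k1"
    using regular_mono_pullback[OF pullback_swap[OF pb2] y(2)]
      regular_mono_pullback[OF pullback_swap[OF pb1] y(2)] by auto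
  obtain s t where st_eq: "po C i1 jb1 = (s, t)" by (metis prod.exhaust)
  have po_st: "is_pushout C i1 jb1 s t" using rule_types(2) jb1(1) st_eq by (rule po_is_pushout)
  obtain I21 where I21: "s \<in> hom C I1 I21" "t \<in> hom C L1 I21"
    using po_st rule_types(2) jb1(1) by (rule pushout_cocone_types)
  obtain u0 u where u_eq: "po C o2 jb2 = (u0, u)" by (metis prod.exhaust)
  have po_u: "is_pushout C o2 jb2 u0 u" using rule_types(3) jb2(1) u_eq by (rule po_is_pushout)
  obtain O21 where O21: "u0 \<in> hom C O2 O21" "u \<in> hom C L2 O21"
    using po_u rule_types(3) jb2(1) by (rule pushout_cocone_types)
  obtain p q where pq_eq: "pb C c2 c1 = (p, q)" by (metis prod.exhaust)
  have pb_pq: "is_pullback C c2 c1 p q" using L2(1) L1(1) pq_eq by (rule pb_is_pullback)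
  obtain K21 where K21: "p \<in> hom C K21 L2" "q \<in> hom C K21 L1"
    using pb_pq L2(1) L1(1) by (rule pullback_cone_types)
  note [simp] = J[THEN hom_types] y(1)[THEN hom_types] L2[THEN hom_types] L1[THEN hom_types]
    I21[THEN hom_types] O21[THEN hom_types] K21[THEN hom_types]
  \<comment> \<open>Since \<open>mb1\<close> is \<open>k1 \<odot> jb1\<close>, the input square of
    the first step splits at \<open>I21\<close>. The resulting \<open>w\<close> is the match of the
    composite rule.\<close>
  obtain w where w: "w \<in> hom C I21 X0" "w \<odot> s = m1" "w \<odot> t = ib1 \<odot> k1" "is_pushout C t k1 w ib1"
    using pushout_split[OF po_st po_in1[folded jb1(2)] rule_types(2) jb1(1) I21 sequence_types(3,2) L1(2)]
    by metis
  obtain a b where pb_ab: "is_pullback C ib2 d1 a b"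
    using ex_pullback[OF sequence_types(8,5)] by blast
  obtain Z where Z: "a \<in> hom C Z Y1" "b \<in> hom C Z Y0"
    using pb_ab sequence_types(8,5) by (rule pullback_cone_types)
  note [simp] = Z[THEN hom_types]
  note comm = pullback_comm[OF pb2] pullback_comm[OF pb1] pullback_comm[OF pb_pq]
  have "ib2 \<odot> (k2 \<odot> p) = d1 \<odot> (k1 \<odot> q)"
    by (simp add: comm(1,2)[symmetric, THEN comp_eq] comm(3))
  then obtain x where x: "x \<in> hom C K21 Z" "a \<odot> x = k2 \<odot> p" "b \<odot> x = k1 \<odot> q"
    using pullback_factor[OF pb_ab Z, of "k2 \<odot> p" K21 "k1 \<odot> q"] by (auto simp: hom_iff)
  \<comment> \<open>The two cubes exchange the roles of the steps: each stands on the pushout into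
    \<open>X1\<close> from \<open>J\<close> and one context, and is pulled back along the arrow from
    the other context. Their tops are the pushouts of \<open>x\<close> along \<open>p\<close> and
    along \<open>q\<close>, and a back face shows \<open>x\<close> to be regular.\<close>
  note cube2 = cube_pullback[OF jb1(5) regk(2) L1(1,2) y(1) sequence_types(5,8) pb2
      pullback_swap[OF pb_ab] pullback_swap[OF pb_pq] K21(2) Z(2) x(1) x(3) x(2)]
  note cube1 = cube_pullback[OF jb2(5) regk(1) L2(1,2) y(1) sequence_types(8,5) pb1
      pb_ab pb_pq K21(1) Z(1) x(1) x(2) x(3)]
  have x_regular: "regular_mono C x"
    using pullback_swap[OF cube2(1)] regk(2) by (rule regular_mono_pullback)
  \<comment> \<open>Pasting yields the input square of the composite derivation, with
    \<open>ib1 \<odot> b\<close> as its arrow \<open>z\<close> from the context.\<close>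
  have po_w: "is_pushout C (t \<odot> q) x w (ib1 \<odot> b)"
    using cube1(2) w(4) by (rule pushout_paste)
  have w_regular: "regular_mono C w" using regk(2) w(4) by (rule regular_mono_pushout)
  have ibb: "ib1 \<odot> b \<in> hom C Z X0" by (simp add: hom_iff)
  have "link C o1 i1 o2 i2 K1 O1 I1 K2 O2 I2 X0 m1 mb1 ib1 n1 d1 m2 mb2 ib2 n2 d2 Y0 X1 Y1 X2
      j2 j1 jb2 c2 jb1 c1 s t p q u0 u w x (ib1 \<odot> b) J L2 L1 I21 K21 O21 Z y k1 k2 a b"
    by unfold_locales (fact J jb1 jb2 L1 L2 I21 K21 O21 w x po_w w_regular ibb ms st_eq u_eq
      pq_eq x_regular y yj      pb1 pb2 pb_ab cube1 cube2 Z refl)+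
  then show ?thesis by (blast intro: linkI)
qed

text \<open>Analysis: once \<open>Y0\<close> and \<open>Y1\<close> are the pushouts of
  \<open>x\<close>, all squares over \<open>X0\<close> and \<open>X1\<close> come from splitting and
  pasting pushouts, and the matches are regular as pushouts of \<open>mb1\<close> and
  \<open>mb2\<close>. Only the claim that \<open>Z\<close> is the intersection of the two contexts
  needs a further van Kampen cube.\<close>

lemma (in composite) ex_linked: "\<exists>S. linked S ((j2, j1, jb2, c2, jb1, c1), (w, x, z))"
proof -
  note [simp] = rule_types[THEN hom_types] composite_types[THEN hom_types]
  note x_regular = composite_regular(4)
  obtain k1 b where po1: "is_pushout C q x k1 b"
    using ex_pushout[OF composite_types(10,14)] by blast
  obtain Y0 where Y0: "k1 \<in> hom C L1 Y0" "b \<in> hom C Z Y0"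
    using po1 composite_types(10,14) by (rule pushout_cocone_types)
  obtain k2 a where po2: "is_pushout C p x k2 a"
    using ex_pushout[OF composite_types(9,14)] by blast
  obtain Y1 where Y1: "k2 \<in> hom C L2 Y1" "a \<in> hom C Z Y1"
    using po2 composite_types(9,14) by (rule pushout_cocone_types)
  note [simp] = Y0[THEN hom_types] Y1[THEN hom_types]
  have regk: "regular_mono C k1" "regular_mono C k2"
    using regular_mono_pushout[OF x_regular po1] regular_mono_pushout[OF x_regular po2] .
  \<comment> \<open>The composite's input square, split at the intermediate context
    \<open>Y0\<close>, gives the context arrow of the first step. Its second half is pasted below to
    the pushout of \<open>i1\<close> and \<open>jb1\<close>.\<close>
  obtain h where h: "h \<in> hom C Y0 X0" "h \<odot> b = z" "h \<odot> k1 = w \<odot> t" "is_pushout C k1 t h w"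
    using pushout_split[OF pushout_swap[OF po1] pushout_swap[OF po_in21]
        composite_types(14,10) Y0(2,1) composite_types(15,13,8)] by metis
  define m1 where "m1 = w \<odot> s"
  define mb1 where "mb1 = k1 \<odot> jb1"
  define mb2 where "mb2 = k2 \<odot> jb2"
  have t1: "m1 \<in> hom C I1 X0" "mb1 \<in> hom C K1 Y0" "mb2 \<in> hom C K2 Y1"
    by (simp_all add: hom_iff m1_def mb1_def mb2_def)
  have regmb: "regular_mono C mb1" "regular_mono C mb2"
    unfolding mb1_def mb2_def
    using regular_mono_comp[OF composite_regular(2) composite_types(5) regk(1) Y0(1)]
      regular_mono_comp[OF composite_regular(1) composite_types(3) regk(2) Y1(1)] .
  have po_m1: "is_pushout C i1 mb1 m1 h"
    unfolding m1_def mb1_def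
    using pushout_paste[OF pushout_swap[OF po_st] h(4)] by (rule pushout_swap)
  have reg_m1: "regular_mono C m1" using regmb(1) po_m1 by (rule regular_mono_pushout)
  obtain n1 d1 where eq1: "po C o1 mb1 = (n1, d1)" by (metis prod.exhaust)
  have po_n1: "is_pushout C o1 mb1 n1 d1" using rule_types(1) t1(2) eq1 by (rule po_is_pushout)
  obtain X1 where X1: "n1 \<in> hom C O1 X1" "d1 \<in> hom C Y0 X1"
    using po_n1 rule_types(1) t1(2) by (rule pushout_cocone_types)
  note [simp] = X1[THEN hom_types]
  obtain y where y: "y \<in> hom C J X1" "y \<odot> j1 = n1" "y \<odot> c1 = d1 \<odot> k1" "is_pushout C c1 k1 y d1"
    using pushout_split[OF po_j1 po_n1[unfolded mb1_def] rule_types(1) composite_types(5,2,6) X1 Y0(1)]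
    by metis
  have reg_y: "regular_mono C y" using regk(1) y(4) by (rule regular_mono_pushout)
  note [simp] = y(1)[THEN hom_types]
  \<comment> \<open>The pasted square has the leg \<open>c1 \<odot> q\<close>, which equals
    \<open>c2 \<odot> p\<close> because \<open>K21\<close> is a pullback over \<open>J\<close>. Read
    in the second form it can be split at \<open>Y1\<close>, which produces the context arrow
    \<open>e\<close> of the second step.\<close>
  have "is_pushout C (c2 \<odot> p) x y (d1 \<odot> b)"
    using pushout_paste[OF po1 y(4)] by (simp add: pullback_comm[OF pb_pq])
  moreover have "d1 \<odot> b \<in> hom C Z X1" by (simp add: hom_iff)
  ultimately obtain e where e: "e \<in> hom C Y1 X1" "e \<odot> a = d1 \<odot> b" "e \<odot> k2 = y \<odot> c2"
      "is_pushout C k2 c2 e y"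
    using pushout_split[OF pushout_swap[OF po2] _
        composite_types(14,9) Y1(2,1) _ y(1) composite_types(4)] pushout_swap by metis
  define m2 where "m2 = y \<odot> j2"
  have t2: "m2 \<in> hom C I2 X1" by (simp add: hom_iff m2_def)
  have po_m2: "is_pushout C i2 mb2 m2 e"
    unfolding m2_def mb2_def
    using pushout_paste[OF pushout_swap[OF po_j2] e(4)] by (rule pushout_swap)
  have reg_m2: "regular_mono C m2" using regmb(2) po_m2 by (rule regular_mono_pushout)
  obtain n2 d2 where eq2: "po C o2 mb2 = (n2, d2)" by (metis prod.exhaust)
  have po_n2: "is_pushout C o2 mb2 n2 d2" using rule_types(3) t1(3) eq2 by (rule po_is_pushout)
  obtain X2 where X2: "n2 \<in> hom C O2 X2" "d2 \<in> hom C Y1 X2"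
    using po_n2 rule_types(3) t1(3) by (rule pushout_cocone_types)
  have pb2: "is_pullback C y e c2 k2"
    using pushout_regular_mono_pullback[OF regk(2) pushout_swap[OF e(4)]] by (rule pullback_swap)
  have pb1: "is_pullback C y d1 c1 k1"
    using pushout_regular_mono_pullback[OF regk(1) y(4)] by (rule pullback_swap)
  \<comment> \<open>Now the cube is read from its top: that face is the pushout defining
    \<open>Y1\<close>, and the back faces are \<open>pb_pq\<close> and the pushout defining
    \<open>Y0\<close>, which is also a pullback. The front face over \<open>d1\<close> is the wanted
    intersection.\<close>
  have "is_pullback C y e c2 k2 \<and> is_pullback C d1 e b a"
  proof (rule van_kampen[OF regk(1) y(4), THEN iffD1])
    show "is_pullback C c1 c2 q p" using pb_pq by (rule pullback_swap)
    show "is_pullback C k1 b q x"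
      using pushout_regular_mono_pullback[OF x_regular po1] by (rule pullback_swap)
    show "commuting_square C p x k2 a"
      using pushout_comm[OF po2] by (simp add: commuting_square_def)
  qed (fact e y Y1 po2)+
  then have pb_ab: "is_pullback C e d1 a b" using pullback_swap by blast
  have "link C o1 i1 o2 i2 K1 O1 I1 K2 O2 I2 X0 m1 mb1 h n1 d1 m2 mb2 e n2 d2 Y0 X1 Y1 X2
      j2 j1 jb2 c2 jb1 c1 s t p q u0 u w x z J L2 L1 I21 K21 O21 Z y k1 k2 a b"
    by unfold_locales (fact t1 h X1 t2 e X2 reg_m1 reg_m2 regmb po_m1 po_m2 eq1 eq2 y Y0 Y1 reg_y
      m1_def[symmetric] m2_def[symmetric] mb1_def[symmetric] mb2_def[symmetric] h(3)[symmetric]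
      pb1 pb2 pb_ab po1 po2)+
  then show ?thesis by (blast intro: linkI)
qed

text \<open>As \<open>mb2\<close> is \<open>k2 \<odot> jb2\<close>, the output square of the second
  step splits at \<open>O21\<close>. Pasting its second half to \<open>po_k2\<close> exhibits
  \<open>X2\<close> as a pushout of the composite's output leg and \<open>x\<close>.\<close>

lemma (in link) result_isomorphic:
  "isomorphic C X2 (Tgt C (fst (po C (u \<odot> p) x)))"
proof -
  note [simp] = rule_types[THEN hom_types] sequence_types[THEN hom_types]
    composite_types[THEN hom_types] link_types[THEN hom_types]
  obtain v where v: "v \<in> hom C O21 X2" "is_pushout C u k2 v d2"
    using pushout_split[OF po_u po_out2[folded k_jb(2)] rule_types(3) composite_types(3,11,12)
        sequence_types(9,10) link_types(3)] by metis
  have po: "is_pushout C (u \<odot> p) x v (d2 \<odot> a)"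
    using po_k2 v(2) by (rule pushout_paste)
  obtain n d where eq: "po C (u \<odot> p) x = (n, d)" by (metis prod.exhaust)
  have up: "u \<odot> p \<in> hom C K21 O21" and da: "d2 \<odot> a \<in> hom C Z X2" by (simp_all add: hom_iff)
  have po': "is_pushout C (u \<odot> p) x n d"
    using up composite_types(14) eq by (rule po_is_pushout)
  obtain X where X: "n \<in> hom C O21 X" "d \<in> hom C Z X"
    using po' up composite_types(14) by (rule pushout_cocone_types)
  obtain \<delta> where "\<delta> \<in> isos C X2 X"
    using pushout_iso[OF po po' up composite_types(14) v(1) da up composite_types(14) X
        Ident_isos[of K21] Ident_isos[of O21] Ident_isos[of Z]] by auto
  then show ?thesis using X by (auto simp: isomorphic_def eq hom_iff)
qed

section \<open>Comparison of the two equivalences\<close>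

context rule_pair
begin

text \<open>Resolves the chosen pushouts in the definition to the names of the two diagrams, so that
  only isomorphisms and equations remain.\<close>

lemma sequence_equiv_iff:
  assumes "sequence C o1 i1 o2 i2 K1 O1 I1 K2 O2 I2 X0
      m1 mb1 ib1 n1 d1 m2 mb2 ib2 n2 d2 Y0 X1 Y1 X2"
    and "sequence C o1 i1 o2 i2 K1 O1 I1 K2 O2 I2 X0
        m1' mb1' ib1' n1' d1' m2' mb2' ib2' n2' d2' Y0' X1' Y1' X2'"
  shows "(((m1, mb1, ib1), (m2, mb2, ib2)), ((m1', mb1', ib1'), (m2', mb2', ib2')))
      \<in> sequence_equiv C (o2, i2) (o1, i1) X0 \<longleftrightarrow>
    m1 = m1' \<and>
    (\<exists>\<alpha> \<in> isos C Y0 Y0'. \<exists>\<xi> \<in> isos C X1 X1'. \<exists>\<beta> \<in> isos C Y1 Y1'. \<exists>\<zeta> \<in> isos C X2 X2'.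
       \<alpha> \<odot> mb1 = mb1' \<and> ib1' \<odot> \<alpha> = ib1 \<and> \<xi> \<odot> n1 = n1' \<and> \<xi> \<odot> d1 = d1' \<odot> \<alpha> \<and> \<xi> \<odot> m2 = m2' \<and>
       \<beta> \<odot> mb2 = mb2' \<and> ib2' \<odot> \<beta> = \<xi> \<odot> ib2 \<and> \<zeta> \<odot> n2 = n2' \<and> \<zeta> \<odot> d2 = d2' \<odot> \<beta>)"
proof -
  interpret S: sequence C o1 i1 o2 i2 K1 O1 I1 K2 O2 I2 X0
      m1 mb1 ib1 n1 d1 m2 mb2 ib2 n2 d2 Y0 X1 Y1 X2
    by fact
  interpret S': sequence C o1 i1 o2 i2 K1 O1 I1 K2 O2 I2 X0
      m1' mb1' ib1' n1' d1' m2' mb2' ib2' n2' d2' Y0' X1' Y1' X2'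
    by fact
  note [simp] = S.sequence_types[THEN hom_types] S'.sequence_types[THEN hom_types]
  show ?thesis
    by (simp add: sequence_equiv_def S.po_eq1 S'.po_eq1 S.po_eq2 S'.po_eq2
        sequence_mem[OF assms(1)] sequence_mem[OF assms(2)])
qed

lemma sequence_equiv_subset:
  "sequence_equiv C (o2, i2) (o1, i1) X0 \<subseteq>
     match_sequences C (o2, i2) (o1, i1) X0 \<times> match_sequences C (o2, i2) (o1, i1) X0"
  by (auto simp: sequence_equiv_def)

lemma composite_equiv_subset:
  "composite_equiv C (o2, i2) (o1, i1) X0 \<subseteq>
     composite_matches C (o2, i2) (o1, i1) X0 \<times> composite_matches C (o2, i2) (o1, i1) X0"
  by (auto simp: composite_equiv_def)

text \<open>Identities, inverses and composites of the four isomorphisms. This is the equivalence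
  that is checked directly, since its diagrams are the smaller ones.\<close>

lemma equiv_sequence_equiv:
  "equiv (match_sequences C (o2, i2) (o1, i1) X0) (sequence_equiv C (o2, i2) (o1, i1) X0)"
proof (rule equivI)
  show "refl_on (match_sequences C (o2, i2) (o1, i1) X0) (sequence_equiv C (o2, i2) (o1, i1) X0)"
  proof (rule refl_onI)
    fix S
    assume "S \<in> match_sequences C (o2, i2) (o1, i1) X0"
    then show "(S, S) \<in> sequence_equiv C (o2, i2) (o1, i1) X0"
    proof (rule match_sequencesE)
      fix m1 mb1 ib1 n1 d1 m2 mb2 ib2 n2 d2 Y0 X1 Y1 X2
      assume S: "S = ((m1, mb1, ib1), (m2, mb2, ib2))" and
        seq: "sequence C o1 i1 o2 i2 K1 O1 I1 K2 O2 I2 X0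
            m1 mb1 ib1 n1 d1 m2 mb2 ib2 n2 d2 Y0 X1 Y1 X2"
      interpret sequence C o1 i1 o2 i2 K1 O1 I1 K2 O2 I2 X0
          m1 mb1 ib1 n1 d1 m2 mb2 ib2 n2 d2 Y0 X1 Y1 X2
        by fact
      note [simp] = sequence_types[THEN hom_types]
      show ?thesis
        unfolding S sequence_equiv_iff[OF seq seq]
        by (intro conjI refl bexI[of _ "Ident C Y0"] bexI[of _ "Ident C X1"]
            bexI[of _ "Ident C Y1"] bexI[of _ "Ident C X2"]) (simp_all add: Ident_isos)
    qed
  qed
next
  show "sym (sequence_equiv C (o2, i2) (o1, i1) X0)"
  proof (rule symI)
    fix S S'
    assume *: "(S, S') \<in> sequence_equiv C (o2, i2) (o1, i1) X0"
    then have mem: "S \<in> match_sequences C (o2, i2) (o1, i1) X0"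
      "S' \<in> match_sequences C (o2, i2) (o1, i1) X0"
      using sequence_equiv_subset by auto
    obtain m1 mb1 ib1 n1 d1 m2 mb2 ib2 n2 d2 Y0 X1 Y1 X2 where
      S: "S = ((m1, mb1, ib1), (m2, mb2, ib2))" and
      seq: "sequence C o1 i1 o2 i2 K1 O1 I1 K2 O2 I2 X0
          m1 mb1 ib1 n1 d1 m2 mb2 ib2 n2 d2 Y0 X1 Y1 X2"
      using mem(1) by (rule match_sequencesE)
    obtain m1' mb1' ib1' n1' d1' m2' mb2' ib2' n2' d2' Y0' X1' Y1' X2' where
      S': "S' = ((m1', mb1', ib1'), (m2', mb2', ib2'))" and
      seq': "sequence C o1 i1 o2 i2 K1 O1 I1 K2 O2 I2 X0
          m1' mb1' ib1' n1' d1' m2' mb2' ib2' n2' d2' Y0' X1' Y1' X2'"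
      using mem(2) by (rule match_sequencesE)
    interpret P: sequence C o1 i1 o2 i2 K1 O1 I1 K2 O2 I2 X0
        m1 mb1 ib1 n1 d1 m2 mb2 ib2 n2 d2 Y0 X1 Y1 X2
      by fact
    interpret P': sequence C o1 i1 o2 i2 K1 O1 I1 K2 O2 I2 X0
        m1' mb1' ib1' n1' d1' m2' mb2' ib2' n2' d2' Y0' X1' Y1' X2'
      by fact
    note types = P.sequence_types P'.sequence_types
    note [simp] = types[THEN hom_types]
    obtain \<alpha> \<xi> \<beta> \<zeta> where i: "\<alpha> \<in> isos C Y0 Y0'" "\<xi> \<in> isos C X1 X1'" "\<beta> \<in> isos C Y1 Y1'" "\<zeta> \<in> isos C X2 X2'"
      and eqs: "m1 = m1'" "\<alpha> \<odot> mb1 = mb1'" "ib1' \<odot> \<alpha> = ib1" "\<xi> \<odot> n1 = n1'" "\<xi> \<odot> m2 = m2'"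
        "\<beta> \<odot> mb2 = mb2'" "\<zeta> \<odot> n2 = n2'"
      and sq: "d1' \<odot> \<alpha> = \<xi> \<odot> d1" "ib2' \<odot> \<beta> = \<xi> \<odot> ib2" "d2' \<odot> \<beta> = \<zeta> \<odot> d2"
      using *[unfolded S S' sequence_equiv_iff[OF seq seq']] by auto
    obtain \<alpha>' where \<alpha>': "\<alpha>' \<in> isos C Y0' Y0" "\<alpha>' \<in> hom C Y0' Y0" "\<alpha>' \<odot> \<alpha> = Ident C Y0" "\<alpha> \<odot> \<alpha>' = Ident C Y0'"
      using i(1) by (rule isosE)
    obtain \<xi>' where \<xi>': "\<xi>' \<in> isos C X1' X1" "\<xi>' \<in> hom C X1' X1" "\<xi>' \<odot> \<xi> = Ident C X1" "\<xi> \<odot> \<xi>' = Ident C X1'"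
      using i(2) by (rule isosE)
    obtain \<beta>' where \<beta>': "\<beta>' \<in> isos C Y1' Y1" "\<beta>' \<in> hom C Y1' Y1" "\<beta>' \<odot> \<beta> = Ident C Y1" "\<beta> \<odot> \<beta>' = Ident C Y1'"
      using i(3) by (rule isosE)
    obtain \<zeta>' where \<zeta>': "\<zeta>' \<in> isos C X2' X2" "\<zeta>' \<in> hom C X2' X2" "\<zeta>' \<odot> \<zeta> = Ident C X2" "\<zeta> \<odot> \<zeta>' = Ident C X2'"
      using i(4) by (rule isosE)
    note ih = i[THEN isos_hom]
    note [simp] = ih[THEN hom_types] \<alpha>'(2)[THEN hom_types] \<xi>'(2)[THEN hom_types]
      \<beta>'(2)[THEN hom_types] \<zeta>'(2)[THEN hom_types]
    have sq': "d1 \<odot> \<alpha>' = \<xi>' \<odot> d1'" "ib2 \<odot> \<beta>' = \<xi>' \<odot> ib2'" "d2 \<odot> \<beta>' = \<zeta>' \<odot> d2'"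
      by (rule iso_square_inverse; (rule \<alpha>' \<xi>' \<beta>' \<zeta>' ih types sq))+
    have "\<alpha>' \<odot> mb1' = mb1" "ib1 \<odot> \<alpha>' = ib1'" "\<xi>' \<odot> n1' = n1" "\<xi>' \<odot> m2' = m2"
        "\<beta>' \<odot> mb2' = mb2" "\<zeta>' \<odot> n2' = n2"
      unfolding eqs(2-)[symmetric]
      by (simp_all add: \<alpha>'(3,4)[THEN comp_eq] \<xi>'(3,4)[THEN comp_eq] \<beta>'(3,4)[THEN comp_eq]
          \<zeta>'(3,4)[THEN comp_eq] \<alpha>'(4))
    with sq' show "(S', S) \<in> sequence_equiv C (o2, i2) (o1, i1) X0"
      unfolding S S' sequence_equiv_iff[OF seq' seq]
      by (intro conjI eqs(1)[symmetric] bexI[OF _ \<alpha>'(1)] bexI[OF _ \<xi>'(1)]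
          bexI[OF _ \<beta>'(1)] bexI[OF _ \<zeta>'(1)]) simp_all
  qed
next
  show "trans (sequence_equiv C (o2, i2) (o1, i1) X0)"
  proof (rule transI)
    fix S S' S''
    assume *: "(S, S') \<in> sequence_equiv C (o2, i2) (o1, i1) X0"
      "(S', S'') \<in> sequence_equiv C (o2, i2) (o1, i1) X0"
    then have mem: "S \<in> match_sequences C (o2, i2) (o1, i1) X0"
      "S' \<in> match_sequences C (o2, i2) (o1, i1) X0" "S'' \<in> match_sequences C (o2, i2) (o1, i1) X0"
      using sequence_equiv_subset by auto
    obtain m1 mb1 ib1 n1 d1 m2 mb2 ib2 n2 d2 Y0 X1 Y1 X2 where
      S: "S = ((m1, mb1, ib1), (m2, mb2, ib2))" and
      seq: "sequence C o1 i1 o2 i2 K1 O1 I1 K2 O2 I2 X0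
          m1 mb1 ib1 n1 d1 m2 mb2 ib2 n2 d2 Y0 X1 Y1 X2"
      using mem(1) by (rule match_sequencesE)
    obtain m1' mb1' ib1' n1' d1' m2' mb2' ib2' n2' d2' Y0' X1' Y1' X2' where
      S': "S' = ((m1', mb1', ib1'), (m2', mb2', ib2'))" and
      seq': "sequence C o1 i1 o2 i2 K1 O1 I1 K2 O2 I2 X0
          m1' mb1' ib1' n1' d1' m2' mb2' ib2' n2' d2' Y0' X1' Y1' X2'"
      using mem(2) by (rule match_sequencesE)
    obtain m1'' mb1'' ib1'' n1'' d1'' m2'' mb2'' ib2'' n2'' d2'' Y0'' X1'' Y1'' X2'' where
      S'': "S'' = ((m1'', mb1'', ib1''), (m2'', mb2'', ib2''))" and
      seq'': "sequence C o1 i1 o2 i2 K1 O1 I1 K2 O2 I2 X0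
          m1'' mb1'' ib1'' n1'' d1'' m2'' mb2'' ib2'' n2'' d2'' Y0'' X1'' Y1'' X2''"
      using mem(3) by (rule match_sequencesE)
    interpret P: sequence C o1 i1 o2 i2 K1 O1 I1 K2 O2 I2 X0
        m1 mb1 ib1 n1 d1 m2 mb2 ib2 n2 d2 Y0 X1 Y1 X2
      by fact
    interpret P': sequence C o1 i1 o2 i2 K1 O1 I1 K2 O2 I2 X0
        m1' mb1' ib1' n1' d1' m2' mb2' ib2' n2' d2' Y0' X1' Y1' X2'
      by fact
    interpret P'': sequence C o1 i1 o2 i2 K1 O1 I1 K2 O2 I2 X0
        m1'' mb1'' ib1'' n1'' d1'' m2'' mb2'' ib2'' n2'' d2'' Y0'' X1'' Y1'' X2''
      by fact
    obtain \<alpha> \<xi> \<beta> \<zeta> where i: "\<alpha> \<in> isos C Y0 Y0'" "\<xi> \<in> isos C X1 X1'" "\<beta> \<in> isos C Y1 Y1'" "\<zeta> \<in> isos C X2 X2'"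
      and eqs: "m1 = m1'" "\<alpha> \<odot> mb1 = mb1'" "ib1' \<odot> \<alpha> = ib1" "\<xi> \<odot> n1 = n1'" "\<xi> \<odot> m2 = m2'"
        "\<beta> \<odot> mb2 = mb2'" "\<zeta> \<odot> n2 = n2'"
        "\<xi> \<odot> d1 = d1' \<odot> \<alpha>" "\<xi> \<odot> ib2 = ib2' \<odot> \<beta>" "\<zeta> \<odot> d2 = d2' \<odot> \<beta>"
      using *(1)[unfolded S S' sequence_equiv_iff[OF seq seq']] by auto
    obtain \<alpha>' \<xi>' \<beta>' \<zeta>' where i': "\<alpha>' \<in> isos C Y0' Y0''" "\<xi>' \<in> isos C X1' X1''" "\<beta>' \<in> isos C Y1' Y1''" "\<zeta>' \<in> isos C X2' X2''"
      and eqs': "m1' = m1''" "\<alpha>' \<odot> mb1' = mb1''" "ib1'' \<odot> \<alpha>' = ib1'" "\<xi>' \<odot> n1' = n1''" "\<xi>' \<odot> m2' = m2''"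
        "\<beta>' \<odot> mb2' = mb2''" "\<zeta>' \<odot> n2' = n2''"
        "\<xi>' \<odot> d1' = d1'' \<odot> \<alpha>'" "\<xi>' \<odot> ib2' = ib2'' \<odot> \<beta>'" "\<zeta>' \<odot> d2' = d2'' \<odot> \<beta>'"
      using *(2)[unfolded S' S'' sequence_equiv_iff[OF seq' seq'']] by auto
    note [simp] = P.sequence_types[THEN hom_types] P'.sequence_types[THEN hom_types]
      P''.sequence_types[THEN hom_types] i[THEN isos_hom, THEN hom_types] i'[THEN isos_hom, THEN hom_types]
    have "m1 = m1''" using eqs(1) eqs'(1) by simp
    then show "(S, S'') \<in> sequence_equiv C (o2, i2) (o1, i1) X0"
      unfolding S S'' sequence_equiv_iff[OF seq seq'']
      by (intro conjI bexI[OF _ isos_comp[OF i(1) i'(1)]] bexI[OF _ isos_comp[OF i(2) i'(2)]]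
          bexI[OF _ isos_comp[OF i(3) i'(3)]] bexI[OF _ isos_comp[OF i(4) i'(4)]])
        (simp_all add: eqs(2-) eqs'(2-) eqs'(3,8-10)[THEN comp_eq])
  qed
qed (rule sequence_equiv_subset)

lemma composite_equiv_iff:
  assumes "composite C o1 i1 o2 i2 K1 O1 I1 K2 O2 I2 X0
      j2 j1 jb2 c2 jb1 c1 s t p q u0 u w x z J L2 L1 I21 K21 O21 Z"
    and "composite C o1 i1 o2 i2 K1 O1 I1 K2 O2 I2 X0
      j2' j1' jb2' c2' jb1' c1' s' t' p' q' u0' u' w' x' z' J' L2' L1' I21' K21' O21' Z'"
  shows "(((j2, j1, jb2, c2, jb1, c1), (w, x, z)), ((j2', j1', jb2', c2', jb1', c1'), (w', x', z')))
      \<in> composite_equiv C (o2, i2) (o1, i1) X0 \<longleftrightarrow>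
    (\<exists>\<psi> \<in> isos C J J'. \<exists>\<kappa>2 \<in> isos C L2 L2'. \<exists>\<kappa>1 \<in> isos C L1 L1'.
     \<exists>\<iota> \<in> isos C I21 I21'. \<exists>\<kappa> \<in> isos C K21 K21'. \<exists>\<chi> \<in> isos C Z Z'.
       \<psi> \<odot> j2 = j2' \<and> \<psi> \<odot> j1 = j1' \<and>
       \<kappa>2 \<odot> jb2 = jb2' \<and> c2' \<odot> \<kappa>2 = \<psi> \<odot> c2 \<and> \<kappa>1 \<odot> jb1 = jb1' \<and> c1' \<odot> \<kappa>1 = \<psi> \<odot> c1 \<and>
       \<iota> \<odot> s = s' \<and> \<iota> \<odot> t = t' \<odot> \<kappa>1 \<and> p' \<odot> \<kappa> = \<kappa>2 \<odot> p \<and> q' \<odot> \<kappa> = \<kappa>1 \<odot> q \<and>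
       w' \<odot> \<iota> = w \<and> \<chi> \<odot> x = x' \<odot> \<kappa> \<and> z' \<odot> \<chi> = z)"
proof -
  interpret T: composite C o1 i1 o2 i2 K1 O1 I1 K2 O2 I2 X0
    j2 j1 jb2 c2 jb1 c1 s t p q u0 u w x z J L2 L1 I21 K21 O21 Z
    by fact
  interpret T': composite C o1 i1 o2 i2 K1 O1 I1 K2 O2 I2 X0
    j2' j1' jb2' c2' jb1' c1' s' t' p' q' u0' u' w' x' z' J' L2' L1' I21' K21' O21' Z'
    by fact
  note [simp] = T.composite_types[THEN hom_types] T'.composite_types[THEN hom_types]
  show ?thesis
    by (simp add: composite_equiv_def T.po_st_eq T'.po_st_eq T.pb_pq_eq T'.pb_pq_eq
        composite_mem[OF assms(1)] composite_mem[OF assms(2)])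
qed

end

text \<open>Two links over the same rules and the same \<open>X0\<close>, placed side by side so
  that isomorphisms given on one of their views can be carried to the other.\<close>

locale two_links =
  link C o1 i1 o2 i2 K1 O1 I1 K2 O2 I2 X0 m1 mb1 ib1 n1 d1 m2 mb2 ib2 n2 d2 Y0 X1 Y1 X2
    j2 j1 jb2 c2 jb1 c1 s t p q u0 u w x z J L2 L1 I21 K21 O21 Z y k1 k2 a b +
  P: link C o1 i1 o2 i2 K1 O1 I1 K2 O2 I2 X0
      m1' mb1' ib1' n1' d1' m2' mb2' ib2' n2' d2' Y0' X1' Y1' X2'
    j2' j1' jb2' c2' jb1' c1' s' t' p' q' u0' u' w' x' z' J' L2' L1' I21' K21' O21' Z' y' k1' k2' a' b'
  for C :: "('o, 'a) cat" (structure) and o1 i1 o2 i2 K1 O1 I1 K2 O2 I2 X0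
    m1 mb1 ib1 n1 d1 m2 mb2 ib2 n2 d2 Y0 X1 Y1 X2
    j2 j1 jb2 c2 jb1 c1 s t p q u0 u w x z J L2 L1 I21 K21 O21 Z y k1 k2 a b
    m1' mb1' ib1' n1' d1' m2' mb2' ib2' n2' d2' Y0' X1' Y1' X2'
    j2' j1' jb2' c2' jb1' c1' s' t' p' q' u0' u' w' x' z' J' L2' L1' I21' K21' O21' Z' y' k1' k2' a' b'
begin

lemmas all_types =
  rule_types sequence_types composite_types link_types
  P.sequence_types P.composite_types P.link_types

lemma sequence_pred:
  "sequence C o1 i1 o2 i2 K1 O1 I1 K2 O2 I2 X0 m1 mb1 ib1 n1 d1 m2 mb2 ib2 n2 d2 Y0 X1 Y1 X2"
  "sequence C o1 i1 o2 i2 K1 O1 I1 K2 O2 I2 X0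
      m1' mb1' ib1' n1' d1' m2' mb2' ib2' n2' d2' Y0' X1' Y1' X2'"
  by unfold_locales

lemma composite_pred:
  "composite C o1 i1 o2 i2 K1 O1 I1 K2 O2 I2 X0
     j2 j1 jb2 c2 jb1 c1 s t p q u0 u w x z J L2 L1 I21 K21 O21 Z"
  "composite C o1 i1 o2 i2 K1 O1 I1 K2 O2 I2 X0
     j2' j1' jb2' c2' jb1' c1' s' t' p' q' u0' u' w' x' z' J' L2' L1' I21' K21' O21' Z'"
  by unfold_locales

text \<open>The overlap \<open>J\<close> is determined through the multi-sum, \<open>L2\<close>,
  \<open>L1\<close>, \<open>K21\<close> and \<open>Z\<close> are pullbacks of arrows already
  compared, and \<open>I21\<close> is a pushout, so all isomorphisms are induced. Equations into a
  pullback are tested on its projections, the one for \<open>w\<close> on the two arrows into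
  \<open>I21\<close>.\<close>

lemma composite_equiv_of_sequence_equiv:
  assumes "(((m1, mb1, ib1), (m2, mb2, ib2)), ((m1', mb1', ib1'), (m2', mb2', ib2')))
      \<in> sequence_equiv C (o2, i2) (o1, i1) X0"
  shows "(((j2, j1, jb2, c2, jb1, c1), (w, x, z)), ((j2', j1', jb2', c2', jb1', c1'), (w', x', z')))
      \<in> composite_equiv C (o2, i2) (o1, i1) X0"
proof -
  note [simp] = all_types[THEN hom_types]
  obtain \<alpha> \<xi> \<beta> where \<alpha>: "\<alpha> \<in> isos C Y0 Y0'" and \<xi>: "\<xi> \<in> isos C X1 X1'" and \<beta>: "\<beta> \<in> isos C Y1 Y1'"
    and m1: "m1 = m1'"
    and eqs: "\<alpha> \<odot> mb1 = mb1'" "ib1' \<odot> \<alpha> = ib1" "\<xi> \<odot> n1 = n1'" "d1' \<odot> \<alpha> = \<xi> \<odot> d1" "\<xi> \<odot> m2 = m2'"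
      "\<beta> \<odot> mb2 = mb2'" "ib2' \<odot> \<beta> = \<xi> \<odot> ib2"
    using assms unfolding sequence_equiv_iff[OF sequence_pred] by auto
  note [simp] = \<alpha>[THEN isos_hom, THEN hom_types] \<xi>[THEN isos_hom, THEN hom_types]
    \<beta>[THEN isos_hom, THEN hom_types]
  have \<xi>y: "regular_mono C (\<xi> \<odot> y)" "\<xi> \<odot> y \<in> hom C J X1'"
    using regular_mono_comp[OF y_regular link_types(1) regular_mono_iso[OF \<xi>] isos_hom[OF \<xi>]]
    by (simp_all add: hom_iff)
  have \<xi>yj: "(\<xi> \<odot> y) \<odot> j2 = m2'" "(\<xi> \<odot> y) \<odot> j1 = n1'"
    by (simp_all add: y_j eqs)
  \<comment> \<open>Both \<open>\<xi> \<odot> y\<close> and \<open>y'\<close> factor the cospan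
    \<open>(m2', n1')\<close> through a member of the multi-sum.\<close>
  obtain \<psi> where \<psi>: "\<psi> \<in> isos C J J'" "\<psi> \<odot> j2 = j2'" "\<psi> \<odot> j1 = j1'" "y' \<odot> \<psi> = \<xi> \<odot> y"
    using Msum_iso[OF multi_sum P.multi_sum \<xi>y(1) P.y_regular composite_types(1,2)
        P.composite_types(1,2) \<xi>y(2) P.link_types(1)]
    by (auto simp: \<xi>yj P.y_j P.sequence_regular P.n1_regular)
  obtain \<kappa>2 where \<kappa>2: "\<kappa>2 \<in> isos C L2 L2'" "c2' \<odot> \<kappa>2 = \<psi> \<odot> c2" "k2' \<odot> \<kappa>2 = \<beta> \<odot> k2"
    using pullback_iso[OF pb_c2 P.pb_c2 link_types(1) sequence_types(8) composite_types(4) link_types(3)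
        P.link_types(1) P.sequence_types(8) P.composite_types(4) P.link_types(3) \<psi>(1) \<beta> \<xi> \<psi>(4) eqs(7)]
    by metis
  obtain \<kappa>1 where \<kappa>1: "\<kappa>1 \<in> isos C L1 L1'" "c1' \<odot> \<kappa>1 = \<psi> \<odot> c1" "k1' \<odot> \<kappa>1 = \<alpha> \<odot> k1"
    using pullback_iso[OF pb_c1 P.pb_c1 link_types(1) sequence_types(5) composite_types(6) link_types(2)
        P.link_types(1) P.sequence_types(5) P.composite_types(6) P.link_types(2) \<psi>(1) \<alpha> \<xi> \<psi>(4) eqs(4)]
    by metis
  note [simp] = \<psi>(1)[THEN isos_hom, THEN hom_types] \<kappa>2(1)[THEN isos_hom, THEN hom_types]
    \<kappa>1(1)[THEN isos_hom, THEN hom_types]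
  note jcomm = pushout_comm[OF po_j2] pushout_comm[OF po_j1]
    pushout_comm[OF P.po_j2] pushout_comm[OF P.po_j1]
  have \<kappa>jb: "\<kappa>2 \<odot> jb2 = jb2'" "\<kappa>1 \<odot> jb1 = jb1'"
  proof -
    have "c2' \<odot> (\<kappa>2 \<odot> jb2) = c2' \<odot> jb2'" "c1' \<odot> (\<kappa>1 \<odot> jb1) = c1' \<odot> jb1'"
      using \<kappa>2(2)[THEN comp_eq, of jb2] \<kappa>1(2)[THEN comp_eq, of jb1]
        \<psi>(2)[THEN comp_eq, of i2] \<psi>(3)[THEN comp_eq, of o1] by (simp_all flip: jcomm)
    moreover have "k2' \<odot> (\<kappa>2 \<odot> jb2) = k2' \<odot> jb2'" "k1' \<odot> (\<kappa>1 \<odot> jb1) = k1' \<odot> jb1'"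
      by (simp_all add: \<kappa>2(3)[THEN comp_eq] \<kappa>1(3)[THEN comp_eq] k_jb P.k_jb eqs)
    ultimately show "\<kappa>2 \<odot> jb2 = jb2'" "\<kappa>1 \<odot> jb1 = jb1'"
      using pullback_cancel[OF P.pb_c2 P.composite_types(4), of "\<kappa>2 \<odot> jb2" K2 jb2']
        pullback_cancel[OF P.pb_c1 P.composite_types(6), of "\<kappa>1 \<odot> jb1" K1 jb1']
      by (simp_all add: hom_iff)
  qed
  obtain \<iota> where \<iota>: "\<iota> \<in> isos C I21 I21'" "\<iota> \<odot> s = s'" "\<iota> \<odot> t = t' \<odot> \<kappa>1"
    using pushout_iso[OF po_st P.po_st rule_types(2) composite_types(5,7,8)
        rule_types(2) P.composite_types(5,7,8) Ident_isos[of K1] Ident_isos[of I1] \<kappa>1(1)]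
    by (auto simp: \<kappa>jb)
  obtain \<kappa> where \<kappa>: "\<kappa> \<in> isos C K21 K21'" "p' \<odot> \<kappa> = \<kappa>2 \<odot> p" "q' \<odot> \<kappa> = \<kappa>1 \<odot> q"
    using pullback_iso[OF pb_pq P.pb_pq composite_types(4,6,9,10) P.composite_types(4,6,9,10)
        \<kappa>2(1) \<kappa>1(1) \<psi>(1) \<kappa>2(2) \<kappa>1(2)] by metis
  obtain \<chi> where \<chi>: "\<chi> \<in> isos C Z Z'" "a' \<odot> \<chi> = \<beta> \<odot> a" "b' \<odot> \<chi> = \<alpha> \<odot> b"
    using pullback_iso[OF pb_ab P.pb_ab sequence_types(8,5) link_types(4,5)
        P.sequence_types(8,5) P.link_types(4,5) \<beta> \<alpha> \<xi> eqs(7,4)] by metis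
  note [simp] = \<iota>(1)[THEN isos_hom, THEN hom_types] \<kappa>(1)[THEN isos_hom, THEN hom_types]
    \<chi>(1)[THEN isos_hom, THEN hom_types]
  note kcomm = pushout_comm[OF po_k2] pushout_comm[OF po_k1]
    pushout_comm[OF P.po_k2] pushout_comm[OF P.po_k1]
  have \<chi>x: "\<chi> \<odot> x = x' \<odot> \<kappa>"
  proof (rule pullback_cancel[OF P.pb_ab P.link_types(4)])
    show "a' \<odot> (\<chi> \<odot> x) = a' \<odot> (x' \<odot> \<kappa>)"
      using \<kappa>2(3)[THEN comp_eq, of p]
      by (simp add: \<chi>(2)[THEN comp_eq] kcomm[symmetric] kcomm[symmetric, THEN comp_eq] \<kappa>)
    show "b' \<odot> (\<chi> \<odot> x) = b' \<odot> (x' \<odot> \<kappa>)"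
      using \<kappa>1(3)[THEN comp_eq, of q]
      by (simp add: \<chi>(3)[THEN comp_eq] kcomm[symmetric] kcomm[symmetric, THEN comp_eq] \<kappa>)
  qed (simp_all add: hom_iff)
  have "z' \<odot> \<chi> = z"
    using eqs(2)[THEN comp_eq, of b] by (simp flip: z_eq P.z_eq add: \<chi>(3))
  moreover have "w' \<odot> \<iota> = w"
  proof (rule pushout_cancel[OF po_st composite_types(7)])
    show "(w' \<odot> \<iota>) \<odot> s = w \<odot> s"
      by (simp add: \<iota> w_eqs P.w_eqs m1)
    show "(w' \<odot> \<iota>) \<odot> t = w \<odot> t"
      using eqs(2)[THEN comp_eq, of k1] P.w_eqs(2)[THEN comp_eq, of \<kappa>1]
      by (simp add: \<iota> w_eqs \<kappa>1)
  qed (simp_all add: hom_iff)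
  ultimately show ?thesis
    unfolding composite_equiv_iff[OF composite_pred]
    using \<psi> \<kappa>2 \<kappa>1 \<kappa>jb \<iota> \<kappa> \<chi> \<chi>x by blast
qed

text \<open>Dually, the two-step derivation consists of pushouts: \<open>Y0\<close> and
  \<open>Y1\<close> are pushouts of \<open>x\<close>, while \<open>X1\<close> and \<open>X2\<close>
  are the chosen ones. Equations out of them are tested on the pushout cocones.\<close>

lemma sequence_equiv_of_composite_equiv:
  assumes "(((j2, j1, jb2, c2, jb1, c1), (w, x, z)), ((j2', j1', jb2', c2', jb1', c1'), (w', x', z')))
      \<in> composite_equiv C (o2, i2) (o1, i1) X0"
  shows "(((m1, mb1, ib1), (m2, mb2, ib2)), ((m1', mb1', ib1'), (m2', mb2', ib2')))
      \<in> sequence_equiv C (o2, i2) (o1, i1) X0"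
proof -
  note [simp] = all_types[THEN hom_types]
  obtain \<psi> \<kappa>2 \<kappa>1 \<iota> \<kappa> \<chi> where i: "\<psi> \<in> isos C J J'" "\<kappa>2 \<in> isos C L2 L2'" "\<kappa>1 \<in> isos C L1 L1'"
      "\<iota> \<in> isos C I21 I21'" "\<kappa> \<in> isos C K21 K21'" "\<chi> \<in> isos C Z Z'"
    and \<psi>: "\<psi> \<odot> j2 = j2'" "\<psi> \<odot> j1 = j1'"
    and \<kappa>2: "\<kappa>2 \<odot> jb2 = jb2'" "c2' \<odot> \<kappa>2 = \<psi> \<odot> c2"
    and \<kappa>1: "\<kappa>1 \<odot> jb1 = jb1'" "c1' \<odot> \<kappa>1 = \<psi> \<odot> c1"
    and \<iota>: "\<iota> \<odot> s = s'" "\<iota> \<odot> t = t' \<odot> \<kappa>1"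
    and \<kappa>: "p' \<odot> \<kappa> = \<kappa>2 \<odot> p" "q' \<odot> \<kappa> = \<kappa>1 \<odot> q"
    and w: "w' \<odot> \<iota> = w" and \<chi>: "x' \<odot> \<kappa> = \<chi> \<odot> x" and z: "z' \<odot> \<chi> = z"
    using assms unfolding composite_equiv_iff[OF composite_pred] by auto
  note [simp] = i[THEN isos_hom, THEN hom_types]
  have m1: "m1 = m1'"
    using w[THEN comp_eq, of s] by (simp add: \<iota>(1) w_eqs(1) P.w_eqs(1))
  obtain \<alpha> where \<alpha>: "\<alpha> \<in> isos C Y0 Y0'" "\<alpha> \<odot> k1 = k1' \<odot> \<kappa>1" "\<alpha> \<odot> b = b' \<odot> \<chi>"
    using pushout_iso[OF po_k1 P.po_k1 composite_types(10,14) link_types(2,5)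
        P.composite_types(10,14) P.link_types(2,5) i(5,3,6) \<kappa>(2) \<chi>] by metis
  obtain \<beta> where \<beta>: "\<beta> \<in> isos C Y1 Y1'" "\<beta> \<odot> k2 = k2' \<odot> \<kappa>2" "\<beta> \<odot> a = a' \<odot> \<chi>"
    using pushout_iso[OF po_k2 P.po_k2 composite_types(9,14) link_types(3,4)
        P.composite_types(9,14) P.link_types(3,4) i(5,2,6) \<kappa>(1) \<chi>] by metis
  note [simp] = \<alpha>(1)[THEN isos_hom, THEN hom_types] \<beta>(1)[THEN isos_hom, THEN hom_types]
  have mb: "\<alpha> \<odot> mb1 = mb1'" "\<beta> \<odot> mb2 = mb2'"
    using \<alpha>(2)[THEN comp_eq, of jb1] \<beta>(2)[THEN comp_eq, of jb2]
    by (simp_all add: \<kappa>1 \<kappa>2 k_jb P.k_jb)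
  have ib1: "ib1' \<odot> \<alpha> = ib1"
  proof (rule pushout_cancel[OF po_k1 link_types(2)])
    show "(ib1' \<odot> \<alpha>) \<odot> k1 = ib1 \<odot> k1"
      using P.w_eqs(2)[THEN comp_eq, of \<kappa>1] w[THEN comp_eq, of t]
      by (simp add: \<alpha> \<iota> flip: w_eqs)
    show "(ib1' \<odot> \<alpha>) \<odot> b = ib1 \<odot> b"
      using P.z_eq[THEN comp_eq, of \<chi>] by (simp add: \<alpha> z z_eq)
  qed (simp_all add: hom_iff)
  obtain \<xi> where \<xi>: "\<xi> \<in> isos C X1 X1'" "\<xi> \<odot> n1 = n1'" "\<xi> \<odot> d1 = d1' \<odot> \<alpha>"
    using pushout_iso[OF po_out1 P.po_out1 rule_types(1) sequence_types(1,4,5)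
        rule_types(1) P.sequence_types(1,4,5) Ident_isos[of K1] Ident_isos[of O1] \<alpha>(1)]
    by (auto simp: mb)
  note [simp] = \<xi>(1)[THEN isos_hom, THEN hom_types]
  \<comment> \<open>Tested on \<open>J\<close> as a pushout of \<open>O1\<close> and
    \<open>L1\<close>. It links \<open>\<xi>\<close> to the isomorphism of overlaps and so transfers
    the match \<open>m2\<close>, which factors through \<open>y\<close>.\<close>
  have \<xi>y: "\<xi> \<odot> y = y' \<odot> \<psi>"
  proof (rule pushout_cancel[OF po_j1 composite_types(2)])
    show "(\<xi> \<odot> y) \<odot> j1 = (y' \<odot> \<psi>) \<odot> j1"
      by (simp add: y_j P.y_j \<xi> \<psi>)
    show "(\<xi> \<odot> y) \<odot> c1 = (y' \<odot> \<psi>) \<odot> c1"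
      using pullback_comm[OF P.pb_c1, THEN comp_eq, of \<kappa>1] \<xi>(3)[THEN comp_eq, of k1]
      by (simp add: pullback_comm[OF pb_c1] \<alpha> \<kappa>1)
  qed (simp_all add: hom_iff)
  have m2: "\<xi> \<odot> m2 = m2'"
    using \<xi>y[THEN comp_eq, of j2] by (simp add: \<psi> y_j P.y_j)
  have ib2: "ib2' \<odot> \<beta> = \<xi> \<odot> ib2"
  proof (rule pushout_cancel[OF po_k2 link_types(3)])
    show "(ib2' \<odot> \<beta>) \<odot> k2 = (\<xi> \<odot> ib2) \<odot> k2"
      using pullback_comm[OF P.pb_c2, THEN comp_eq, of \<kappa>2] \<xi>y[THEN comp_eq, of c2]
      by (simp add: \<beta> \<kappa>2 flip: pullback_comm[OF pb_c2])
    show "(ib2' \<odot> \<beta>) \<odot> a = (\<xi> \<odot> ib2) \<odot> a"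
      using pullback_comm[OF P.pb_ab, THEN comp_eq, of \<chi>] \<xi>(3)[THEN comp_eq, of b]
      by (simp add: \<beta> \<alpha> pullback_comm[OF pb_ab])
  qed (simp_all add: hom_iff)
  obtain \<zeta> where \<zeta>: "\<zeta> \<in> isos C X2 X2'" "\<zeta> \<odot> n2 = n2'" "\<zeta> \<odot> d2 = d2' \<odot> \<beta>"
    using pushout_iso[OF po_out2 P.po_out2 rule_types(3) sequence_types(7,9,10)
        rule_types(3) P.sequence_types(7,9,10) Ident_isos[of K2] Ident_isos[of O2] \<beta>(1)]
    by (auto simp: mb)
  show ?thesis
    unfolding sequence_equiv_iff[OF sequence_pred]
    using m1 \<alpha>(1) \<xi> \<beta>(1) \<zeta> mb ib1 m2 ib2 by blast
qed

end

section \<open>Transport of equivalences and results along links\<close>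

context rule_pair
begin

lemma linked_mem:
  assumes "linked S T"
  shows "S \<in> match_sequences C (o2, i2) (o1, i1) X0" "T \<in> composite_matches C (o2, i2) (o1, i1) X0"
  using assms by (induction rule: linked.induct) (auto simp: link_def intro: sequence_mem composite_mem)

lemma linked_compat:
  assumes "linked S T" "linked S' T'"
  shows "(S, S') \<in> sequence_equiv C (o2, i2) (o1, i1) X0 \<longleftrightarrow>
    (T, T') \<in> composite_equiv C (o2, i2) (o1, i1) X0"
  using assms(1)
proof (cases rule: linked.cases)
  case L: (linkI m1 mb1 ib1 n1 d1 m2 mb2 ib2 n2 d2 Y0 X1 Y1 X2
      j2 j1 jb2 c2 jb1 c1 s t p q u0 u w x z J L2 L1 I21 K21 O21 Z y k1 k2 a b)
  show ?thesis
    using assms(2)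
  proof (cases rule: linked.cases)
    case L': (linkI m1' mb1' ib1' n1' d1' m2' mb2' ib2' n2' d2' Y0' X1' Y1' X2'
      j2' j1' jb2' c2' jb1' c1' s' t' p' q' u0' u' w' x' z' J' L2' L1' I21' K21' O21' Z' y' k1' k2' a' b')
    interpret two_links C o1 i1 o2 i2 K1 O1 I1 K2 O2 I2 X0
      m1 mb1 ib1 n1 d1 m2 mb2 ib2 n2 d2 Y0 X1 Y1 X2
      j2 j1 jb2 c2 jb1 c1 s t p q u0 u w x z J L2 L1 I21 K21 O21 Z y k1 k2 a b
      m1' mb1' ib1' n1' d1' m2' mb2' ib2' n2' d2' Y0' X1' Y1' X2'
      j2' j1' jb2' c2' jb1' c1' s' t' p' q' u0' u' w' x' z' J' L2' L1' I21' K21' O21' Z' y' k1' k2' a' b'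
      using L(3) L'(3) by (rule two_links.intro)
    show ?thesis
      unfolding L(1,2) L'(1,2)
      using composite_equiv_of_sequence_equiv sequence_equiv_of_composite_equiv by blast
  qed
qed

lemma ex_linked_sequence:
  assumes "S \<in> match_sequences C (o2, i2) (o1, i1) X0"
  shows "\<exists>T. linked S T"
  using assms by (rule match_sequencesE) (blast dest: sequence.ex_linked)

lemma ex_linked_composite:
  assumes "T \<in> composite_matches C (o2, i2) (o1, i1) X0"
  shows "\<exists>S. linked S T"
  using assms by (rule composite_matchesE) (blast dest: composite.ex_linked)

text \<open>Every composite derivation has a linked two-step derivation, and
  \<open>linked_compat\<close> translates each law of an equivalence into the one already known for
  \<open>sequence_equiv\<close>.\<close>

lemma equiv_composite_equiv:
  "equiv (composite_matches C (o2, i2) (o1, i1) X0) (composite_equiv C (o2, i2) (o1, i1) X0)"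
proof (rule equivI[OF composite_equiv_subset])
  note eq = equiv_sequence_equiv
  show "refl_on (composite_matches C (o2, i2) (o1, i1) X0) (composite_equiv C (o2, i2) (o1, i1) X0)"
  proof (rule refl_onI)
    fix T
    assume "T \<in> composite_matches C (o2, i2) (o1, i1) X0"
    then obtain S where L: "linked S T" using ex_linked_composite by blast
    then have "(S, S) \<in> sequence_equiv C (o2, i2) (o1, i1) X0"
      using eq linked_mem(1) by (simp add: equiv_def refl_on_def)
    then show "(T, T) \<in> composite_equiv C (o2, i2) (o1, i1) X0"
      using linked_compat[OF L L] by simp
  qed
  show "sym (composite_equiv C (o2, i2) (o1, i1) X0)"
  proof (rule symI)
    fix T T'
    assume *: "(T, T') \<in> composite_equiv C (o2, i2) (o1, i1) X0"
    obtain S S' where L: "linked S T" "linked S' T'"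
      using * composite_equiv_subset ex_linked_composite by blast
    have "(S', S) \<in> sequence_equiv C (o2, i2) (o1, i1) X0"
      using * linked_compat[OF L] eq by (auto simp: equiv_def dest: symD)
    then show "(T', T) \<in> composite_equiv C (o2, i2) (o1, i1) X0"
      using linked_compat[OF L(2,1)] by simp
  qed
  show "trans (composite_equiv C (o2, i2) (o1, i1) X0)"
  proof (rule transI)
    fix T T' T''
    assume *: "(T, T') \<in> composite_equiv C (o2, i2) (o1, i1) X0"
      "(T', T'') \<in> composite_equiv C (o2, i2) (o1, i1) X0"
    obtain S S' S'' where L: "linked S T" "linked S' T'" "linked S'' T''"
      using *[THEN subsetD[OF composite_equiv_subset]] ex_linked_composite by (metis mem_Sigma_iff)
    have "(S, S'') \<in> sequence_equiv C (o2, i2) (o1, i1) X0"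
      using * linked_compat[OF L(1,2)] linked_compat[OF L(2,3)] eq
      by (meson equivE transE)
    then show "(T, T'') \<in> composite_equiv C (o2, i2) (o1, i1) X0"
      using linked_compat[OF L(1,3)] by simp
  qed
qed

lemma linked_result:
  assumes "linked (m1, m2) (\<mu>, m21)"
  shows "isomorphic C (dpo_result C (o2, i2) m2)
    (dpo_result C (dpo_compose C (o2, i2) \<mu> (o1, i1)) m21)"
  using assms
proof (cases rule: linked.cases)
  case L: (linkI m1 mb1 ib1 n1 d1 m2 mb2 ib2 n2 d2 Y0 X1 Y1 X2
      j2 j1 jb2 c2 jb1 c1 s t p q u0 u w x z J L2 L1 I21 K21 O21 Z y k1 k2 a b)
  interpret link C o1 i1 o2 i2 K1 O1 I1 K2 O2 I2 X0
      m1 mb1 ib1 n1 d1 m2 mb2 ib2 n2 d2 Y0 X1 Y1 X2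
      j2 j1 jb2 c2 jb1 c1 s t p q u0 u w x z J L2 L1 I21 K21 O21 Z y k1 k2 a b
    by (fact L)
  show ?thesis
    using result_isomorphic sequence_types(9) unfolding L(1-4)
    by (simp add: dpo_compose_eq) (simp add: dpo_result_def po_eq2 hom_iff)
qed

text \<open>The component \<open>\<zeta>\<close> is the isomorphism. This is needed because a member
  of the image of a class may be linked to a representative other than the given one.\<close>

lemma sequence_equiv_result:
  assumes "((m1, m2), (m1', m2')) \<in> sequence_equiv C (o2, i2) (o1, i1) X0"
  shows "isomorphic C (dpo_result C (o2, i2) m2) (dpo_result C (o2, i2) m2')"
  using assms
  by (cases m1; cases m2; cases m1'; cases m2')
    (auto simp: sequence_equiv_def dpo_result_def isomorphic_def split: prod.splits)

end

theorem theorem4: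
  fixes C :: "('o, 'a) cat" and X0 :: 'o and r1 r2 :: "'a \<times> 'a"
  assumes "rm_adhesive C" and "X0 \<in> Obj C" and "is_span C r1" and "is_span C r2"
  shows
    "(\<forall>m1 \<in> dpo_matches C r1 X0. \<forall>m2 \<in> dpo_matches C r2 (dpo_result C r1 m1).
        \<exists>\<mu> \<in> dpo_rule_matches C r2 r1. \<exists>m21 \<in> dpo_matches C (dpo_compose C r2 \<mu> r1) X0.
          isomorphic C (dpo_result C (dpo_compose C r2 \<mu> r1) m21) (dpo_result C r2 m2)) \<and>
     (\<forall>\<mu> \<in> dpo_rule_matches C r2 r1. \<forall>m21 \<in> dpo_matches C (dpo_compose C r2 \<mu> r1) X0.
        \<exists>m1 \<in> dpo_matches C r1 X0. \<exists>m2 \<in> dpo_matches C r2 (dpo_result C r1 m1).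
          isomorphic C (dpo_result C r2 m2) (dpo_result C (dpo_compose C r2 \<mu> r1) m21)) \<and>
     (finitary C \<longrightarrow>
        (\<exists>\<Phi>. bij_betw \<Phi> (match_sequences C r2 r1 X0 // sequence_equiv C r2 r1 X0)
                       (composite_matches C r2 r1 X0 // composite_equiv C r2 r1 X0) \<and>
             (\<forall>S \<in> match_sequences C r2 r1 X0 // sequence_equiv C r2 r1 X0.
                \<forall>(m1, m2) \<in> S. \<forall>(\<mu>, m21) \<in> \<Phi> S.
                  isomorphic C (dpo_result C r2 m2) (dpo_result C (dpo_compose C r2 \<mu> r1) m21))))"
proof -
  obtain o1 i1 o2 i2 where r: "r1 = (o1, i1)" "r2 = (o2, i2)" by (metis prod.exhaust)
  interpret rule_pair C o1 i1 o2 i2 "Src C o1" "Tgt C o1" "Tgt C i1" "Src C o2" "Tgt C o2" "Tgt C i2" X0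
    using assms by unfold_locales (auto simp: r is_span_def hom_def)
  \<comment> \<open>A class goes to everything linked to one of its members, so no representative
    has to be chosen.\<close>
  define \<Phi> where "\<Phi> = (\<lambda>S. {T. \<exists>s\<in>S. linked s T})"
  have synthesis: "\<exists>\<mu> \<in> dpo_rule_matches C r2 r1. \<exists>m21 \<in> dpo_matches C (dpo_compose C r2 \<mu> r1) X0.
      isomorphic C (dpo_result C (dpo_compose C r2 \<mu> r1) m21) (dpo_result C r2 m2)"
    if "m1 \<in> dpo_matches C r1 X0" "m2 \<in> dpo_matches C r2 (dpo_result C r1 m1)" for m1 m2
  proof -
    have "(m1, m2) \<in> match_sequences C (o2, i2) (o1, i1) X0"
      using that by (simp add: match_sequences_def r)
    then obtain T where "linked (m1, m2) T" using ex_linked_sequence by blast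
    then obtain \<mu> m21 where L: "linked (m1, m2) (\<mu>, m21)" by (metis surj_pair)
    then show ?thesis
      using linked_mem(2)[OF L] isomorphic_sym[OF linked_result[OF L]]
      by (auto simp: composite_matches_def r)
  qed
  have analysis: "\<exists>m1 \<in> dpo_matches C r1 X0. \<exists>m2 \<in> dpo_matches C r2 (dpo_result C r1 m1).
      isomorphic C (dpo_result C r2 m2) (dpo_result C (dpo_compose C r2 \<mu> r1) m21)"
    if "\<mu> \<in> dpo_rule_matches C r2 r1" "m21 \<in> dpo_matches C (dpo_compose C r2 \<mu> r1) X0" for \<mu> m21
  proof -
    have "(\<mu>, m21) \<in> composite_matches C (o2, i2) (o1, i1) X0"
      using that by (simp add: composite_matches_def r)
    then obtain S where "linked S (\<mu>, m21)" using ex_linked_composite by blast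
    then obtain m1 m2 where L: "linked (m1, m2) (\<mu>, m21)" by (metis surj_pair)
    then show ?thesis
      using linked_mem(1)[OF L] linked_result[OF L] by (auto simp: match_sequences_def r)
  qed
  have bij: "bij_betw \<Phi> (match_sequences C r2 r1 X0 // sequence_equiv C r2 r1 X0)
      (composite_matches C r2 r1 X0 // composite_equiv C r2 r1 X0)"
    unfolding \<Phi>_def r
    by (rule quotient_bij_of_relation[OF equiv_sequence_equiv equiv_composite_equiv])
      (use ex_linked_sequence ex_linked_composite linked_mem linked_compat in blast)+
  have results: "isomorphic C (dpo_result C r2 m2) (dpo_result C (dpo_compose C r2 \<mu> r1) m21)"
    if S: "S \<in> match_sequences C r2 r1 X0 // sequence_equiv C r2 r1 X0"
      and m: "(m1, m2) \<in> S" and \<mu>: "(\<mu>, m21) \<in> \<Phi> S" for S m1 m2 \<mu> m21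
  proof -
    obtain m1' m2' where S': "(m1', m2') \<in> S" and L: "linked (m1', m2') (\<mu>, m21)"
      using \<mu> by (auto simp: \<Phi>_def)
    have "((m1, m2), (m1', m2')) \<in> sequence_equiv C (o2, i2) (o1, i1) X0"
      using quotient_eq_iff[OF equiv_sequence_equiv S[unfolded r] S[unfolded r] m S'] by simp
    from isomorphic_trans[OF sequence_equiv_result[OF this] linked_result[OF L]]
    show ?thesis unfolding r .
  qed
  show ?thesis
    using synthesis analysis bij results by blast
qed

end
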